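(* For every integer $n\ge3$ there exists a nontrivial compact generalized steady soliton of dimension $n$; that is, there exist a compact smooth $n$-manifold $M$, a Riemannian metric $g$, a closed $3$-form $H$ and a non-constant function $f\in C^\infty(M)$ such that $$\mathrm{Rc}-\tfrac14H^2+\nabla^2f=0,\qquad \tfrac12d^*H+i_{\frac12\nabla f}H=0 .$$
   Context: Here $\mathrm{Rc}$ is the Ricci tensor and $\nabla$ the Levi-Civita connection of $g$, $(H^2)_{ij}=H_{ipq}H_j{}^{pq}$, $d^*$ is the adjoint of $d$ with respect to $g$, and $i_X$ is interior product. The displayed system is the steady soliton system of the generalized Ricci flow $\partial_t g=-2\mathrm{Rc}+\tfrac12H^2$, $\partial_tH=\Delta_dH$, with $H$ closed. *)

theory Defs
  imports "HOL-Analysis.Analysis"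
begin

section \<open>Smooth functions on open subsets of Euclidean space\<close>

fun Ck_on :: "nat \<Rightarrow> 'a::euclidean_space set \<Rightarrow> ('a \<Rightarrow> 'b::real_normed_vector) \<Rightarrow> bool" where
  "Ck_on 0 S f \<longleftrightarrow> continuous_on S f"
| "Ck_on (Suc k) S f \<longleftrightarrow>
     (\<forall>x\<in>S. f differentiable (at x)) \<and>
     (\<forall>v. Ck_on k S (\<lambda>x. frechet_derivative f (at x) v))"

definition smooth_on :: "'a::euclidean_space set \<Rightarrow> ('a \<Rightarrow> 'b::real_normed_vector) \<Rightarrow> bool" where
  "smooth_on S f \<longleftrightarrow> (\<forall>k. Ck_on k S f)"

definition pd :: "'n::finite \<Rightarrow> (real^'n \<Rightarrow> real) \<Rightarrow> real^'n \<Rightarrow> real" where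
  "pd i f x = frechet_derivative f (at x) (axis i 1)"


section \<open>Manifolds\<close>

type_synonym ('a, 'n) chart = "'a set \<times> ('a \<Rightarrow> real^'n)"

abbreviation cdom :: "('a, 'n) chart \<Rightarrow> 'a set" where "cdom c \<equiv> fst c"
abbreviation coord :: "('a, 'n) chart \<Rightarrow> 'a \<Rightarrow> real^'n" where "coord c \<equiv> snd c"

definition img :: "('a, 'n) chart \<Rightarrow> (real^'n) set" where
  "img c = coord c ` cdom c"

definition pt :: "('a, 'n) chart \<Rightarrow> real^'n \<Rightarrow> 'a" where
  "pt c = inv_into (cdom c) (coord c)"

definition transition :: "('a, 'n) chart \<Rightarrow> ('a, 'n) chart \<Rightarrow> real^'n \<Rightarrow> real^'n" where
  "transition c d x = coord d (pt c x)"

definition overlap :: "('a, 'n) chart \<Rightarrow> ('a, 'n) chart \<Rightarrow> (real^'n) set" where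
  "overlap c d = coord c ` (cdom c \<inter> cdom d)"

text \<open>The atlas is not required to be maximal: any smooth atlas determines the smooth structure.\<close>

definition smooth_manifold :: "'a topology \<Rightarrow> ('a, 'n::finite) chart set \<Rightarrow> bool" where
  "smooth_manifold X A \<longleftrightarrow>
     Hausdorff_space X \<and> second_countable X \<and>
     (\<Union>c\<in>A. cdom c) = topspace X \<and>
     (\<forall>c\<in>A. openin X (cdom c) \<and> open (img c) \<and>
        homeomorphic_map (subtopology X (cdom c)) (top_of_set (img c)) (coord c)) \<and>
     (\<forall>c\<in>A. \<forall>d\<in>A. smooth_on (overlap c d) (transition c d))"

definition smooth_function :: "('a, 'n::finite) chart set \<Rightarrow> ('a \<Rightarrow> real) \<Rightarrow> bool" where
  "smooth_function A f \<longleftrightarrow> (\<forall>c\<in>A. smooth_on (img c) (f \<circ> pt c))"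


section \<open>Covariant tensor fields\<close>

text \<open>A covariant tensor field is given by its component functions in every chart; \<open>T c x i j\<close> is
  the \<open>ij\<close>-component, in the coordinates of \<open>c\<close>, at the point with coordinates \<open>x \<in> img c\<close>. The
  values for \<open>c\<close> outside the atlas or \<open>x\<close> outside \<open>img c\<close> are irrelevant. The families are
  constrained by the usual transformation law on chart overlaps.\<close>

type_synonym ('a, 'n) tensor2 = "('a, 'n) chart \<Rightarrow> real^'n \<Rightarrow> 'n \<Rightarrow> 'n \<Rightarrow> real"
type_synonym ('a, 'n) tensor3 = "('a, 'n) chart \<Rightarrow> real^'n \<Rightarrow> 'n \<Rightarrow> 'n \<Rightarrow> 'n \<Rightarrow> real"

text \<open>\<open>jac c d x k i\<close> is \<open>\<partial>y\<^sup>k/\<partial>x\<^sup>i\<close>, where \<open>x\<close> and \<open>y\<close> are the coordinates of \<open>c\<close> and \<open>d\<close>.\<close>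

definition jac :: "('a, 'n::finite) chart \<Rightarrow> ('a, 'n) chart \<Rightarrow> real^'n \<Rightarrow> 'n \<Rightarrow> 'n \<Rightarrow> real" where
  "jac c d x k i = frechet_derivative (transition c d) (at x) (axis i 1) $ k"

definition smooth_tensor2 :: "('a, 'n::finite) chart set \<Rightarrow> ('a, 'n) tensor2 \<Rightarrow> bool" where
  "smooth_tensor2 A T \<longleftrightarrow>
     (\<forall>c\<in>A. \<forall>i j. smooth_on (img c) (\<lambda>x. T c x i j)) \<and>
     (\<forall>c\<in>A. \<forall>d\<in>A. \<forall>x\<in>overlap c d. \<forall>i j.
        T c x i j =
          (\<Sum>k\<in>UNIV. \<Sum>l\<in>UNIV. jac c d x k i * jac c d x l j * T d (transition c d x) k l))"

definition smooth_tensor3 :: "('a, 'n::finite) chart set \<Rightarrow> ('a, 'n) tensor3 \<Rightarrow> bool" where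
  "smooth_tensor3 A T \<longleftrightarrow>
     (\<forall>c\<in>A. \<forall>i j k. smooth_on (img c) (\<lambda>x. T c x i j k)) \<and>
     (\<forall>c\<in>A. \<forall>d\<in>A. \<forall>x\<in>overlap c d. \<forall>i j k.
        T c x i j k =
          (\<Sum>p\<in>UNIV. \<Sum>q\<in>UNIV. \<Sum>r\<in>UNIV.
             jac c d x p i * jac c d x q j * jac c d x r k * T d (transition c d x) p q r))"

definition two_form :: "('a, 'n::finite) chart set \<Rightarrow> ('a, 'n) tensor2 \<Rightarrow> bool" where
  "two_form A \<alpha> \<longleftrightarrow> smooth_tensor2 A \<alpha> \<and>
     (\<forall>c\<in>A. \<forall>x\<in>img c. \<forall>i j. \<alpha> c x j i = - \<alpha> c x i j)"

definition three_form :: "('a, 'n::finite) chart set \<Rightarrow> ('a, 'n) tensor3 \<Rightarrow> bool" where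
  "three_form A H \<longleftrightarrow> smooth_tensor3 A H \<and>
     (\<forall>c\<in>A. \<forall>x\<in>img c. \<forall>i j k. H c x j i k = - H c x i j k \<and> H c x i k j = - H c x i j k)"

definition ext_deriv2 :: "('a, 'n::finite) tensor2 \<Rightarrow> ('a, 'n) tensor3" where
  "ext_deriv2 \<alpha> c x i j k =
     pd i (\<lambda>y. \<alpha> c y j k) x - pd j (\<lambda>y. \<alpha> c y i k) x + pd k (\<lambda>y. \<alpha> c y i j) x"

definition ext_deriv3 ::
  "('a, 'n::finite) tensor3 \<Rightarrow> ('a, 'n) chart \<Rightarrow> real^'n \<Rightarrow> 'n \<Rightarrow> 'n \<Rightarrow> 'n \<Rightarrow> 'n \<Rightarrow> real" where
  "ext_deriv3 H c x i j k l =
     pd i (\<lambda>y. H c y j k l) x - pd j (\<lambda>y. H c y i k l) x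
     + pd k (\<lambda>y. H c y i j l) x - pd l (\<lambda>y. H c y i j k) x"

definition closed_three_form :: "('a, 'n::finite) chart set \<Rightarrow> ('a, 'n) tensor3 \<Rightarrow> bool" where
  "closed_three_form A H \<longleftrightarrow> three_form A H \<and>
     (\<forall>c\<in>A. \<forall>x\<in>img c. \<forall>i j k l. ext_deriv3 H c x i j k l = 0)"


section \<open>Riemannian metrics and their Levi-Civita connection\<close>

definition riemannian_metric :: "('a, 'n::finite) chart set \<Rightarrow> ('a, 'n) tensor2 \<Rightarrow> bool" where
  "riemannian_metric A g \<longleftrightarrow> smooth_tensor2 A g \<and>
     (\<forall>c\<in>A. \<forall>x\<in>img c.
        (\<forall>i j. g c x i j = g c x j i) \<and>
        (\<forall>v::real^'n. v \<noteq> 0 \<longrightarrow> (\<Sum>i\<in>UNIV. \<Sum>j\<in>UNIV. g c x i j * v $ i * v $ j) > 0))"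

definition metric_matrix ::
  "('a, 'n::finite) tensor2 \<Rightarrow> ('a, 'n) chart \<Rightarrow> real^'n \<Rightarrow> real^'n^'n" where
  "metric_matrix g c x = (\<chi> i j. g c x i j)"

definition ginv ::
  "('a, 'n::finite) tensor2 \<Rightarrow> ('a, 'n) chart \<Rightarrow> real^'n \<Rightarrow> 'n \<Rightarrow> 'n \<Rightarrow> real" where
  "ginv g c x i j = matrix_inv (metric_matrix g c x) $ i $ j"

text \<open>\<open>christoffel g c x l i j\<close> is \<open>\<Gamma>\<^sup>l\<^sub>i\<^sub>j\<close>, i.e. the \<open>l\<close>-component of \<open>\<nabla>\<^sub>i \<partial>\<^sub>j\<close>. The lemmas
  below show that this is the unique torsion-free metric connection.\<close>

definition christoffel ::
  "('a, 'n::finite) tensor2 \<Rightarrow> ('a, 'n) chart \<Rightarrow> real^'n \<Rightarrow> 'n \<Rightarrow> 'n \<Rightarrow> 'n \<Rightarrow> real" where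
  "christoffel g c x l i j =
     (\<Sum>m\<in>UNIV. ginv g c x l m *
        (pd i (\<lambda>y. g c y j m) x + pd j (\<lambda>y. g c y i m) x - pd m (\<lambda>y. g c y i j) x)) / 2"

lemma pd_metric_sym:
  fixes g :: "('a, 'n::finite) tensor2"
  assumes g: "riemannian_metric A g" and A: "smooth_manifold X A" and c: "c \<in> A" "x \<in> img c"
  shows "pd k (\<lambda>y. g c y i j) x = pd k (\<lambda>y. g c y j i) x"
proof -
  have op: "open (img c)" using A c by (auto simp: smooth_manifold_def)
  have eq: "g c y i j = g c y j i" if "y \<in> img c" for y i j
    using g c that unfolding riemannian_metric_def by blast
  have imp: "((\<lambda>y. g c y b a) has_derivative D) (at x)"
    if "((\<lambda>y. g c y a b) has_derivative D) (at x)" for D a b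
    by (rule has_derivative_transform_within_open[OF that op c(2)]) (rule eq)
  have "((\<lambda>y. g c y i j) has_derivative D) (at x) \<longleftrightarrow> ((\<lambda>y. g c y j i) has_derivative D) (at x)" for D
    by (rule iffI) (rule imp, assumption)+
  then show ?thesis by (simp add: pd_def frechet_derivative_def)
qed

lemma metric_matrix_inverse:
  fixes g :: "('a, 'n::finite) tensor2"
  assumes g: "riemannian_metric A g" and c: "c \<in> A" "x \<in> img c"
  shows "(\<Sum>m\<in>UNIV. ginv g c x i m * g c x m j) = (if i = j then 1 else 0)"
    and "(\<Sum>m\<in>UNIV. g c x i m * ginv g c x m j) = (if i = j then 1 else 0)"
proof -
  let ?G = "metric_matrix g c x"
  have "v = 0" if "?G *v v = 0" for v :: "real^'n"
  proof (rule ccontr)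
    assume "v \<noteq> 0"
    then have "0 < (\<Sum>i\<in>UNIV. \<Sum>j\<in>UNIV. g c x i j * v $ i * v $ j)"
      using g c unfolding riemannian_metric_def by blast
    also have "\<dots> = v \<bullet> (?G *v v)"
      by (simp add: inner_vec_def matrix_vector_mult_def metric_matrix_def sum_distrib_left mult_ac)
    finally show False using that by simp
  qed
  then obtain B where "B ** ?G = mat 1"
    using matrix_left_invertible_ker by blast
  then have "\<exists>B. ?G ** B = mat 1 \<and> B ** ?G = mat 1"
    using matrix_left_right_inverse by blast
  then have 1: "matrix_inv ?G ** ?G = mat 1" "?G ** matrix_inv ?G = mat 1"
    unfolding matrix_inv_def by (metis (mono_tags, lifting) someI_ex)+
  show "(\<Sum>m\<in>UNIV. ginv g c x i m * g c x m j) = (if i = j then 1 else 0)"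
    using arg_cong[OF 1(1), of "\<lambda>M. M $ i $ j"]
    by (simp add: matrix_matrix_mult_def mat_def ginv_def metric_matrix_def)
  show "(\<Sum>m\<in>UNIV. g c x i m * ginv g c x m j) = (if i = j then 1 else 0)"
    using arg_cong[OF 1(2), of "\<lambda>M. M $ i $ j"]
    by (simp add: matrix_matrix_mult_def mat_def ginv_def metric_matrix_def)
qed

lemma christoffel_torsion_free:
  fixes g :: "('a, 'n::finite) tensor2"
  assumes "riemannian_metric A g" "smooth_manifold X A" "c \<in> A" "x \<in> img c"
  shows "christoffel g c x l i j = christoffel g c x l j i"
proof -
  have "pd i (\<lambda>y. g c y j m) x + pd j (\<lambda>y. g c y i m) x - pd m (\<lambda>y. g c y i j) x
      = pd j (\<lambda>y. g c y i m) x + pd i (\<lambda>y. g c y j m) x - pd m (\<lambda>y. g c y j i) x" for m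
    by (simp only: pd_metric_sym[OF assms, of m i j] add.commute)
  then show ?thesis unfolding christoffel_def by (simp only:)
qed

lemma christoffel_lower:
  fixes g :: "('a, 'n::finite) tensor2"
  assumes g: "riemannian_metric A g" and c: "c \<in> A" "x \<in> img c"
  shows "(\<Sum>l\<in>UNIV. christoffel g c x l i j * g c x l k) =
    (pd i (\<lambda>y. g c y j k) x + pd j (\<lambda>y. g c y i k) x - pd k (\<lambda>y. g c y i j) x) / 2"
proof -
  let ?P = "\<lambda>m. pd i (\<lambda>y. g c y j m) x + pd j (\<lambda>y. g c y i m) x - pd m (\<lambda>y. g c y i j) x"
  have sym: "g c x l k = g c x k l" for l
    using g c unfolding riemannian_metric_def by blast
  have "(\<Sum>l\<in>UNIV. christoffel g c x l i j * g c x l k)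
      = (\<Sum>l\<in>UNIV. \<Sum>m\<in>UNIV. g c x k l * ginv g c x l m * ?P m / 2)"
    by (rule sum.cong[OF refl])
      (simp add: christoffel_def sym sum_distrib_left sum_distrib_right sum_divide_distrib mult_ac)
  also have "\<dots> = (\<Sum>m\<in>UNIV. (\<Sum>l\<in>UNIV. g c x k l * ginv g c x l m) * (?P m / 2))"
    by (subst sum.swap) (simp add: sum_distrib_right sum_divide_distrib)
  also have "\<dots> = (\<Sum>m\<in>UNIV. if k = m then ?P m / 2 else 0)"
    by (rule sum.cong[OF refl]) (simp add: metric_matrix_inverse(2)[OF g c])
  also have "\<dots> = ?P k / 2" by simp
  finally show ?thesis .
qed

lemma christoffel_metric:
  fixes g :: "('a, 'n::finite) tensor2"
  assumes "riemannian_metric A g" "smooth_manifold X A" "c \<in> A" "x \<in> img c"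
  shows "pd k (\<lambda>y. g c y i j) x =
    (\<Sum>l\<in>UNIV. christoffel g c x l k i * g c x l j) + (\<Sum>l\<in>UNIV. christoffel g c x l k j * g c x l i)"
proof -
  have aux: "a = (a + b - d) / 2 + (a' + d' - b') / 2" if "a = a'" "b = b'" "d = d'"
    for a a' b b' d d' :: real using that by argo
  show ?thesis
    unfolding christoffel_lower[OF assms(1,3,4)]
    by (rule aux) (rule pd_metric_sym[OF assms] refl)+
qed

lemma christoffel_unique:
  fixes g :: "('a, 'n::finite) tensor2"
  assumes "riemannian_metric A g" "smooth_manifold X A" "c \<in> A" "x \<in> img c"
    and tf: "\<And>l i j. \<Gamma> l i j = \<Gamma> l j i"
    and mc: "\<And>i j k. pd k (\<lambda>y. g c y i j) x =
      (\<Sum>l\<in>UNIV. \<Gamma> l k i * g c x l j) + (\<Sum>l\<in>UNIV. \<Gamma> l k j * g c x l i)"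
  shows "\<Gamma> l i j = christoffel g c x l i j"
proof -
  define L where "L i j k = (\<Sum>l\<in>UNIV. \<Gamma> l i j * g c x l k)" for i j k
  have L_sym: "L i j k = L j i k" for i j k using tf by (simp add: L_def)
  have aux: "u = (a + b - d) / 2" if "a = u + v" "b = u + w" "d = v + w" for a b d u v w :: real
    using that by argo
  have L: "L i j k = (\<Sum>l\<in>UNIV. christoffel g c x l i j * g c x l k)" for k
    unfolding christoffel_lower[OF assms(1,3,4)]
  proof (rule aux)
    show "pd i (\<lambda>y. g c y j k) x = L i j k + L i k j"
      unfolding L_def by (rule mc)
    show "pd j (\<lambda>y. g c y i k) x = L i j k + L j k i"
      unfolding L_sym[of i j k] unfolding L_def by (rule mc)
    show "pd k (\<lambda>y. g c y i j) x = L i k j + L j k i"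
      unfolding L_sym[of i k j] L_sym[of j k i] unfolding L_def by (rule mc)
  qed
  have sym: "g c x k l = g c x l k" for k l
    using assms(1,3,4) unfolding riemannian_metric_def by blast
  have raise: "D l = (\<Sum>k\<in>UNIV. ginv g c x l k * (\<Sum>m\<in>UNIV. D m * g c x m k))" for D :: "'n \<Rightarrow> real"
  proof -
    have "(\<Sum>k\<in>UNIV. ginv g c x l k * (\<Sum>m\<in>UNIV. D m * g c x m k))
        = (\<Sum>k\<in>UNIV. \<Sum>m\<in>UNIV. ginv g c x l k * g c x k m * D m)"
      by (simp add: sum_distrib_left sym mult_ac)
    also have "\<dots> = (\<Sum>m\<in>UNIV. (\<Sum>k\<in>UNIV. ginv g c x l k * g c x k m) * D m)"
      by (subst sum.swap) (simp add: sum_distrib_right)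
    also have "\<dots> = (\<Sum>m\<in>UNIV. if l = m then D m else 0)"
      by (rule sum.cong[OF refl]) (simp add: metric_matrix_inverse(1)[OF assms(1,3,4)])
    finally show ?thesis by simp
  qed
  have "\<Gamma> l i j = (\<Sum>k\<in>UNIV. ginv g c x l k * L i j k)"
    unfolding L_def by (rule raise)
  also have "\<dots> = christoffel g c x l i j"
    unfolding L by (rule raise[symmetric])
  finally show ?thesis .
qed

text \<open>\<open>riemann g c x l i j k\<close> is the \<open>l\<close>-component of \<open>R(\<partial>\<^sub>i, \<partial>\<^sub>j) \<partial>\<^sub>k\<close>, where
  \<open>R(X, Y) = [\<nabla>\<^sub>X, \<nabla>\<^sub>Y] - \<nabla>\<^bsub>[X, Y]\<^esub>\<close>.\<close>

definition riemann ::
  "('a, 'n::finite) tensor2 \<Rightarrow> ('a, 'n) chart \<Rightarrow> real^'n \<Rightarrow> 'n \<Rightarrow> 'n \<Rightarrow> 'n \<Rightarrow> 'n \<Rightarrow> real" where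
  "riemann g c x l i j k =
     pd i (\<lambda>y. christoffel g c y l j k) x - pd j (\<lambda>y. christoffel g c y l i k) x
     + (\<Sum>p\<in>UNIV. christoffel g c x l i p * christoffel g c x p j k
                 - christoffel g c x l j p * christoffel g c x p i k)"

definition ricci :: "('a, 'n::finite) tensor2 \<Rightarrow> ('a, 'n) tensor2" where
  "ricci g c x j k = (\<Sum>i\<in>UNIV. riemann g c x i i j k)"

definition hessian :: "('a, 'n::finite) tensor2 \<Rightarrow> ('a \<Rightarrow> real) \<Rightarrow> ('a, 'n) tensor2" where
  "hessian g f c x i j =
     pd i (pd j (f \<circ> pt c)) x - (\<Sum>k\<in>UNIV. christoffel g c x k i j * pd k (f \<circ> pt c) x)"

definition gradient ::
  "('a, 'n::finite) tensor2 \<Rightarrow> ('a \<Rightarrow> real) \<Rightarrow> ('a, 'n) chart \<Rightarrow> real^'n \<Rightarrow> 'n \<Rightarrow> real" where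
  "gradient g f c x k = (\<Sum>l\<in>UNIV. ginv g c x k l * pd l (f \<circ> pt c) x)"

definition interior_product ::
  "(('a, 'n::finite) chart \<Rightarrow> real^'n \<Rightarrow> 'n \<Rightarrow> real) \<Rightarrow> ('a, 'n) tensor3 \<Rightarrow> ('a, 'n) tensor2" where
  "interior_product V H c x i j = (\<Sum>k\<in>UNIV. V c x k * H c x k i j)"

definition H_squared :: "('a, 'n::finite) tensor2 \<Rightarrow> ('a, 'n) tensor3 \<Rightarrow> ('a, 'n) tensor2" where
  "H_squared g H c x i j =
     (\<Sum>p\<in>UNIV. \<Sum>q\<in>UNIV. \<Sum>r\<in>UNIV. \<Sum>s\<in>UNIV.
        ginv g c x p r * ginv g c x q s * H c x i p q * H c x j r s)"


section \<open>The adjoint of the exterior derivative\<close>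

text \<open>The Riemannian measure is the unique Borel measure with density \<open>\<surd>det g\<close> in every chart; this
  makes sense without an orientation.\<close>

definition is_riemannian_measure ::
  "'a topology \<Rightarrow> ('a, 'n::finite) chart set \<Rightarrow> ('a, 'n) tensor2 \<Rightarrow> 'a measure \<Rightarrow> bool" where
  "is_riemannian_measure X A g \<mu> \<longleftrightarrow>
     space \<mu> = topspace X \<and> sets \<mu> = sigma_sets (topspace X) {U. openin X U} \<and>
     (\<forall>c\<in>A. \<forall>B\<in>sets borel. B \<subseteq> img c \<longrightarrow>
        emeasure \<mu> (pt c ` B) = (\<integral>\<^sup>+x\<in>B. ennreal (sqrt (det (metric_matrix g c x))) \<partial>lborel))"

definition riemannian_measure ::
  "'a topology \<Rightarrow> ('a, 'n::finite) chart set \<Rightarrow> ('a, 'n) tensor2 \<Rightarrow> 'a measure" where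
  "riemannian_measure X A g = (SOME \<mu>. is_riemannian_measure X A g \<mu>)"

text \<open>The factor \<open>1/k!\<close> makes the increasing wedge products of an orthonormal coframe orthonormal. This
  is the normalization for which \<open>(d\<^sup>*H)\<^sub>i\<^sub>j = -\<nabla>\<^sup>k H\<^sub>k\<^sub>i\<^sub>j\<close>.\<close>

definition inner2 ::
  "('a, 'n::finite) tensor2 \<Rightarrow> ('a, 'n) tensor2 \<Rightarrow> ('a, 'n) tensor2 \<Rightarrow> ('a, 'n) chart \<Rightarrow> real^'n \<Rightarrow> real" where
  "inner2 g \<alpha> \<beta> c x =
     (\<Sum>i\<in>UNIV. \<Sum>j\<in>UNIV. \<Sum>p\<in>UNIV. \<Sum>q\<in>UNIV.
        ginv g c x i p * ginv g c x j q * \<alpha> c x i j * \<beta> c x p q) / fact 2"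

definition inner3 ::
  "('a, 'n::finite) tensor2 \<Rightarrow> ('a, 'n) tensor3 \<Rightarrow> ('a, 'n) tensor3 \<Rightarrow> ('a, 'n) chart \<Rightarrow> real^'n \<Rightarrow> real" where
  "inner3 g H K c x =
     (\<Sum>i\<in>UNIV. \<Sum>j\<in>UNIV. \<Sum>k\<in>UNIV. \<Sum>p\<in>UNIV. \<Sum>q\<in>UNIV. \<Sum>r\<in>UNIV.
        ginv g c x i p * ginv g c x j q * ginv g c x k r * H c x i j k * K c x p q r) / fact 3"

text \<open>The function on the manifold whose expression in every chart \<open>c\<close> is \<open>s c\<close>; used only for
  expressions that are independent of the chart.\<close>

definition scalar_at ::
  "('a, 'n::finite) chart set \<Rightarrow> (('a, 'n) chart \<Rightarrow> real^'n \<Rightarrow> real) \<Rightarrow> 'a \<Rightarrow> real" where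
  "scalar_at A s p = (let c = (SOME c. c \<in> A \<and> p \<in> cdom c) in s c (coord c p))"

text \<open>\<open>D = d\<^sup>*H\<close> on a compact manifold: \<open>D\<close> is the (unique) two-form with
  \<open>(d\<alpha>, H) = (\<alpha>, D)\<close> in \<open>L\<^sup>2\<close> for all two-forms \<open>\<alpha>\<close>. On a noncompact manifold one would have to
  restrict to compactly supported \<open>\<alpha>\<close>.\<close>

definition is_codifferential ::
  "'a topology \<Rightarrow> ('a, 'n::finite) chart set \<Rightarrow> ('a, 'n) tensor2 \<Rightarrow> ('a, 'n) tensor3 \<Rightarrow>
   ('a, 'n) tensor2 \<Rightarrow> bool" where
  "is_codifferential X A g H D \<longleftrightarrow> two_form A D \<and>
     (\<forall>\<alpha>. two_form A \<alpha> \<longrightarrow>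
        (\<integral>p. scalar_at A (inner3 g (ext_deriv2 \<alpha>) H) p \<partial>riemannian_measure X A g) =
        (\<integral>p. scalar_at A (inner2 g \<alpha> D) p \<partial>riemannian_measure X A g))"


section \<open>Generalized steady solitons\<close>

definition generalized_steady_soliton ::
  "'a topology \<Rightarrow> ('a, 'n::finite) chart set \<Rightarrow> ('a, 'n) tensor2 \<Rightarrow> ('a, 'n) tensor3 \<Rightarrow>
   ('a \<Rightarrow> real) \<Rightarrow> bool" where
  "generalized_steady_soliton X A g H f \<longleftrightarrow>
     riemannian_metric A g \<and> closed_three_form A H \<and> smooth_function A f \<and>
     (\<forall>c\<in>A. \<forall>x\<in>img c. \<forall>i j.
        ricci g c x i j - 1/4 * H_squared g H c x i j + hessian g f c x i j = 0) \<and>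
     (\<exists>D. is_codifferential X A g H D \<and>
        (\<forall>c\<in>A. \<forall>x\<in>img c. \<forall>i j.
           1/2 * D c x i j
             + interior_product (\<lambda>c x k. 1/2 * gradient g f c x k) H c x i j = 0))"

end

theory Submission
  imports Defs
begin

text \<open>
  The soliton is explicit. Read \<open>\<real>\<^sup>n \<times> \<real>\<^sup>n\<close> as \<open>\<complex>\<^sup>n\<close>, pick three indices \<open>p\<close>, \<open>r\<close>, \<open>q\<close>, and let \<open>M\<close> be
  the product of the unit sphere \<open>S\<^sup>3\<close> in the planes \<open>p\<close> and \<open>q\<close> with the unit circles in the planes
  \<open>k \<notin> {p, r, q}\<close>, the coordinate \<open>z\<^sub>r\<close> being \<open>0\<close>; so \<open>M = S\<^sup>3 \<times> T\<^sup>n\<^sup>-\<^sup>3\<close>. For weights \<open>a, b > 0\<close> put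
  \<open>\<Delta> = b|z\<^sub>p|\<^sup>2 + a|z\<^sub>q|\<^sup>2\<close> and

    \<open>g = (a|dz\<^sub>p|\<^sup>2 + b|dz\<^sub>q|\<^sup>2) / \<Delta> + \<Sum> |dz\<^sub>k|\<^sup>2\<close>,  \<open>f = - ln \<Delta>\<close>,  \<open>H = (2ab / \<Delta>\<^sup>2) \<cdot>\<close> volume form of the round \<open>S\<^sup>3\<close>.

  The first part of \<open>g\<close> is the metric of an ellipsoid divided by \<open>\<Delta>\<close>. For \<open>a = b\<close> it is the round metric,
  with \<open>Rc = H\<^sup>2/4\<close> and constant \<open>f\<close>; for \<open>a \<noteq> b\<close> the function \<open>f\<close> is not constant and its Hessian makes up
  for the defect. The theorem uses \<open>a = 1\<close>, \<open>b = 2\<close>.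

  Where \<open>z\<^sub>q \<noteq> 0\<close> the disc coordinate \<open>z\<^sub>p\<close>, the angle of \<open>z\<^sub>q\<close> and the angles of the \<open>z\<^sub>k\<close> are
  coordinates, and the coefficients of \<open>g\<close>, \<open>H\<close>, \<open>f\<close> are rational functions (or the logarithm of one) of
  \<open>|z\<^sub>p|\<^sup>2\<close>, multiplied by tensors with polynomial components. The first equation (\<open>einstein_equation\<close>) therefore reduces to three
  identities between rational functions of one variable, collected in \<open>soliton_coeffs\<close>. The data are symmetric
  under exchanging \<open>(p, a)\<close> with \<open>(q, b)\<close>, so the charts around the circle \<open>z\<^sub>q = 0\<close> need no second computation:
  the same locale is interpreted with the roles exchanged.

  The second equation says \<open>d\<^sup>*H = - i\<^bsub>\<nabla>f\<^esub> H\<close>, where \<open>d\<^sup>*\<close> is the adjoint with respect to the Riemannian measure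
  \<open>\<mu>\<close>. Two facts make it transparent: \<open>e\<^sup>-\<^sup>f \<mu>\<close> is in these coordinates a constant multiple of Lebesgue measure
  (\<open>det_G\<close>), and \<open>H\<close> with its indices raised has constant components \<open>\<plusminus>2\<close> (\<open>raise_flux\<close>). Hence for every two-form
  \<open>\<alpha>\<close> the integral of \<open>\<langle>d(e\<^sup>f\<alpha>), H\<rangle> e\<^sup>-\<^sup>f\<close> is an integral of partial derivatives over a coordinate domain, and it
  vanishes (\<open>integral_curl_zero\<close>); since \<open>\<langle>d(e\<^sup>f\<alpha>), H\<rangle> e\<^sup>-\<^sup>f = \<langle>d\<alpha>, H\<rangle> - \<langle>\<alpha>, - i\<^bsub>\<nabla>f\<^esub> H\<rangle>\<close> (\<open>inner_difference_local\<close>), this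
  is the claim. The coordinate domain has the boundary \<open>|z\<^sub>p| = 1\<close>,
  where nothing need cancel; therefore \<open>e\<^sup>f = 1/\<Delta>\<close> is first split into two functions of class \<open>C\<^sup>1\<close>, one vanishing
  near \<open>z\<^sub>q = 0\<close> and one near \<open>z\<^sub>p = 0\<close>, and each part is integrated in charts whose boundary it avoids.

  The first of these facts also gives the Riemannian measure: \<open>det g\<close> is the same function of the
  point in every chart, so coordinate changes preserve Lebesgue measure; every chart misses only
  a null set; hence all charts transport Lebesgue measure to one and the same measure on \<open>M\<close>.
\<close>

section \<open>Smooth functions\<close>

lemma has_derivative_cong_open:
  assumes "open S" "x \<in> S" "\<And>y. y \<in> S \<Longrightarrow> f y = g y"
  shows "(f has_derivative D) (at x) \<longleftrightarrow> (g has_derivative D) (at x)"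
proof
  assume "(f has_derivative D) (at x)"
  then show "(g has_derivative D) (at x)"
    by (rule has_derivative_transform_within_open[OF _ assms(1,2)]) (rule assms(3))
next
  assume "(g has_derivative D) (at x)"
  then show "(f has_derivative D) (at x)"
    by (rule has_derivative_transform_within_open[OF _ assms(1,2)]) (simp add: assms(3))
qed

lemma frechet_derivative_cong_open:
  assumes "open S" "x \<in> S" "\<And>y. y \<in> S \<Longrightarrow> f y = g y"
  shows "frechet_derivative f (at x) = frechet_derivative g (at x)"
  using has_derivative_cong_open[OF assms] by (simp add: frechet_derivative_def)

lemma pd_cong_open:
  assumes "open S" "x \<in> S" "\<And>y. y \<in> S \<Longrightarrow> f y = g y"
  shows "pd i f x = pd i g x"
  using frechet_derivative_cong_open[OF assms] by (simp add: pd_def)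

lemma pd_eqI: "(f has_derivative D) (at x) \<Longrightarrow> pd i f x = D (axis i 1)"
  by (simp add: pd_def frechet_derivative_at[symmetric])

lemma Ck_on_cong:
  assumes "open S" "\<And>x. x \<in> S \<Longrightarrow> f x = g x" "Ck_on k S f"
  shows "Ck_on k S g"
  using assms(2,3)
proof (induction k arbitrary: f g)
  case 0
  then show ?case using continuous_on_cong by (metis Ck_on.simps(1))
next
  case (Suc k)
  have d: "f differentiable at x \<longleftrightarrow> g differentiable at x" if "x \<in> S" for x
    using has_derivative_cong_open[OF assms(1) that, of f g] Suc.prems by (simp add: differentiable_def)
  have "Ck_on k S (\<lambda>x. frechet_derivative g (at x) v)" for v
  proof (rule Suc.IH)
    show "Ck_on k S (\<lambda>x. frechet_derivative f (at x) v)" using Suc.prems by simp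
    show "frechet_derivative f (at x) v = frechet_derivative g (at x) v" if "x \<in> S" for x
      using frechet_derivative_cong_open[OF assms(1) that, of f g] Suc.prems by simp
  qed
  then show ?case using d Suc.prems by simp
qed

lemma Ck_on_SucI:
  assumes "open S" "\<And>x. x \<in> S \<Longrightarrow> (f has_derivative f' x) (at x)" "\<And>v. Ck_on k S (\<lambda>x. f' x v)"
  shows "Ck_on (Suc k) S f"
proof -
  have "Ck_on k S (\<lambda>x. frechet_derivative f (at x) v)" for v
    by (rule Ck_on_cong[OF assms(1) _ assms(3)]) (simp add: frechet_derivative_at[OF assms(2), symmetric])
  then show ?thesis using assms(2) by (auto simp: differentiable_def)
qed

lemma Ck_on_SucD:
  assumes "Ck_on (Suc k) S f" "x \<in> S"
  shows "(f has_derivative frechet_derivative f (at x)) (at x)"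
  using assms by (simp add: frechet_derivative_works[symmetric])

lemma Ck_on_Suc_imp: "Ck_on (Suc k) S f \<Longrightarrow> Ck_on k S f"
proof (induction k arbitrary: f)
  case 0
  then show ?case
    by (auto intro!: continuous_at_imp_continuous_on differentiable_imp_continuous_within)
next
  case (Suc k)
  then show ?case by (metis Ck_on.simps(2))
qed

lemma Ck_on_subset: "Ck_on k S f \<Longrightarrow> T \<subseteq> S \<Longrightarrow> Ck_on k T f"
  by (induction k arbitrary: f) (auto intro: continuous_on_subset)

lemma Ck_on_const: "Ck_on k S (\<lambda>_. c)"
  by (induction k arbitrary: c) simp_all

lemma Ck_on_linear_compose:
  assumes "bounded_linear L" "open S" "Ck_on k S f"
  shows "Ck_on k S (\<lambda>x. L (f x))"
  using assms(3)
proof (induction k arbitrary: f)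
  case 0
  then show ?case using linear_continuous_on_compose bounded_linear.continuous_on[OF assms(1)] by auto
next
  case (Suc k)
  show ?case
    by (rule Ck_on_SucI[OF assms(2) bounded_linear.has_derivative[OF assms(1) Ck_on_SucD[OF Suc.prems]]])
      (use Suc in auto)
qed

lemma Ck_on_linear:
  assumes "bounded_linear f" "open S" shows "Ck_on k S f"
proof (cases k)
  case 0
  then show ?thesis using linear_continuous_on[OF assms(1)] by simp
next
  case (Suc m)
  then show ?thesis
    using Ck_on_SucI[OF assms(2) bounded_linear_imp_has_derivative[OF assms(1)] Ck_on_const] by blast
qed

lemma Ck_on_add:
  assumes "open S" "Ck_on k S f" "Ck_on k S g"
  shows "Ck_on k S (\<lambda>x. f x + g x)"
  using assms(2,3)
proof (induction k arbitrary: f g)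
  case 0 then show ?case by (auto intro: continuous_intros)
next
  case (Suc k)
  show ?case
    by (rule Ck_on_SucI[OF assms(1) has_derivative_add[OF Ck_on_SucD[OF Suc.prems(1)] Ck_on_SucD[OF Suc.prems(2)]]])
      (use Suc in auto)
qed

lemma Ck_on_mult:
  fixes f g :: "'a::euclidean_space \<Rightarrow> real"
  assumes "open S" "Ck_on k S f" "Ck_on k S g"
  shows "Ck_on k S (\<lambda>x. f x * g x)"
  using assms(2,3)
proof (induction k arbitrary: f g)
  case 0 then show ?case by (auto intro: continuous_intros)
next
  case (Suc k)
  show ?case
    by (rule Ck_on_SucI[OF assms(1) has_derivative_mult[OF Ck_on_SucD[OF Suc.prems(1)] Ck_on_SucD[OF Suc.prems(2)]]])
      (use Suc in \<open>auto intro!: Ck_on_add[OF assms(1)] Suc.IH intro: Ck_on_Suc_imp simp del: Ck_on.simps(2)\<close>, simp_all)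
qed

text \<open>Real powers are treated first because their derivative is again a product of a real power and a
  derivative, so that one induction over the order of differentiability covers square roots and quotients.\<close>

lemma Ck_on_powr:
  fixes f :: "'a::euclidean_space \<Rightarrow> real"
  assumes "open S" "Ck_on k S f" "\<And>x. x \<in> S \<Longrightarrow> f x > 0"
  shows "Ck_on k S (\<lambda>x. f x powr r)"
  using assms(2)
proof (induction k arbitrary: r)
  case 0 then show ?case using assms(3) by (fastforce intro!: continuous_intros)
next
  case (Suc k)
  have d: "((\<lambda>x. f x powr r) has_derivative (\<lambda>v. r * f x powr (r - 1) * frechet_derivative f (at x) v)) (at x)"
    if "x \<in> S" for x
    using Ck_on_SucD[OF Suc.prems that] assms(3)[OF that]
    by (auto intro!: derivative_eq_intros simp: powr_diff)
  show ?case
    by (rule Ck_on_SucI[OF assms(1) d])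
      (use Suc Ck_on_Suc_imp in \<open>auto intro!: Ck_on_mult[OF assms(1)] Ck_on_const\<close>)
qed

text \<open>Sine and cosine are derivatives of each other up to sign, so they share one induction.\<close>

lemma Ck_on_sin_cos:
  fixes f :: "'a::euclidean_space \<Rightarrow> real"
  assumes "open S" "Ck_on k S f"
  shows "Ck_on k S (\<lambda>x. sin (f x)) \<and> Ck_on k S (\<lambda>x. cos (f x))"
  using assms(2)
proof (induction k)
  case 0 then show ?case by (auto intro!: continuous_intros)
next
  case (Suc k)
  have IH: "Ck_on k S (\<lambda>x. sin (f x))" "Ck_on k S (\<lambda>x. cos (f x))"
    using Suc.IH[OF Ck_on_Suc_imp[OF Suc.prems]] by auto
  have d: "((\<lambda>x. sin (f x)) has_derivative (\<lambda>v. cos (f x) * frechet_derivative f (at x) v)) (at x)"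
     "((\<lambda>x. cos (f x)) has_derivative (\<lambda>v. (- 1) * (sin (f x) * frechet_derivative f (at x) v))) (at x)"
    if "x \<in> S" for x
    using Ck_on_SucD[OF Suc.prems that] by (auto intro!: derivative_eq_intros)
  have F: "Ck_on k S (\<lambda>x. frechet_derivative f (at x) v)" for v using Suc.prems by simp
  show ?case
    by (intro conjI Ck_on_SucI[OF assms(1) d(1)] Ck_on_SucI[OF assms(1) d(2)])
      (assumption | rule Ck_on_mult[OF assms(1)] Ck_on_const IH F)+
qed

lemma smooth_on_cong: "open S \<Longrightarrow> (\<And>x. x \<in> S \<Longrightarrow> f x = g x) \<Longrightarrow> smooth_on S f \<Longrightarrow> smooth_on S g"
  unfolding smooth_on_def using Ck_on_cong by metis

lemma smooth_on_subset: "smooth_on S f \<Longrightarrow> T \<subseteq> S \<Longrightarrow> smooth_on T f"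
  unfolding smooth_on_def using Ck_on_subset by metis

lemma smooth_onI_derivative:
  assumes "open S" "\<And>x. x \<in> S \<Longrightarrow> (f has_derivative f' x) (at x)" "\<And>v. smooth_on S (\<lambda>x. f' x v)"
  shows "smooth_on S f"
  unfolding smooth_on_def
proof
  fix k
  have "Ck_on (Suc k) S f" using assms by (intro Ck_on_SucI) (auto simp: smooth_on_def)
  then show "Ck_on k S f" by (rule Ck_on_Suc_imp)
qed

lemma smooth_on_has_derivative:
  assumes "smooth_on S f" "x \<in> S"
  shows "(f has_derivative frechet_derivative f (at x)) (at x)"
  using Ck_on_SucD[of 0 S f x] assms unfolding smooth_on_def by blast

lemma smooth_on_frechet_derivative: "smooth_on S f \<Longrightarrow> smooth_on S (\<lambda>x. frechet_derivative f (at x) v)"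
  unfolding smooth_on_def by (metis Ck_on.simps(2))

lemma smooth_on_pd: "smooth_on S f \<Longrightarrow> smooth_on S (pd i f)"
  using smooth_on_frechet_derivative[of S f "axis i 1"] by (simp add: pd_def[abs_def])

lemma smooth_on_continuous_on: "smooth_on S f \<Longrightarrow> continuous_on S f"
  unfolding smooth_on_def by (metis Ck_on.simps(1))

lemma smooth_on_differentiable: "smooth_on S f \<Longrightarrow> x \<in> S \<Longrightarrow> f differentiable (at x)"
  using smooth_on_has_derivative differentiable_def by blast

lemma smooth_on_const: "smooth_on S (\<lambda>_. c)"
  by (simp add: smooth_on_def Ck_on_const)

lemma smooth_on_nth: "open S \<Longrightarrow> smooth_on S (\<lambda>x::real^'n::finite. x $ i)"
  by (simp add: smooth_on_def Ck_on_linear bounded_linear_vec_nth)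

lemma smooth_on_linear_compose:
  "bounded_linear L \<Longrightarrow> open S \<Longrightarrow> smooth_on S f \<Longrightarrow> smooth_on S (\<lambda>x. L (f x))"
  by (simp add: smooth_on_def Ck_on_linear_compose)

lemma smooth_on_add: "open S \<Longrightarrow> smooth_on S f \<Longrightarrow> smooth_on S g \<Longrightarrow> smooth_on S (\<lambda>x. f x + g x)"
  by (simp add: smooth_on_def Ck_on_add)

lemma smooth_on_minus: "open S \<Longrightarrow> smooth_on S f \<Longrightarrow> smooth_on S (\<lambda>x. - f x)"
  using smooth_on_linear_compose[OF bounded_linear_minus[OF bounded_linear_ident]] by blast

lemma smooth_on_diff: "open S \<Longrightarrow> smooth_on S f \<Longrightarrow> smooth_on S g \<Longrightarrow> smooth_on S (\<lambda>x. f x - g x)"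
  using smooth_on_add[of S f "\<lambda>x. - g x"] smooth_on_minus[of S g] by simp

lemma smooth_on_sum:
  assumes "open S" "\<And>i. i \<in> I \<Longrightarrow> smooth_on S (f i)"
  shows "smooth_on S (\<lambda>x. \<Sum>i\<in>I. f i x)"
  using assms(2)
  by (induction I rule: infinite_finite_induct) (auto intro!: smooth_on_const smooth_on_add[OF assms(1)])

lemma smooth_on_mult:
  fixes f g :: "'a::euclidean_space \<Rightarrow> real"
  shows "open S \<Longrightarrow> smooth_on S f \<Longrightarrow> smooth_on S g \<Longrightarrow> smooth_on S (\<lambda>x. f x * g x)"
  by (simp add: smooth_on_def Ck_on_mult)

lemma smooth_on_power:
  fixes f :: "'a::euclidean_space \<Rightarrow> real"
  shows "open S \<Longrightarrow> smooth_on S f \<Longrightarrow> smooth_on S (\<lambda>x. f x ^ n)"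
  by (induction n) (auto intro: smooth_on_const smooth_on_mult)

lemma smooth_on_powr:
  fixes f :: "'a::euclidean_space \<Rightarrow> real"
  shows "open S \<Longrightarrow> smooth_on S f \<Longrightarrow> (\<And>x. x \<in> S \<Longrightarrow> f x > 0) \<Longrightarrow> smooth_on S (\<lambda>x. f x powr r)"
  by (simp add: smooth_on_def Ck_on_powr)

lemma smooth_on_sqrt:
  fixes f :: "'a::euclidean_space \<Rightarrow> real"
  assumes "open S" "smooth_on S f" "\<And>x. x \<in> S \<Longrightarrow> f x > 0"
  shows "smooth_on S (\<lambda>x. sqrt (f x))"
  by (rule smooth_on_cong[OF assms(1) _ smooth_on_powr[OF assms, of "1/2"]]) (simp_all add: powr_half_sqrt less_imp_le assms(3))

lemma smooth_on_divide:
  fixes f g :: "'a::euclidean_space \<Rightarrow> real"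
  assumes "open S" "smooth_on S f" "smooth_on S g" "\<And>x. x \<in> S \<Longrightarrow> g x > 0"
  shows "smooth_on S (\<lambda>x. f x / g x)"
  by (rule smooth_on_cong[OF assms(1) _ smooth_on_mult[OF assms(1,2) smooth_on_powr[OF assms(1,3,4), of "-1"]]])
    (simp_all add: powr_minus less_imp_le assms(4) divide_inverse)

lemma smooth_on_sin:
  fixes f :: "'a::euclidean_space \<Rightarrow> real"
  shows "open S \<Longrightarrow> smooth_on S f \<Longrightarrow> smooth_on S (\<lambda>x. sin (f x))"
  by (simp add: smooth_on_def Ck_on_sin_cos)

lemma smooth_on_cos:
  fixes f :: "'a::euclidean_space \<Rightarrow> real"
  shows "open S \<Longrightarrow> smooth_on S f \<Longrightarrow> smooth_on S (\<lambda>x. cos (f x))"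
  by (simp add: smooth_on_def Ck_on_sin_cos)

lemma smooth_on_ln:
  fixes f :: "'a::euclidean_space \<Rightarrow> real"
  assumes "open S" "smooth_on S f" "\<And>x. x \<in> S \<Longrightarrow> f x > 0"
  shows "smooth_on S (\<lambda>x. ln (f x))"
proof (rule smooth_onI_derivative[OF assms(1)])
  show "((\<lambda>x. ln (f x)) has_derivative (\<lambda>v. frechet_derivative f (at x) v / f x)) (at x)" if "x \<in> S" for x
    using smooth_on_has_derivative[OF assms(2) that] assms(3)[OF that]
    by (auto intro!: derivative_eq_intros simp: field_simps)
  show "smooth_on S (\<lambda>x. frechet_derivative f (at x) v / f x)" for v
    by (rule smooth_on_divide[OF assms(1) smooth_on_frechet_derivative[OF assms(2)] assms(2,3)])
qed

lemma smooth_on_vec: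
  fixes f :: "'a::euclidean_space \<Rightarrow> real^'n::finite"
  assumes "open S" "\<And>i. smooth_on S (\<lambda>x. f x $ i)"
  shows "smooth_on S f"
proof -
  have "bounded_linear (\<lambda>r::real. r *\<^sub>R axis i (1::real) :: real^'n)" for i
    by (auto intro: bounded_linear_intros)
  then have "smooth_on S (\<lambda>x. f x $ i *\<^sub>R axis i 1 :: real^'n)" for i
    using smooth_on_linear_compose[OF _ assms(1) assms(2)[of i]] by blast
  then have "smooth_on S (\<lambda>x. \<Sum>i\<in>UNIV. f x $ i *\<^sub>R axis i 1 :: real^'n)"
    by (intro smooth_on_sum assms(1))
  then show ?thesis
    by (rule smooth_on_cong[OF assms(1), rotated])
      (simp add: basis_expansion[of "f _", unfolded scalar_mult_eq_scaleR])
qed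

lemma smooth_on_Pair:
  assumes "open S" "smooth_on S f" "smooth_on S g"
  shows "smooth_on S (\<lambda>x. (f x, g x))"
proof -
  have b: "bounded_linear (\<lambda>v. (v, 0))" "bounded_linear (\<lambda>v. (0, v))"
    by (auto intro!: bounded_linear_intros bounded_linear_Pair)
  show ?thesis
    using smooth_on_add[OF assms(1) smooth_on_linear_compose[OF b(1) assms(1,2)] smooth_on_linear_compose[OF b(2) assms(1,3)]]
    by simp
qed

section \<open>Second derivatives and the pullback of exterior derivatives\<close>

lemma has_derivative_along_line:
  fixes f :: "'a::real_normed_vector \<Rightarrow> real"
  assumes "(f has_derivative D) (at (y + t *\<^sub>R v))"
  shows "((\<lambda>t. f (y + t *\<^sub>R v)) has_real_derivative D v) (at t)"
proof -
  have "((\<lambda>t. y + t *\<^sub>R v) has_derivative (\<lambda>h. h *\<^sub>R v)) (at t)"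
    by (auto intro!: derivative_eq_intros)
  from has_derivative_compose[OF this assms]
  have "((\<lambda>t. f (y + t *\<^sub>R v)) has_derivative (\<lambda>h. D (h *\<^sub>R v))) (at t)" .
  moreover have "D (h *\<^sub>R v) = D v * h" for h
    using linear_cmul[OF has_derivative_linear[OF assms], of h v] by simp
  ultimately show ?thesis by (simp add: has_field_derivative_def)
qed

abbreviation dirD :: "('a::euclidean_space \<Rightarrow> real) \<Rightarrow> 'a \<Rightarrow> 'a \<Rightarrow> real" where
  "dirD f v x \<equiv> frechet_derivative f (at x) v"

text \<open>The mean value theorem, used first in direction \<open>u\<close> and then in direction \<open>v\<close>, turns the second
  difference over a parallelogram into a mixed second derivative at one of its points. The left-hand side
  is symmetric in \<open>u\<close> and \<open>v\<close>.\<close>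

lemma second_difference_mvt:
  fixes f :: "'a::euclidean_space \<Rightarrow> real"
  assumes f: "smooth_on S f" and h: "h > 0"
    and S: "\<And>s t. 0 \<le> s \<Longrightarrow> s \<le> h \<Longrightarrow> 0 \<le> t \<Longrightarrow> t \<le> h \<Longrightarrow> x + s *\<^sub>R u + t *\<^sub>R v \<in> S"
  obtains s t where "0 \<le> s" "s \<le> h" "0 \<le> t" "t \<le> h"
    "f (x + h *\<^sub>R u + h *\<^sub>R v) - f (x + h *\<^sub>R u) - f (x + h *\<^sub>R v) + f x
      = h * h * dirD (dirD f u) v (x + s *\<^sub>R u + t *\<^sub>R v)"
proof -
  have d1: "((\<lambda>s. f (x + s *\<^sub>R u + t *\<^sub>R v)) has_real_derivative dirD f u (x + s *\<^sub>R u + t *\<^sub>R v)) (at s)"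
    if "0 \<le> s" "s \<le> h" "0 \<le> t" "t \<le> h" for s t
    using has_derivative_along_line[of f _ "x + t *\<^sub>R v" s u] smooth_on_has_derivative[OF f S[OF that]]
    by (simp add: add_ac)
  have "\<exists>s. 0 < s \<and> s < h \<and> (f (x + h *\<^sub>R u + h *\<^sub>R v) - f (x + h *\<^sub>R u + 0 *\<^sub>R v)) -
        (f (x + 0 *\<^sub>R u + h *\<^sub>R v) - f (x + 0 *\<^sub>R u + 0 *\<^sub>R v))
      = (h - 0) * (dirD f u (x + s *\<^sub>R u + h *\<^sub>R v) - dirD f u (x + s *\<^sub>R u + 0 *\<^sub>R v))"
    by (rule MVT2[OF h]; intro DERIV_diff d1; use h in simp)
  then obtain s where s: "0 < s" "s < h"
    and e1: "(f (x + h *\<^sub>R u + h *\<^sub>R v) - f (x + h *\<^sub>R u + 0 *\<^sub>R v)) -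
        (f (x + 0 *\<^sub>R u + h *\<^sub>R v) - f (x + 0 *\<^sub>R u + 0 *\<^sub>R v))
      = (h - 0) * (dirD f u (x + s *\<^sub>R u + h *\<^sub>R v) - dirD f u (x + s *\<^sub>R u + 0 *\<^sub>R v))" by blast
  have d2: "((\<lambda>t. dirD f u (x + s *\<^sub>R u + t *\<^sub>R v)) has_real_derivative dirD (dirD f u) v (x + s *\<^sub>R u + t *\<^sub>R v)) (at t)"
    if "0 \<le> t" "t \<le> h" for t
    by (rule has_derivative_along_line[OF smooth_on_has_derivative[OF smooth_on_frechet_derivative[OF f] S]])
      (use s that in auto)
  have "\<exists>t. 0 < t \<and> t < h \<and> dirD f u (x + s *\<^sub>R u + h *\<^sub>R v) - dirD f u (x + s *\<^sub>R u + 0 *\<^sub>R v)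
      = (h - 0) * dirD (dirD f u) v (x + s *\<^sub>R u + t *\<^sub>R v)"
    by (rule MVT2[OF h]) (use h in \<open>auto intro!: d2\<close>)
  then obtain t where t: "0 < t" "t < h"
    and e2: "dirD f u (x + s *\<^sub>R u + h *\<^sub>R v) - dirD f u (x + s *\<^sub>R u + 0 *\<^sub>R v)
      = (h - 0) * dirD (dirD f u) v (x + s *\<^sub>R u + t *\<^sub>R v)" by blast
  show ?thesis
    by (rule that[of s t]) (use s t e1 e2 in auto)
qed

text \<open>Both orders of differentiation occur as limits of the same second differences, by
  \<open>second_difference_mvt\<close> and the continuity of the second derivatives.\<close>

lemma second_derivative_symmetric:
  fixes f :: "'a::euclidean_space \<Rightarrow> real"
  assumes f: "smooth_on S f" and S: "open S" "x \<in> S"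
  shows "dirD (dirD f u) v x = dirD (dirD f v) u x"
proof -
  let ?A = "dirD (dirD f u) v" and ?B = "dirD (dirD f v) u"
  have cA: "continuous (at x) ?A" "continuous (at x) ?B"
    using smooth_on_continuous_on[OF smooth_on_frechet_derivative[OF smooth_on_frechet_derivative[OF f]]]
      continuous_on_eq_continuous_at[OF S(1)] S(2) by blast+
  obtain r where r: "r > 0" "ball x r \<subseteq> S" using S open_contains_ball by blast
  show ?thesis
  proof (rule ccontr)
    assume ne: "?A x \<noteq> ?B x"
    define e where "e = \<bar>?A x - ?B x\<bar> / 2"
    have e: "e > 0" using ne by (simp add: e_def)
    obtain d1 where d1: "d1 > 0" "\<And>y. dist y x < d1 \<Longrightarrow> dist (?A y) (?A x) < e"
      using cA(1) e unfolding continuous_at_eps_delta by (metis dist_commute)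
    obtain d2 where d2: "d2 > 0" "\<And>y. dist y x < d2 \<Longrightarrow> dist (?B y) (?B x) < e"
      using cA(2) e unfolding continuous_at_eps_delta by (metis dist_commute)
    define d where "d = min r (min d1 d2)"
    have d: "d > 0" "d \<le> r" "d \<le> d1" "d \<le> d2" using r d1 d2 by (auto simp: d_def)
    \<comment> \<open>With this step size the parallelogram stays within distance \<open>d\<close> of \<open>x\<close>.\<close>
    define h where "h = d / (norm u + norm v + 1)"
    have n: "norm u + norm v + 1 > 0" by (smt (verit) norm_ge_zero)
    have h: "h > 0" using d n by (simp add: h_def)
    have near: "dist (x + s *\<^sub>R u' + t *\<^sub>R v') x < d"
      if "0 \<le> s" "s \<le> h" "0 \<le> t" "t \<le> h" "(u' = u \<and> v' = v) \<or> (u' = v \<and> v' = u)" for s t u' v'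
    proof -
      have "dist (x + s *\<^sub>R u' + t *\<^sub>R v') x \<le> s * norm u' + t * norm v'"
        using norm_triangle_ineq[of "s *\<^sub>R u'" "t *\<^sub>R v'"] that by (simp add: dist_norm add.assoc)
      also have "\<dots> \<le> h * norm u' + h * norm v'"
        using that by (intro add_mono mult_right_mono) auto
      also have "\<dots> < h * (norm u + norm v + 1)" using h that(5) by (auto simp: algebra_simps)
      also have "\<dots> = d" using n by (simp add: h_def)
      finally show ?thesis .
    qed
    have inS: "x + s *\<^sub>R u' + t *\<^sub>R v' \<in> S"
      if "0 \<le> s" "s \<le> h" "0 \<le> t" "t \<le> h" "(u' = u \<and> v' = v) \<or> (u' = v \<and> v' = u)" for s t u' v'
      using near[OF that] d r by (auto simp: dist_commute subset_iff)
    obtain s t where st: "0 \<le> s" "s \<le> h" "0 \<le> t" "t \<le> h"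
      "f (x + h *\<^sub>R u + h *\<^sub>R v) - f (x + h *\<^sub>R u) - f (x + h *\<^sub>R v) + f x
        = h * h * ?A (x + s *\<^sub>R u + t *\<^sub>R v)"
      using second_difference_mvt[OF f h, of x u v] inS by metis
    obtain s' t' where st': "0 \<le> s'" "s' \<le> h" "0 \<le> t'" "t' \<le> h"
      "f (x + h *\<^sub>R v + h *\<^sub>R u) - f (x + h *\<^sub>R v) - f (x + h *\<^sub>R u) + f x
        = h * h * ?B (x + s' *\<^sub>R v + t' *\<^sub>R u)"
      using second_difference_mvt[OF f h, of x v u] inS by metis
    have cm: "x + h *\<^sub>R v + h *\<^sub>R u = x + h *\<^sub>R u + h *\<^sub>R v" by (simp add: add_ac)
    then have "h * h * ?A (x + s *\<^sub>R u + t *\<^sub>R v) = h * h * ?B (x + s' *\<^sub>R v + t' *\<^sub>R u)"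
      using st(5) st'(5)[unfolded cm] by linarith
    then have eq: "?A (x + s *\<^sub>R u + t *\<^sub>R v) = ?B (x + s' *\<^sub>R v + t' *\<^sub>R u)" using h by simp
    have "dist (?A (x + s *\<^sub>R u + t *\<^sub>R v)) (?A x) < e"
      using near[of s t u v] st d d1 by force
    moreover have "dist (?B (x + s' *\<^sub>R v + t' *\<^sub>R u)) (?B x) < e"
      using near[of s' t' v u] st' d d2 by force
    ultimately show False using eq by (simp add: e_def dist_real_def abs_if field_simps split: if_splits)
  qed
qed

lemma sum_swap3:
  fixes F :: "'a::finite \<Rightarrow> 'b::finite \<Rightarrow> 'c::finite \<Rightarrow> real"
  shows "(\<Sum>p\<in>UNIV. \<Sum>l\<in>UNIV. \<Sum>m\<in>UNIV. F p l m) = (\<Sum>l\<in>UNIV. \<Sum>p\<in>UNIV. \<Sum>m\<in>UNIV. F p l m)"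
    and "(\<Sum>p\<in>UNIV. \<Sum>l\<in>UNIV. \<Sum>m\<in>UNIV. F p l m) = (\<Sum>l\<in>UNIV. \<Sum>m\<in>UNIV. \<Sum>p\<in>UNIV. F p l m)"
proof -
  show a: "(\<Sum>p\<in>UNIV. \<Sum>l\<in>UNIV. \<Sum>m\<in>UNIV. F p l m) = (\<Sum>l\<in>UNIV. \<Sum>p\<in>UNIV. \<Sum>m\<in>UNIV. F p l m)"
    by (rule sum.swap)
  show "(\<Sum>p\<in>UNIV. \<Sum>l\<in>UNIV. \<Sum>m\<in>UNIV. F p l m) = (\<Sum>l\<in>UNIV. \<Sum>m\<in>UNIV. \<Sum>p\<in>UNIV. F p l m)"
    unfolding a by (intro sum.cong refl) (rule sum.swap)
qed

lemma frechet_derivative_expand: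
  fixes f :: "real^'n::finite \<Rightarrow> 'b::real_normed_vector"
  assumes "(f has_derivative D) (at x)"
  shows "D v = (\<Sum>p\<in>UNIV. v $ p *\<^sub>R D (axis p 1))"
proof -
  have "D v = D (\<Sum>p\<in>UNIV. v $ p *\<^sub>R axis p 1)"
    by (simp add: basis_expansion[of v, unfolded scalar_mult_eq_scaleR])
  then show ?thesis
    using has_derivative_linear[OF assms] by (simp add: linear_sum linear_cmul)
qed

lemma has_derivative_vecI:
  fixes f :: "'a::real_normed_vector \<Rightarrow> real^'n::finite"
  assumes "\<And>i. ((\<lambda>x. f x $ i) has_derivative (\<lambda>h. f' h $ i)) (at x)"
  shows "(f has_derivative f') (at x)"
  unfolding has_derivative_componentwise_within[of f]
  using assms by (auto simp: Basis_vec_def inner_axis)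

text \<open>This is \<open>d(\<tau>\<^sup>*\<beta>) = \<tau>\<^sup>*(d\<beta>)\<close> for two-forms, in coordinates. The second derivatives of \<open>\<tau>\<close> are symmetric
  and drop out of the alternating sum. Only differentiability of \<open>\<beta>\<close> is assumed: the lemma is applied to
  smooth forms multiplied by a function of class \<open>C\<^sup>1\<close>.\<close>

lemma exterior_derivative_pullback:
  fixes \<tau> :: "real^'n::finite \<Rightarrow> real^'n" and \<alpha> \<beta> :: "'n \<Rightarrow> 'n \<Rightarrow> real^'n \<Rightarrow> real"
  assumes S: "open S" "x \<in> S" and \<tau>: "\<And>l. smooth_on S (\<lambda>y. \<tau> y $ l)"
    and J: "\<And>y l i. y \<in> S \<Longrightarrow> J y l i = pd i (\<lambda>y. \<tau> y $ l) y"
    and \<alpha>: "\<And>y j k. y \<in> S \<Longrightarrow> \<alpha> j k y = (\<Sum>l\<in>UNIV. \<Sum>m\<in>UNIV. J y l j * J y m k * \<beta> l m (\<tau> y))"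
    and \<beta>: "\<And>l m. \<beta> l m differentiable (at (\<tau> x))" "\<And>l m. \<beta> m l (\<tau> x) = - \<beta> l m (\<tau> x)"
  shows "pd i (\<alpha> j k) x - pd j (\<alpha> i k) x + pd k (\<alpha> i j) x =
    (\<Sum>p\<in>UNIV. \<Sum>l\<in>UNIV. \<Sum>m\<in>UNIV. J x p i * J x l j * J x m k *
      (pd p (\<beta> l m) (\<tau> x) - pd l (\<beta> p m) (\<tau> x) + pd m (\<beta> p l) (\<tau> x)))"
proof -
  define Q where "Q l j y = pd j (\<lambda>y. \<tau> y $ l) y" for l j y
  have Jx: "J x l j = Q l j x" for l j using J[OF S(2)] by (simp add: Q_def)
  define R where "R l i j = pd i (Q l j) x" for l i j
  have Rsym: "R l i j = R l j i" for l i j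
    using second_derivative_symmetric[OF \<tau>[of l] S, of "axis j 1" "axis i 1"]
    by (simp add: R_def Q_def[abs_def] pd_def)
  have dQ: "(Q l j has_derivative frechet_derivative (Q l j) (at x)) (at x)" for l j
    using smooth_on_has_derivative[OF smooth_on_pd[OF \<tau>[of l], of j] S(2)] by (simp add: Q_def[abs_def])
  have d\<tau>: "(\<tau> has_derivative (\<lambda>v. \<chi> l. frechet_derivative (\<lambda>y. \<tau> y $ l) (at x) v)) (at x)"
    by (rule has_derivative_vecI) (simp add: smooth_on_has_derivative[OF \<tau> S(2)])
  have d\<beta>: "((\<lambda>y. \<beta> l m (\<tau> y)) has_derivative
      (\<lambda>v. frechet_derivative (\<beta> l m) (at (\<tau> x)) (\<chi> l. frechet_derivative (\<lambda>y. \<tau> y $ l) (at x) v))) (at x)" for l m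
    by (rule has_derivative_compose[OF d\<tau>]) (use \<beta>(1) frechet_derivative_works in blast)
  have db: "frechet_derivative (\<beta> l m) (at (\<tau> x)) (\<chi> l. frechet_derivative (\<lambda>y. \<tau> y $ l) (at x) (axis i 1))
      = (\<Sum>p\<in>UNIV. Q p i x * pd p (\<beta> l m) (\<tau> x))" for l m i
    by (subst frechet_derivative_expand[OF \<beta>(1)[unfolded frechet_derivative_works]]) (simp add: Q_def pd_def)
  \<comment> \<open>T collects the terms with second derivatives of \<open>\<tau>\<close>, C those with derivatives of \<open>\<beta>\<close>; T is symmetric in its first two indices.\<close>
  define T where "T i j k = (\<Sum>l\<in>UNIV. \<Sum>m\<in>UNIV. R l i j * Q m k x * \<beta> l m (\<tau> x))" for i j k
  define C where "C i j k = (\<Sum>p\<in>UNIV. \<Sum>l\<in>UNIV. \<Sum>m\<in>UNIV. Q p i x * Q l j x * Q m k x * pd p (\<beta> l m) (\<tau> x))" for i j k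
  have pd\<alpha>: "pd i (\<alpha> j k) x = T i j k - T i k j + C i j k" for i j k
  proof -
    have "pd i (\<alpha> j k) x = pd i (\<lambda>y. \<Sum>l\<in>UNIV. \<Sum>m\<in>UNIV. Q l j y * Q m k y * \<beta> l m (\<tau> y)) x"
      by (rule pd_cong_open[OF S]) (simp add: \<alpha> J Q_def)
    also have "\<dots> = (\<Sum>l\<in>UNIV. \<Sum>m\<in>UNIV. Q l j x * Q m k x * (\<Sum>p\<in>UNIV. Q p i x * pd p (\<beta> l m) (\<tau> x))
        + (Q l j x * R m i k + R l i j * Q m k x) * \<beta> l m (\<tau> x))"
      by (subst pd_eqI[OF has_derivative_sum[OF has_derivative_sum[OF
        has_derivative_mult[OF has_derivative_mult[OF dQ dQ] d\<beta>]]]]) (simp add: db R_def pd_def)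
    also have "\<dots> = (\<Sum>l\<in>UNIV. \<Sum>m\<in>UNIV. \<Sum>p\<in>UNIV. Q p i x * Q l j x * Q m k x * pd p (\<beta> l m) (\<tau> x))
        + (\<Sum>l\<in>UNIV. \<Sum>m\<in>UNIV. R m i k * Q l j x * \<beta> l m (\<tau> x)) + T i j k"
      by (simp add: T_def sum.distrib[symmetric] sum_distrib_left algebra_simps)
    also have "(\<Sum>l\<in>UNIV. \<Sum>m\<in>UNIV. R m i k * Q l j x * \<beta> l m (\<tau> x)) = - T i k j"
      unfolding T_def sum_negf[symmetric]
    proof (subst sum.swap, intro sum.cong refl)
      fix l m
      show "R l i k * Q m j x * \<beta> m l (\<tau> x) = - (R l i k * Q m j x * \<beta> l m (\<tau> x))"
        using \<beta>(2)[of m l] by simp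
    qed
    also have "(\<Sum>l\<in>UNIV. \<Sum>m\<in>UNIV. \<Sum>p\<in>UNIV. Q p i x * Q l j x * Q m k x * pd p (\<beta> l m) (\<tau> x)) = C i j k"
      unfolding C_def by (rule sum_swap3(2)[symmetric])
    finally show ?thesis by simp
  qed
  have Tsym: "T i j k = T j i k" for i j k by (simp add: T_def Rsym[of _ i j])
  have C2: "C j i k = (\<Sum>p\<in>UNIV. \<Sum>l\<in>UNIV. \<Sum>m\<in>UNIV. Q p i x * Q l j x * Q m k x * pd l (\<beta> p m) (\<tau> x))"
    unfolding C_def by (subst sum_swap3(1)) (simp add: mult_ac)
  have C3: "C k i j = (\<Sum>p\<in>UNIV. \<Sum>l\<in>UNIV. \<Sum>m\<in>UNIV. Q p i x * Q l j x * Q m k x * pd m (\<beta> p l) (\<tau> x))"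
    unfolding C_def by (subst sum_swap3(2)) (simp add: mult_ac)
  have "pd i (\<alpha> j k) x - pd j (\<alpha> i k) x + pd k (\<alpha> i j) x = C i j k - C j i k + C k i j"
    unfolding pd\<alpha> using Tsym[of i j k] Tsym[of i k j] Tsym[of j k i] by linarith
  also have "\<dots> = (\<Sum>p\<in>UNIV. \<Sum>l\<in>UNIV. \<Sum>m\<in>UNIV. Q p i x * Q l j x * Q m k x *
      (pd p (\<beta> l m) (\<tau> x) - pd l (\<beta> p m) (\<tau> x) + pd m (\<beta> p l) (\<tau> x)))"
    unfolding C2 C3 unfolding C_def sum_subtractf[symmetric] sum.distrib[symmetric]
    by (simp add: algebra_simps)
  finally show ?thesis by (simp add: Jx)
qed

section \<open>Charts and tensors restricted from the ambient space\<close>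

lemma
  assumes M: "smooth_manifold X A" and c: "c \<in> A"
  shows chart_inj: "inj_on (coord c) (cdom c)"
    and chart_img_open: "open (img c)"
    and chart_dom_open: "openin X (cdom c)"
    and chart_homeomorphic: "homeomorphic_map (subtopology X (cdom c)) (top_of_set (img c)) (coord c)"
proof -
  show h: "homeomorphic_map (subtopology X (cdom c)) (top_of_set (img c)) (coord c)"
    and "open (img c)" and o: "openin X (cdom c)"
    using assms by (auto simp: smooth_manifold_def)
  have "topspace (subtopology X (cdom c)) = cdom c"
    using openin_subset[OF o] by (simp add: Int_absorb1)
  then show "inj_on (coord c) (cdom c)"
    using homeomorphic_imp_injective_map[OF h] by simp
qed

lemma overlap_open:
  assumes M: "smooth_manifold X A" and c: "c \<in> A" "d \<in> A"
  shows "open (overlap c d)"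
proof -
  have "openin (subtopology X (cdom c)) (cdom c \<inter> cdom d)"
    using chart_dom_open[OF M c(2)] by (metis inf_commute openin_subtopology_Int)
  then have "openin (top_of_set (img c)) (coord c ` (cdom c \<inter> cdom d))"
    using homeomorphic_imp_open_map[OF chart_homeomorphic[OF M c(1)]] by (auto simp: open_map_def)
  then show ?thesis
    using openin_open_trans[OF _ chart_img_open[OF M c(1)]] by (simp add: overlap_def)
qed

lemma overlapD:
  assumes M: "smooth_manifold X A" and c: "c \<in> A" "d \<in> A" and x: "x \<in> overlap c d"
  shows "x \<in> img c" "pt c x \<in> cdom c" "pt c x \<in> cdom d" "transition c d x \<in> img d"
    "transition c d x \<in> overlap d c" "pt d (transition c d x) = pt c x" "transition d c (transition c d x) = x"
proof -
  obtain y where y: "y \<in> cdom c" "y \<in> cdom d" "x = coord c y" using x by (auto simp: overlap_def)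
  have p: "pt c x = y" using inv_into_f_f[OF chart_inj[OF M c(1)] y(1)] y(3) by (simp add: pt_def)
  have t: "transition c d x = coord d y" by (simp add: transition_def p)
  have q: "pt d (coord d y) = y" using inv_into_f_f[OF chart_inj[OF M c(2)] y(2)] by (simp add: pt_def)
  show "x \<in> img c" "pt c x \<in> cdom c" "pt c x \<in> cdom d" "transition c d x \<in> img d"
    "transition c d x \<in> overlap d c" "pt d (transition c d x) = pt c x" "transition d c (transition c d x) = x"
    using y p t q by (auto simp: img_def overlap_def transition_def)
qed

lemma transition_smooth:
  assumes M: "smooth_manifold X A" and c: "c \<in> A" "d \<in> A"
  shows "smooth_on (overlap c d) (transition c d)" "smooth_on (overlap c d) (\<lambda>y. transition c d y $ l)"
proof -
  show t: "smooth_on (overlap c d) (transition c d)" using assms by (auto simp: smooth_manifold_def)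
  show "smooth_on (overlap c d) (\<lambda>y. transition c d y $ l)"
    by (rule smooth_on_linear_compose[OF bounded_linear_vec_nth overlap_open[OF assms] t])
qed

lemma jac_eq_pd:
  assumes M: "smooth_manifold X A" and c: "c \<in> A" "d \<in> A" and x: "x \<in> overlap c d"
  shows "jac c d x l i = pd i (\<lambda>y. transition c d y $ l) x"
  unfolding jac_def
  by (rule pd_eqI[OF bounded_linear.has_derivative[OF bounded_linear_vec_nth
      smooth_on_has_derivative[OF transition_smooth(1)[OF M c] x]], symmetric])

text \<open>The coordinate vector fields of the chart as vectors of the ambient Euclidean space.\<close>

definition tframe :: "('a::euclidean_space, 'n::finite) chart \<Rightarrow> real^'n \<Rightarrow> 'n \<Rightarrow> 'a" where
  "tframe c x i = frechet_derivative (pt c) (at x) (axis i 1)"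

lemma tframe_transition:
  fixes A :: "('a::euclidean_space, 'n::finite) chart set"
  assumes M: "smooth_manifold X A" and P: "\<And>c. c \<in> A \<Longrightarrow> smooth_on (img c) (pt c)"
    and c: "c \<in> A" "d \<in> A" and x: "x \<in> overlap c d"
  shows "tframe c x i = (\<Sum>k\<in>UNIV. jac c d x k i *\<^sub>R tframe d (transition c d x) k)"
proof -
  let ?\<tau> = "transition c d"
  note o = overlapD[OF M c x]
  have d: "(pt d has_derivative frechet_derivative (pt d) (at (?\<tau> x))) (at (?\<tau> x))"
    using smooth_on_has_derivative[OF P[OF c(2)]] o by blast
  have "((\<lambda>y. pt d (?\<tau> y)) has_derivative
      (\<lambda>v. frechet_derivative (pt d) (at (?\<tau> x)) (frechet_derivative ?\<tau> (at x) v))) (at x)"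
    by (rule has_derivative_compose[OF smooth_on_has_derivative[OF transition_smooth(1)[OF M c] x] d])
  then have "frechet_derivative (pt c) (at x) = (\<lambda>v. frechet_derivative (pt d) (at (?\<tau> x)) (frechet_derivative ?\<tau> (at x) v))"
    using frechet_derivative_cong_open[OF overlap_open[OF M c] x, of "\<lambda>y. pt d (?\<tau> y)" "pt c"]
      overlapD(6)[OF M c] frechet_derivative_at by metis
  then show ?thesis
    using frechet_derivative_expand[OF d, of "frechet_derivative ?\<tau> (at x) (axis i 1)"]
    by (simp add: tframe_def jac_def)
qed

text \<open>Tensor fields on a submanifold are obtained by evaluating ambient multilinear forms on the coordinate
  vector fields. Such components obey the transformation law automatically, so that only smoothness has to be
  checked chart by chart.\<close>

definition pull2 :: "('a \<Rightarrow> 'a \<Rightarrow> 'a \<Rightarrow> real) \<Rightarrow> ('a::euclidean_space, 'n::finite) tensor2" where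
  "pull2 \<beta> c x i j = \<beta> (pt c x) (tframe c x i) (tframe c x j)"

definition pull3 :: "('a \<Rightarrow> 'a \<Rightarrow> 'a \<Rightarrow> 'a \<Rightarrow> real) \<Rightarrow> ('a::euclidean_space, 'n::finite) tensor3" where
  "pull3 \<beta> c x i j k = \<beta> (pt c x) (tframe c x i) (tframe c x j) (tframe c x k)"

lemma smooth_tensor2_pull2:
  fixes A :: "('a::euclidean_space, 'n::finite) chart set"
  assumes M: "smooth_manifold X A" and P: "\<And>c. c \<in> A \<Longrightarrow> smooth_on (img c) (pt c)"
    and lin: "\<And>y v. linear (\<beta> y v)" "\<And>y w. linear (\<lambda>v. \<beta> y v w)"
    and sm: "\<And>c i j. c \<in> A \<Longrightarrow> smooth_on (img c) (\<lambda>x. pull2 \<beta> c x i j)"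
  shows "smooth_tensor2 A (pull2 \<beta>)"
  unfolding smooth_tensor2_def
proof (intro conjI ballI allI sm)
  fix c d x i j assume c: "c \<in> A" "d \<in> A" and x: "x \<in> overlap c d"
  have tf: "tframe c x i = (\<Sum>k\<in>UNIV. jac c d x k i *\<^sub>R tframe d (transition c d x) k)" for i
    by (rule tframe_transition[OF M _ c x]) (rule P)
  show "pull2 \<beta> c x i j = (\<Sum>k\<in>UNIV. \<Sum>l\<in>UNIV. jac c d x k i * jac c d x l j * pull2 \<beta> d (transition c d x) k l)"
    unfolding pull2_def tf overlapD(6)[OF M c x]
    unfolding linear_sum[OF lin(2)] linear_cmul[OF lin(2)] real_scaleR_def
    unfolding linear_sum[OF lin(1)] linear_cmul[OF lin(1)] real_scaleR_def
    unfolding sum_distrib_left mult.assoc ..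
qed

lemma smooth_tensor3_pull3:
  fixes A :: "('a::euclidean_space, 'n::finite) chart set"
  assumes M: "smooth_manifold X A" and P: "\<And>c. c \<in> A \<Longrightarrow> smooth_on (img c) (pt c)"
    and lin: "\<And>y u v. linear (\<beta> y u v)" "\<And>y u w. linear (\<lambda>v. \<beta> y u v w)" "\<And>y v w. linear (\<lambda>u. \<beta> y u v w)"
    and sm: "\<And>c i j k. c \<in> A \<Longrightarrow> smooth_on (img c) (\<lambda>x. pull3 \<beta> c x i j k)"
  shows "smooth_tensor3 A (pull3 \<beta>)"
  unfolding smooth_tensor3_def
proof (intro conjI ballI allI sm)
  fix c d x i j k assume c: "c \<in> A" "d \<in> A" and x: "x \<in> overlap c d"
  have tf: "tframe c x i = (\<Sum>k\<in>UNIV. jac c d x k i *\<^sub>R tframe d (transition c d x) k)" for i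
    by (rule tframe_transition[OF M _ c x]) (rule P)
  show "pull3 \<beta> c x i j k = (\<Sum>p\<in>UNIV. \<Sum>q\<in>UNIV. \<Sum>r\<in>UNIV.
     jac c d x p i * jac c d x q j * jac c d x r k * pull3 \<beta> d (transition c d x) p q r)"
    unfolding pull3_def tf overlapD(6)[OF M c x]
    unfolding linear_sum[OF lin(3)] linear_cmul[OF lin(3)] real_scaleR_def
    unfolding linear_sum[OF lin(2)] linear_cmul[OF lin(2)] real_scaleR_def
    unfolding linear_sum[OF lin(1)] linear_cmul[OF lin(1)] real_scaleR_def
    unfolding sum_distrib_left mult.assoc ..
qed

section \<open>The manifold \<open>S\<^sup>3 \<times> T\<^sup>n\<^sup>-\<^sup>3\<close>\<close>

text \<open>The branch of the angle of \<open>c + \<i>s\<close> with values in \<open>(t - \<pi>, t + \<pi>)\<close>; \<open>off_cut t c s\<close> says that \<open>c + \<i>s\<close> does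
  not lie on the ray on which this branch jumps.\<close>

definition angle_near :: "real \<Rightarrow> real \<Rightarrow> real \<Rightarrow> real" where
  "angle_near t c s = t + Arg (cis (- t) * Complex c s)"

definition off_cut :: "real \<Rightarrow> real \<Rightarrow> real \<Rightarrow> bool" where
  "off_cut t c s \<longleftrightarrow> cis (- t) * Complex c s \<notin> \<real>\<^sub>\<le>\<^sub>0"

lemma angle_near_polar:
  assumes "\<rho> > 0" "\<bar>a - t\<bar> < pi"
  shows "angle_near t (\<rho> * cos a) (\<rho> * sin a) = a" "off_cut t (\<rho> * cos a) (\<rho> * sin a)"
proof -
  have "Complex (\<rho> * cos a) (\<rho> * sin a) = rcis \<rho> a" by (simp add: complex_eq_iff)
  then have e: "cis (- t) * Complex (\<rho> * cos a) (\<rho> * sin a) = rcis \<rho> (a - t)"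
    by (simp add: rcis_def cis_mult mult.left_commute)
  have A: "Arg (rcis \<rho> (a - t)) = a - t"
    by (rule Arg_unique'[OF assms(1) _ refl]) (use assms(2) in auto)
  then show "angle_near t (\<rho> * cos a) (\<rho> * sin a) = a" by (simp add: angle_near_def e)
  have "rcis \<rho> (a - t) \<noteq> 0" using assms by simp
  then have "Arg (rcis \<rho> (a - t)) = pi" if "rcis \<rho> (a - t) \<in> \<real>\<^sub>\<le>\<^sub>0"
    using that unfolding Arg_eq_pi complex_nonpos_Reals_iff by (metis complex.expand less_eq_real_def zero_complex.simps)
  then show "off_cut t (\<rho> * cos a) (\<rho> * sin a)" using A assms(2) by (auto simp: off_cut_def e)
qed

lemma polar_angle_near:
  assumes "off_cut t c s"
  shows "\<bar>angle_near t c s - t\<bar> < pi" "c = sqrt (c\<^sup>2 + s\<^sup>2) * cos (angle_near t c s)"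
    "s = sqrt (c\<^sup>2 + s\<^sup>2) * sin (angle_near t c s)" "c\<^sup>2 + s\<^sup>2 > 0"
proof -
  let ?z = "cis (- t) * Complex c s"
  have ns: "?z \<notin> \<real>\<^sub>\<le>\<^sub>0" using assms by (simp add: off_cut_def)
  have "Arg ?z \<noteq> pi" using ns by (auto simp: Arg_eq_pi complex_nonpos_Reals_iff)
  then show "\<bar>angle_near t c s - t\<bar> < pi"
    using mpi_less_Arg[of ?z] Arg_le_pi[of ?z] by (simp add: angle_near_def)
  have m: "cmod ?z = sqrt (c\<^sup>2 + s\<^sup>2)" by (simp add: norm_mult complex_norm)
  have "Complex c s = cis t * ?z" by (simp add: mult.assoc[symmetric] cis_mult)
  also have "?z = rcis (cmod ?z) (Arg ?z)" by (simp add: rcis_cmod_Arg)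
  also have "cis t * rcis (cmod ?z) (Arg ?z) = rcis (sqrt (c\<^sup>2 + s\<^sup>2)) (angle_near t c s)"
    by (simp add: m rcis_def cis_mult mult.left_commute angle_near_def)
  finally have *: "Complex c s = rcis (sqrt (c\<^sup>2 + s\<^sup>2)) (angle_near t c s)" .
  show "c = sqrt (c\<^sup>2 + s\<^sup>2) * cos (angle_near t c s)" using arg_cong[OF *, of Re] by simp
  show "s = sqrt (c\<^sup>2 + s\<^sup>2) * sin (angle_near t c s)" using arg_cong[OF *, of Im] by simp
  have "c \<noteq> 0 \<or> s \<noteq> 0" using ns by (auto simp: Complex_eq)
  then show "c\<^sup>2 + s\<^sup>2 > 0" by (simp add: sum_power2_gt_zero_iff)
qed

lemma has_derivative_angle_near:
  assumes c: "(c has_derivative c') (at x)" and s: "(s has_derivative s') (at x)" and o: "off_cut t (c x) (s x)"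
  shows "((\<lambda>x. angle_near t (c x) (s x)) has_derivative
    (\<lambda>v. (c x * s' v - s x * c' v) / ((c x)\<^sup>2 + (s x)\<^sup>2))) (at x)"
proof -
  let ?z = "\<lambda>x. cis (- t) * Complex (c x) (s x)"
  have C: "Complex a b = of_real a + \<i> * of_real b" for a b by (simp add: complex_eq_iff)
  have z: "(?z has_derivative (\<lambda>v. cis (- t) * Complex (c' v) (s' v))) (at x)"
    unfolding C by (auto intro!: derivative_eq_intros c s simp: algebra_simps)
  have ns: "?z x \<notin> \<real>\<^sub>\<le>\<^sub>0" using o by (simp add: off_cut_def)
  have L: "(Ln has_derivative (\<lambda>h. inverse (?z x) * h)) (at (?z x))"
    using has_field_derivative_Ln[OF ns] by (simp add: has_field_derivative_def)
  have d: "((\<lambda>x. t + Im (Ln (?z x))) has_derivative (\<lambda>v. Im (inverse (?z x) * (cis (- t) * Complex (c' v) (s' v))))) (at x)"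
    using has_derivative_add[OF has_derivative_const[of t] has_derivative_Im[OF has_derivative_compose[OF z L]]] by simp
  have e: "Im (inverse (?z x) * (cis (- t) * Complex (c' v) (s' v))) = (c x * s' v - s x * c' v) / ((c x)\<^sup>2 + (s x)\<^sup>2)" for v
  proof -
    have "inverse (?z x) * (cis (- t) * Complex (c' v) (s' v)) = Complex (c' v) (s' v) / Complex (c x) (s x)"
      by (simp add: divide_inverse cis_mult)
    then show ?thesis by (simp add: Im_divide algebra_simps)
  qed
  have near: "\<forall>\<^sub>F y in nhds x. ?z y \<notin> \<real>\<^sub>\<le>\<^sub>0"
  proof -
    have "(?z \<longlongrightarrow> ?z x) (nhds x)"
      using has_derivative_continuous[OF z] by (simp add: continuous_at tendsto_nhds_iff)
    then show ?thesis
      using topological_tendstoD[of ?z "?z x" "nhds x" "- \<real>\<^sub>\<le>\<^sub>0"] ns by (auto simp: open_Compl)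
  qed
  then obtain T where T: "open T" "x \<in> T" "\<And>y. y \<in> T \<Longrightarrow> ?z y \<notin> \<real>\<^sub>\<le>\<^sub>0"
    unfolding eventually_nhds by blast
  have "((\<lambda>x. angle_near t (c x) (s x)) has_derivative (\<lambda>v. Im (inverse (?z x) * (cis (- t) * Complex (c' v) (s' v))))) (at x)"
  proof (rule has_derivative_transform_within_open[OF d T(1,2)])
    fix y assume "y \<in> T"
    then have "?z y \<noteq> 0" using T(3) by fastforce
    then show "t + Im (Ln (?z y)) = angle_near t (c y) (s y)"
      by (simp add: angle_near_def Arg_eq_Im_Ln)
  qed
  then show ?thesis unfolding e .
qed

lemma smooth_on_angle_near:
  fixes c s :: "'a::euclidean_space \<Rightarrow> real"
  assumes S: "open S" and c: "smooth_on S c" and s: "smooth_on S s" and o: "\<And>x. x \<in> S \<Longrightarrow> off_cut t (c x) (s x)"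
  shows "smooth_on S (\<lambda>x. angle_near t (c x) (s x))"
proof (rule smooth_onI_derivative[OF S has_derivative_angle_near[OF smooth_on_has_derivative[OF c] smooth_on_has_derivative[OF s] o]])
  show "smooth_on S (\<lambda>x. (c x * frechet_derivative s (at x) v - s x * frechet_derivative c (at x) v) / ((c x)\<^sup>2 + (s x)\<^sup>2))" for v
    by (intro smooth_on_divide smooth_on_diff smooth_on_mult smooth_on_add smooth_on_power S c s
      smooth_on_frechet_derivative polar_angle_near(4)[OF o])
qed

text \<open>A pair \<open>(x, y)\<close> stands for the point \<open>x + \<i>y\<close> of \<open>\<complex>\<^sup>n\<close>.\<close>

type_synonym 'n ambient = "(real^'n) \<times> (real^'n)"

definition sphere_torus :: "'n \<Rightarrow> 'n \<Rightarrow> 'n \<Rightarrow> 'n::finite ambient set" where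
  "sphere_torus p r q = {y. (fst y $ p)\<^sup>2 + (snd y $ p)\<^sup>2 + ((fst y $ q)\<^sup>2 + (snd y $ q)\<^sup>2) = 1 \<and>
     fst y $ r = 0 \<and> snd y $ r = 0 \<and> (\<forall>k. k \<noteq> p \<longrightarrow> k \<noteq> r \<longrightarrow> k \<noteq> q \<longrightarrow> (fst y $ k)\<^sup>2 + (snd y $ k)\<^sup>2 = 1)}"

text \<open>A coordinate vector \<open>x\<close> holds the real and imaginary part of \<open>z\<^sub>p\<close> in its slots \<open>p\<close> and \<open>r\<close>, and angles in
  all the other slots. This is why the plane \<open>r\<close> is left out of the manifold. Thus \<open>dsq p r x\<close> is \<open>|z\<^sub>p|\<^sup>2\<close>.\<close>

definition dsq :: "'n \<Rightarrow> 'n \<Rightarrow> real^'n::finite \<Rightarrow> real" where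
  "dsq p r x = (x $ p)\<^sup>2 + (x $ r)\<^sup>2"

definition modulus :: "'n \<Rightarrow> 'n \<Rightarrow> 'n \<Rightarrow> real^'n::finite \<Rightarrow> 'n \<Rightarrow> real" where
  "modulus p r q x k = (if k = q then sqrt (1 - dsq p r x) else 1)"

text \<open>The inverse of all charts at once, periodic in the angles. It is continuous on the closed solid \<open>|z\<^sub>p| \<le> 1\<close>,
  smooth on the open one, and maps the closed one onto the manifold.\<close>

definition param :: "'n \<Rightarrow> 'n \<Rightarrow> 'n \<Rightarrow> real^'n::finite \<Rightarrow> 'n ambient" where
  "param p r q x =
    (\<chi> k. if k = p then x $ p else if k = r then 0 else modulus p r q x k * cos (x $ k),
     \<chi> k. if k = p then x $ r else if k = r then 0 else modulus p r q x k * sin (x $ k))"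

definition solid :: "'n \<Rightarrow> 'n \<Rightarrow> (real^'n::finite) set" where
  "solid p r = {x. dsq p r x < 1}"

text \<open>The coordinate domain of the chart centred at the angles \<open>\<theta>\<close>; \<open>patch\<close> is the corresponding set of points.\<close>

definition box_around :: "'n \<Rightarrow> 'n \<Rightarrow> real^'n \<Rightarrow> (real^'n::finite) set" where
  "box_around p r \<theta> = {x. dsq p r x < 1 \<and> (\<forall>k. k \<noteq> p \<longrightarrow> k \<noteq> r \<longrightarrow> \<bar>x $ k - \<theta> $ k\<bar> < pi)}"

definition patch :: "'n \<Rightarrow> 'n \<Rightarrow> 'n \<Rightarrow> real^'n \<Rightarrow> 'n::finite ambient set" where
  "patch p r q \<theta> = {y \<in> sphere_torus p r q. \<forall>k. k \<noteq> p \<longrightarrow> k \<noteq> r \<longrightarrow> off_cut (\<theta> $ k) (fst y $ k) (snd y $ k)}"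

definition coords :: "'n \<Rightarrow> 'n \<Rightarrow> real^'n \<Rightarrow> 'n::finite ambient \<Rightarrow> real^'n" where
  "coords p r \<theta> y = (\<chi> k. if k = p then fst y $ p else if k = r then snd y $ p
     else angle_near (\<theta> $ k) (fst y $ k) (snd y $ k))"

definition torus_chart :: "'n \<Rightarrow> 'n \<Rightarrow> 'n \<Rightarrow> real^'n \<Rightarrow> ('n::finite ambient, 'n) chart" where
  "torus_chart p r q \<theta> = (patch p r q \<theta>, coords p r \<theta>)"

text \<open>Charts with a disc coordinate \<open>z\<^sub>p\<close> cover the points with \<open>z\<^sub>q \<noteq> 0\<close>, those with a disc coordinate \<open>z\<^sub>q\<close> the points with
  \<open>z\<^sub>p \<noteq> 0\<close>.\<close>

definition torus_atlas :: "'n \<Rightarrow> 'n \<Rightarrow> 'n \<Rightarrow> ('n::finite ambient, 'n) chart set" where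
  "torus_atlas p r q = range (torus_chart p r q) \<union> range (torus_chart q r p)"

lemma sphere_torus_swap: "sphere_torus q r p = sphere_torus p r q"
  by (auto simp: sphere_torus_def)

lemma torus_atlas_swap: "torus_atlas q r p = torus_atlas p r q"
  by (auto simp: torus_atlas_def)

locale three_axes =
  fixes p r q :: "'n::finite"
  assumes distinct: "p \<noteq> r" "p \<noteq> q" "r \<noteq> q"
begin

lemma axes_neq [simp]: "p \<noteq> r" "p \<noteq> q" "r \<noteq> q" "r \<noteq> p" "q \<noteq> p" "q \<noteq> r"
  using distinct by auto

lemma swapped: "three_axes q r p"
  by unfold_locales auto

lemma param_nth:
  "fst (param p r q x) $ k = (if k = p then x $ p else if k = r then 0 else modulus p r q x k * cos (x $ k))"
  "snd (param p r q x) $ k = (if k = p then x $ r else if k = r then 0 else modulus p r q x k * sin (x $ k))"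
  by (simp_all add: param_def)

lemma modulus_pos: "x \<in> solid p r \<Longrightarrow> modulus p r q x k > 0"
  by (simp add: modulus_def solid_def)

lemma param_modulus:
  assumes "x \<in> solid p r" "k \<noteq> p" "k \<noteq> r"
  shows "(fst (param p r q x) $ k)\<^sup>2 + (snd (param p r q x) $ k)\<^sup>2 = (if k = q then 1 - dsq p r x else 1)"
  using assms by (simp add: param_nth power_mult_distrib distrib_left[symmetric] modulus_def solid_def)

lemma param_in: "x \<in> solid p r \<Longrightarrow> param p r q x \<in> sphere_torus p r q"
  by (auto simp: sphere_torus_def param_modulus) (simp_all add: param_nth dsq_def)

lemma box_solid: "box_around p r \<theta> \<subseteq> solid p r"
  by (auto simp: box_around_def solid_def)

lemma param_patch:
  assumes "x \<in> box_around p r \<theta>"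
  shows "param p r q x \<in> patch p r q \<theta>" "coords p r \<theta> (param p r q x) = x"
proof -
  have x: "x \<in> solid p r" using assms box_solid by blast
  have *: "off_cut (\<theta> $ k) (fst (param p r q x) $ k) (snd (param p r q x) $ k)"
    "angle_near (\<theta> $ k) (fst (param p r q x) $ k) (snd (param p r q x) $ k) = x $ k" if "k \<noteq> p" "k \<noteq> r" for k
    using angle_near_polar[OF modulus_pos[OF x], of "x $ k" "\<theta> $ k"] assms that
    by (simp_all add: param_nth box_around_def)
  then show "param p r q x \<in> patch p r q \<theta>" using param_in[OF x] by (simp add: patch_def)
  show "coords p r \<theta> (param p r q x) = x" using * by (simp add: vec_eq_iff coords_def param_nth)
qed

lemma coords_box:
  assumes "y \<in> patch p r q \<theta>"
  shows "coords p r \<theta> y \<in> box_around p r \<theta>" "param p r q (coords p r \<theta> y) = y"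
proof -
  have y: "y \<in> sphere_torus p r q" using assms by (simp add: patch_def)
  note o = polar_angle_near
  have oc: "off_cut (\<theta> $ k) (fst y $ k) (snd y $ k)" if "k \<noteq> p" "k \<noteq> r" for k
    using assms that by (simp add: patch_def)
  have s: "dsq p r (coords p r \<theta> y) = 1 - ((fst y $ q)\<^sup>2 + (snd y $ q)\<^sup>2)"
    using y by (simp add: dsq_def coords_def sphere_torus_def)
  show "coords p r \<theta> y \<in> box_around p r \<theta>"
    using s o(4)[OF oc[of q]] o(1)[OF oc] by (simp add: box_around_def) (simp add: coords_def)
  have m: "modulus p r q (coords p r \<theta> y) k = sqrt ((fst y $ k)\<^sup>2 + (snd y $ k)\<^sup>2)" if "k \<noteq> p" "k \<noteq> r" for k
    using that y by (simp add: modulus_def s sphere_torus_def)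
  have "fst (param p r q (coords p r \<theta> y)) $ k = fst y $ k" "snd (param p r q (coords p r \<theta> y)) $ k = snd y $ k" for k
    using o(2,3)[OF oc[of k], symmetric] y
    by (cases "k = p"; cases "k = r"; simp add: param_nth m; simp add: coords_def sphere_torus_def)+
  then show "param p r q (coords p r \<theta> y) = y" by (simp add: prod_eq_iff vec_eq_iff)
qed

lemma
  shows img_torus_chart: "img (torus_chart p r q \<theta>) = box_around p r \<theta>"
    and pt_torus_chart: "x \<in> box_around p r \<theta> \<Longrightarrow> pt (torus_chart p r q \<theta>) x = param p r q x"
proof -
  show "img (torus_chart p r q \<theta>) = box_around p r \<theta>"
    unfolding img_def torus_chart_def fst_conv snd_conv
  proof (intro equalityI image_subsetI subsetI coords_box(1))
    fix x assume "x \<in> box_around p r \<theta>"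
    then show "x \<in> coords p r \<theta> ` patch p r q \<theta>" using param_patch by (metis imageI)
  qed
  have "inj_on (coords p r \<theta>) (patch p r q \<theta>)" by (rule inj_on_inverseI[where g = "param p r q"]) (rule coords_box(2))
  then show "pt (torus_chart p r q \<theta>) x = param p r q x" if "x \<in> box_around p r \<theta>"
    using inv_into_f_f[of "coords p r \<theta>" "patch p r q \<theta>" "param p r q x"] param_patch[OF that]
    by (simp add: pt_def torus_chart_def)
qed

lemma continuous_dsq: "continuous_on S (dsq p r)"
  unfolding dsq_def[abs_def] by (intro continuous_intros)

lemma open_solid: "open (solid p r)"
  unfolding solid_def using open_Collect_less[OF continuous_dsq continuous_on_const] .

lemma open_box: "open (box_around p r \<theta>)"
proof -
  have e: "box_around p r \<theta> = solid p r \<inter> (\<Inter>k\<in>-{p,r}. {x. \<bar>x $ k - \<theta> $ k\<bar> < pi})"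
    by (auto simp: box_around_def solid_def)
  show ?thesis
    unfolding e by (intro open_Int open_solid open_INT ballI open_Collect_less continuous_intros) simp
qed

lemma patch_open: "openin (top_of_set (sphere_torus p r q)) (patch p r q \<theta>)"
proof -
  have e: "patch p r q \<theta> = sphere_torus p r q \<inter>
      (\<Inter>k\<in>-{p,r}. (\<lambda>y. cis (- \<theta> $ k) * (of_real (fst y $ k) + \<i> * of_real (snd y $ k))) -` (- \<real>\<^sub>\<le>\<^sub>0))"
    by (auto simp: patch_def off_cut_def Complex_eq)
  have "open (\<Inter>k\<in>-{p,r}. (\<lambda>y::'n ambient. cis (- \<theta> $ k) * (of_real (fst y $ k) + \<i> * of_real (snd y $ k))) -` (- \<real>\<^sub>\<le>\<^sub>0))"
    by (intro open_INT ballI open_vimage continuous_intros) (auto simp: open_Compl)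
  then show ?thesis
    unfolding e openin_open by blast
qed

lemma smooth_dsq: "open S \<Longrightarrow> smooth_on S (dsq p r)"
  unfolding dsq_def[abs_def] by (intro smooth_on_add smooth_on_power smooth_on_nth)

lemma smooth_param_nth:
  "smooth_on (solid p r) (\<lambda>x. fst (param p r q x) $ k)" "smooth_on (solid p r) (\<lambda>x. snd (param p r q x) $ k)"
proof -
  have m: "smooth_on (solid p r) (\<lambda>x. modulus p r q x k)"
    unfolding modulus_def
    by (cases "k = q") (auto intro!: smooth_on_sqrt smooth_on_diff smooth_on_const smooth_dsq open_solid, auto simp: solid_def)
  show "smooth_on (solid p r) (\<lambda>x. fst (param p r q x) $ k)" "smooth_on (solid p r) (\<lambda>x. snd (param p r q x) $ k)"
    unfolding param_nth
    by (cases "k = p"; cases "k = r"; simp add: smooth_on_nth open_solid smooth_on_const smooth_on_mult m smooth_on_cos smooth_on_sin)+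
qed

lemma smooth_param: "smooth_on (solid p r) (param p r q)"
proof -
  have "smooth_on (solid p r) (\<lambda>x. (fst (param p r q x), snd (param p r q x)))"
    by (intro smooth_on_Pair smooth_on_vec open_solid smooth_param_nth)
  then show ?thesis by simp
qed

lemma smooth_pt: "smooth_on (box_around p r \<theta>) (pt (torus_chart p r q \<theta>))"
  by (rule smooth_on_cong[OF open_box _ smooth_on_subset[OF smooth_param box_solid]]) (simp add: pt_torus_chart)

lemma smooth_coords_param:
  assumes S: "open S" "S \<subseteq> solid p r"
    and k: "\<And>x. x \<in> S \<Longrightarrow> param p r q x \<in> patch p' r' q' \<theta>'"
  shows "smooth_on S (\<lambda>x. coords p' r' \<theta>' (param p r q x))"
proof (rule smooth_on_vec[OF S(1)])
  fix k
  note sm = smooth_on_subset[OF smooth_param_nth(1) S(2)] smooth_on_subset[OF smooth_param_nth(2) S(2)]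
  show "smooth_on S (\<lambda>x. coords p' r' \<theta>' (param p r q x) $ k)"
    unfolding coords_def vec_lambda_beta
    by (cases "k = p'"; cases "k = r'"; simp add: sm)
      (intro smooth_on_angle_near S(1) sm, use assms(3) in \<open>simp add: patch_def\<close>)
qed

lemma chart_homeomorphism:
  "homeomorphic_map (top_of_set (patch p r q \<theta>)) (top_of_set (box_around p r \<theta>)) (coords p r \<theta>)"
proof -
  have "continuous_on (patch p r q \<theta>) (coords p r \<theta>)"
    unfolding coords_def[abs_def] angle_near_def Complex_eq
  proof (rule continuous_on_vec_lambda)
    fix k
    show "continuous_on (patch p r q \<theta>) (\<lambda>y. if k = p then fst y $ p else if k = r then snd y $ p
       else \<theta> $ k + Arg (cis (- \<theta> $ k) * (complex_of_real (fst y $ k) + \<i> * complex_of_real (snd y $ k))))"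
      by (cases "k = p"; cases "k = r"; simp)
        (auto intro!: continuous_intros simp: patch_def off_cut_def Complex_eq)
  qed
  moreover have "continuous_on (box_around p r \<theta>) (param p r q)"
    by (rule smooth_on_continuous_on[OF smooth_on_subset[OF smooth_param box_solid]])
  ultimately show ?thesis
    unfolding homeomorphic_map_maps homeomorphic_maps_def
    by (intro exI[of _ "param p r q"]) (use param_patch coords_box in \<open>auto simp: continuous_map_in_subtopology\<close>)
qed

end

lemma second_countable_euclidean: "second_countable (euclidean :: 'a::second_countable_topology topology)"
proof -
  obtain \<B> :: "'a set set" where B: "countable \<B>" "\<And>C. C \<in> \<B> \<Longrightarrow> open C" "\<And>S. open S \<Longrightarrow> \<exists>U. U \<subseteq> \<B> \<and> S = \<Union>U"
    using univ_second_countable by blast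
  have "\<exists>V\<in>\<B>. x \<in> V \<and> V \<subseteq> U" if "open U" "x \<in> U" for U x
    using B(3)[OF that(1)] that(2) by blast
  then show ?thesis unfolding second_countable_def using B(1,2) by (intro exI[of _ \<B>]) auto
qed

lemma ex_off_cut:
  assumes "c\<^sup>2 + s\<^sup>2 > 0"
  shows "off_cut (Arg (Complex c s)) c s"
proof -
  let ?z = "Complex c s"
  have "?z \<noteq> 0" using assms by (auto simp: Complex_eq_0)
  moreover have "cis (- Arg ?z) * ?z = of_real (cmod ?z)"
    by (subst (2) rcis_cmod_Arg[symmetric]) (simp add: rcis_def cis_mult mult.left_commute)
  ultimately show ?thesis by (auto simp: off_cut_def complex_nonpos_Reals_iff)
qed

context three_axes begin

lemma patch_cover:
  assumes y: "y \<in> sphere_torus p r q" and q: "(fst y $ q)\<^sup>2 + (snd y $ q)\<^sup>2 > 0"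
  shows "y \<in> patch p r q (\<chi> k. Arg (Complex (fst y $ k) (snd y $ k)))"
proof -
  have "(fst y $ k)\<^sup>2 + (snd y $ k)\<^sup>2 > 0" if "k \<noteq> p" "k \<noteq> r" for k
    using that y q by (cases "k = q") (auto simp: sphere_torus_def)
  then show ?thesis using y by (simp add: patch_def ex_off_cut)
qed

lemma atlas_cases:
  assumes "c \<in> torus_atlas p r q"
  obtains \<theta> where "c = torus_chart p r q \<theta>" | \<theta> where "c = torus_chart q r p \<theta>"
  using assms by (auto simp: torus_atlas_def)

lemma atlas_chart:
  assumes c: "c \<in> torus_atlas p r q"
  obtains p' q' \<theta> where "three_axes p' r q'" "c = torus_chart p' r q' \<theta>"
    "sphere_torus p' r q' = sphere_torus p r q" "torus_atlas p' r q' = torus_atlas p r q"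
  using assms three_axes_axioms swapped sphere_torus_swap torus_atlas_swap by (metis atlas_cases)

lemma atlas_in: "torus_chart p r q \<theta> \<in> torus_atlas p r q" "torus_chart q r p \<theta> \<in> torus_atlas p r q"
  by (auto simp: torus_atlas_def)

lemma smooth_manifold_torus: "smooth_manifold (top_of_set (sphere_torus p r q)) (torus_atlas p r q)"
  unfolding smooth_manifold_def
proof (intro conjI ballI)
  show "Hausdorff_space (top_of_set (sphere_torus p r q))"
    by (simp add: Hausdorff_space_subtopology)
  show "second_countable (top_of_set (sphere_torus p r q))"
    by (intro second_countable_subtopology second_countable_euclidean)
  show "(\<Union>c\<in>torus_atlas p r q. cdom c) = topspace (top_of_set (sphere_torus p r q))"
  proof
    show "(\<Union>c\<in>torus_atlas p r q. cdom c) \<subseteq> topspace (top_of_set (sphere_torus p r q))"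
      by (auto simp: torus_atlas_def torus_chart_def patch_def sphere_torus_swap)
    show "topspace (top_of_set (sphere_torus p r q)) \<subseteq> (\<Union>c\<in>torus_atlas p r q. cdom c)"
    proof
      fix y assume "y \<in> topspace (top_of_set (sphere_torus p r q))"
      then have y: "y \<in> sphere_torus p r q" by simp
      then have "(fst y $ q)\<^sup>2 + (snd y $ q)\<^sup>2 > 0 \<or> (fst y $ p)\<^sup>2 + (snd y $ p)\<^sup>2 > 0"
        by (auto simp: sphere_torus_def not_less)
      then have "\<exists>\<theta>. y \<in> cdom (torus_chart p r q \<theta>) \<or> y \<in> cdom (torus_chart q r p \<theta>)"
        using patch_cover[OF y] three_axes.patch_cover[OF swapped, of y] y
        by (auto simp: torus_chart_def sphere_torus_swap)
      then show "y \<in> (\<Union>c\<in>torus_atlas p r q. cdom c)" using atlas_in by blast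
    qed
  qed
next
  fix c assume "c \<in> torus_atlas p r q"
  then obtain p' q' \<theta> where c: "three_axes p' r q'" "c = torus_chart p' r q' \<theta>"
    "sphere_torus p' r q' = sphere_torus p r q" by (metis atlas_chart)
  interpret c: three_axes p' r q' by (rule c(1))
  have "openin (top_of_set (sphere_torus p r q)) (cdom c)"
    using c.patch_open[of \<theta>] c by (simp add: torus_chart_def)
  moreover have "open (img c)" by (simp add: c(2) c.img_torus_chart c.open_box)
  moreover have "subtopology (top_of_set (sphere_torus p r q)) (patch p' r q' \<theta>) = top_of_set (patch p' r q' \<theta>)"
    unfolding subtopology_subtopology using c(3) by (metis (no_types, lifting) c.patch_open inf.absorb_iff2 openin_imp_subset)
  then have "homeomorphic_map (subtopology (top_of_set (sphere_torus p r q)) (cdom c)) (top_of_set (img c)) (coord c)"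
    using c.chart_homeomorphism[of \<theta>] by (simp add: c(2) c.img_torus_chart) (simp add: torus_chart_def)
  ultimately show "openin (top_of_set (sphere_torus p r q)) (cdom c)" "open (img c)"
      "homeomorphic_map (subtopology (top_of_set (sphere_torus p r q)) (cdom c)) (top_of_set (img c)) (coord c)"
    by simp_all
next
  fix c d assume cd: "c \<in> torus_atlas p r q" "d \<in> torus_atlas p r q"
  obtain p' q' \<theta> where c: "three_axes p' r q'" "c = torus_chart p' r q' \<theta>"
    "sphere_torus p' r q' = sphere_torus p r q" using cd(1) by (metis atlas_chart)
  obtain p'' q'' \<theta>' where d: "three_axes p'' r q''" "d = torus_chart p'' r q'' \<theta>'"
    "sphere_torus p'' r q'' = sphere_torus p r q" using cd(2) by (metis atlas_chart)
  interpret c: three_axes p' r q' by (rule c(1))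
  interpret d: three_axes p'' r q'' by (rule d(1))
  have o: "overlap c d = {x \<in> box_around p' r \<theta>. param p' r q' x \<in> patch p'' r q'' \<theta>'}"
    unfolding overlap_def c(2) d(2) torus_chart_def fst_conv snd_conv
  proof (intro equalityI subsetI)
    fix x assume "x \<in> coords p' r \<theta> ` (patch p' r q' \<theta> \<inter> patch p'' r q'' \<theta>')"
    then show "x \<in> {x \<in> box_around p' r \<theta>. param p' r q' x \<in> patch p'' r q'' \<theta>'}"
      using c.coords_box by auto
  next
    fix x assume "x \<in> {x \<in> box_around p' r \<theta>. param p' r q' x \<in> patch p'' r q'' \<theta>'}"
    then show "x \<in> coords p' r \<theta> ` (patch p' r q' \<theta> \<inter> patch p'' r q'' \<theta>')"
      using c.param_patch[of x \<theta>] by (metis (no_types, lifting) IntI imageI mem_Collect_eq)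
  qed
  have "open (overlap c d)"
  proof -
    have "openin (top_of_set (sphere_torus p r q)) (patch p'' r q'' \<theta>')" using d.patch_open d(3) by metis
    then obtain T where T: "open T" "patch p'' r q'' \<theta>' = sphere_torus p r q \<inter> T" by (metis openin_open)
    have "overlap c d = box_around p' r \<theta> \<inter> param p' r q' -` T"
      unfolding o T(2) using c.param_in c.box_solid c(3) by blast
    moreover have "openin (top_of_set (box_around p' r \<theta>)) (box_around p' r \<theta> \<inter> param p' r q' -` T)"
      by (rule continuous_openin_preimage_gen[OF smooth_on_continuous_on[OF smooth_on_subset[OF c.smooth_param c.box_solid]] T(1)])
    ultimately show ?thesis using openin_open_trans c.open_box by metis
  qed
  then have sm: "smooth_on (overlap c d) (\<lambda>x. coords p'' r \<theta>' (param p' r q' x))"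
    by (rule c.smooth_coords_param) (use o c.box_solid in auto)
  have "coords p'' r \<theta>' (param p' r q' x) = transition c d x" if "x \<in> overlap c d" for x
  proof -
    have "x \<in> box_around p' r \<theta>" using that unfolding o by blast
    then have "pt c x = param p' r q' x" unfolding c(2) by (rule c.pt_torus_chart)
    moreover have "coord d = coords p'' r \<theta>'" by (simp add: d(2) torus_chart_def)
    ultimately show ?thesis by (simp add: transition_def)
  qed
  then show "smooth_on (overlap c d) (transition c d)"
    by (rule smooth_on_cong[OF \<open>open (overlap c d)\<close> _ sm])
qed

text \<open>The torus is closed, being defined by equations between continuous functions, and each of its coordinates has
  modulus at most 1.\<close>

lemma compact_torus: "compact (sphere_torus p r q)"
proof -
  let ?N = "\<lambda>k y. (fst y $ k)\<^sup>2 + (snd y $ k)\<^sup>2 :: real"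
  have "closed (sphere_torus p r q)"
    unfolding sphere_torus_def Collect_conj_eq Collect_all_eq Collect_imp_eq
    by (intro closed_Int closed_INT closed_Un closed_Collect_eq continuous_intros ballI) auto
  moreover have "bounded (sphere_torus p r q)"
  proof -
    have n: "\<bar>fst y $ k\<bar> \<le> 1 \<and> \<bar>snd y $ k\<bar> \<le> 1" if "y \<in> sphere_torus p r q" for y k
    proof -
      have "?N k y \<le> 1"
      proof -
        have e: "?N p y + ?N q y = 1" and z: "k = r \<Longrightarrow> ?N k y = 0"
          and o: "k \<noteq> p \<Longrightarrow> k \<noteq> r \<Longrightarrow> k \<noteq> q \<Longrightarrow> ?N k y = 1"
          using that by (auto simp: sphere_torus_def)
        have "?N p y \<ge> 0" "?N q y \<ge> 0" by (rule sum_power2_ge_zero)+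
        then have "?N p y \<le> 1" "?N q y \<le> 1" using e by linarith+
        then show ?thesis using z o by (cases "k = p"; cases "k = q"; cases "k = r") auto
      qed
      then have "(fst y $ k)\<^sup>2 \<le> 1" "(snd y $ k)\<^sup>2 \<le> 1" by (smt (verit) zero_le_power2)+
      then show ?thesis by (simp add: abs_square_le_1)
    qed
    have "norm y \<le> real CARD('n) + real CARD('n)" if "y \<in> sphere_torus p r q" for y
    proof -
      have "norm y \<le> norm (fst y) + norm (snd y)" using norm_Pair_le[of "fst y" "snd y"] by simp
      also have "\<dots> \<le> (\<Sum>k\<in>UNIV. \<bar>fst y $ k\<bar>) + (\<Sum>k\<in>UNIV. \<bar>snd y $ k\<bar>)"
        by (intro add_mono norm_le_l1_cart)
      also have "\<dots> \<le> (\<Sum>k\<in>(UNIV::'n set). 1) + (\<Sum>k\<in>(UNIV::'n set). 1)"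
        by (intro add_mono sum_mono) (use n[OF that] in auto)
      finally show ?thesis by simp
    qed
    then show ?thesis using bounded_iff by blast
  qed
  ultimately show ?thesis by (simp add: compact_eq_bounded_closed)
qed

text \<open>The torus is the image of the closed solid under \<open>param\<close>, and the closed solid is starlike about the origin.\<close>

lemma connected_torus: "connected (sphere_torus p r q)"
proof -
  let ?C = "{x::real^'n. dsq p r x \<le> 1}"
  have "dsq p r ((1 - t) *\<^sub>R 0 + t *\<^sub>R x) \<le> 1" if "dsq p r x \<le> 1" "0 \<le> t" "t \<le> 1" for x t
  proof -
    have "dsq p r ((1 - t) *\<^sub>R 0 + t *\<^sub>R x) = t\<^sup>2 * dsq p r x"
      by (simp add: dsq_def power_mult_distrib distrib_left)
    also have "\<dots> \<le> 1 * 1"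
      using that by (intro mult_mono) (auto simp: abs_square_le_1 dsq_def)
    finally show ?thesis by simp
  qed
  then have "starlike ?C"
    unfolding starlike_def by (intro bexI[of _ 0]) (auto simp: closed_segment_def dsq_def)
  then have "connected ?C" by (rule starlike_imp_connected)
  moreover have "continuous_on ?C (param p r q)"
    unfolding param_def modulus_def
  proof (intro continuous_on_Pair continuous_on_vec_lambda)
    fix k
    show "continuous_on ?C (\<lambda>x. if k = p then x $ p else if k = r then 0 else (if k = q then sqrt (1 - dsq p r x) else 1) * cos (x $ k))"
      "continuous_on ?C (\<lambda>x. if k = p then x $ r else if k = r then 0 else (if k = q then sqrt (1 - dsq p r x) else 1) * sin (x $ k))"
      by (cases "k = p"; cases "k = r"; cases "k = q"; auto intro!: continuous_intros continuous_dsq)+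
  qed
  moreover have "param p r q ` ?C = sphere_torus p r q"
  proof (intro equalityI image_subsetI subsetI)
    fix x :: "real^'n" assume "x \<in> ?C"
    then show "param p r q x \<in> sphere_torus p r q"
      by (auto simp: sphere_torus_def param_nth power_mult_distrib distrib_left[symmetric] modulus_def) (simp add: dsq_def)
  next
    fix y assume y: "y \<in> sphere_torus p r q"
    define x :: "real^'n" where "x = (\<chi> k. if k = p then fst y $ p else if k = r then snd y $ p else Arg (Complex (fst y $ k) (snd y $ k)))"
    have s: "dsq p r x = 1 - ((fst y $ q)\<^sup>2 + (snd y $ q)\<^sup>2)"
      using y by (simp add: dsq_def x_def sphere_torus_def)
    have m: "modulus p r q x k = cmod (Complex (fst y $ k) (snd y $ k))" if "k \<noteq> p" "k \<noteq> r" for k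
      using that y by (simp add: modulus_def s sphere_torus_def complex_norm)
    have a: "cmod (Complex c s) * cos (Arg (Complex c s)) = c" "cmod (Complex c s) * sin (Arg (Complex c s)) = s" for c s
      using rcis_cmod_Arg[of "Complex c s"] by (metis Re_rcis complex.sel(1)) (metis Im_rcis complex.sel(2) rcis_cmod_Arg)
    have "fst (param p r q x) $ k = fst y $ k" "snd (param p r q x) $ k = snd y $ k" for k
      using y a[of "fst y $ k" "snd y $ k"]
      by (cases "k = p"; cases "k = r"; simp add: param_nth m; simp add: x_def sphere_torus_def)+
    then have "param p r q x = y" by (simp add: prod_eq_iff vec_eq_iff)
    moreover have "x \<in> ?C" by (simp add: s)
    ultimately show "y \<in> param p r q ` ?C" by blast
  qed
  ultimately show ?thesis using connected_continuous_image by metis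
qed

end

section \<open>Coefficient functions\<close>

text \<open>All local computations take place in this locale, in a chart with disc coordinate \<open>z\<^sub>p\<close>. Since the data are invariant under
  the exchange in \<open>swapped_weights\<close>, an interpretation of the locale with \<open>q r p b a\<close> covers the other charts.\<close>

locale two_weights = three_axes p r q for p r q :: "'n::finite" +
  fixes a b :: real
  assumes a_pos: "a > 0" and b_pos: "b > 0"
begin

lemma swapped_weights: "two_weights q r p b a"
  by unfold_locales (use a_pos b_pos in auto)

text \<open>Indicators of the three distinguished indices. Every tensor below is a combination of products of \<open>P\<close>, \<open>R\<close>, \<open>Q\<close> with functions
  of \<open>|z\<^sub>p|\<^sup>2\<close>, which lets polynomial arithmetic decide tensor identities for all values of the free indices at once.
  The covector \<open>w\<close> is half the differential of \<open>|z\<^sub>p|\<^sup>2\<close>, \<open>kd\<close> is the flat metric of the disc, and \<open>flat\<close> is the metric of the torus factor.\<close>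

definition P :: "'n \<Rightarrow> real" where "P i = (if i = p then 1 else 0)"
definition R :: "'n \<Rightarrow> real" where "R i = (if i = r then 1 else 0)"
definition Q :: "'n \<Rightarrow> real" where "Q i = (if i = q then 1 else 0)"
definition flat :: "'n \<Rightarrow> 'n \<Rightarrow> real" where "flat i j = (if i = j \<and> i \<noteq> p \<and> i \<noteq> r \<and> i \<noteq> q then 1 else 0)"
definition w :: "real^'n \<Rightarrow> 'n \<Rightarrow> real" where "w x i = x $ p * P i + x $ r * R i"

definition kd :: "'n \<Rightarrow> 'n \<Rightarrow> real" where "kd i j = P i * P j + R i * R j"

lemma PRQ_simps [simp]:
  "P p = 1" "P r = 0" "P q = 0" "R p = 0" "R r = 1" "R q = 0" "Q p = 0" "Q r = 0" "Q q = 1"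
  by (simp_all add: P_def R_def Q_def)

lemma off_axes [simp]:
  "i \<noteq> p \<Longrightarrow> P i = 0" "i \<noteq> r \<Longrightarrow> R i = 0" "i \<noteq> q \<Longrightarrow> Q i = 0"
  by (simp_all add: P_def R_def Q_def)

lemma flat_simps [simp]: "flat p j = 0" "flat r j = 0" "flat q j = 0" "flat i p = 0" "flat i r = 0" "flat i q = 0"
  by (auto simp: flat_def)

lemma axis_nth_PRQ: "axis m (1::real) $ p = P m" "axis m (1::real) $ r = R m" "axis m (1::real) $ q = Q m"
  by (auto simp: axis_def P_def R_def Q_def)

lemma sum_axes:
  fixes F :: "'n \<Rightarrow> real"
  assumes "\<And>i. i \<noteq> p \<Longrightarrow> i \<noteq> r \<Longrightarrow> i \<noteq> q \<Longrightarrow> F i = 0"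
  shows "(\<Sum>i\<in>UNIV. F i) = F p + F r + F q"
proof -
  have "(\<Sum>i\<in>UNIV. F i) = (\<Sum>i\<in>{p,r,q}. F i)"
    by (rule sum.mono_neutral_right) (use assms in auto)
  then show ?thesis by (simp add: add.assoc)
qed

lemma has_derivative_radial:
  assumes "(\<phi> has_real_derivative d) (at (dsq p r x))"
  shows "((\<lambda>y. \<phi> (dsq p r y)) has_derivative (\<lambda>h. d * (2 * (x $ p * h $ p + x $ r * h $ r)))) (at x)"
proof -
  have "(dsq p r has_derivative (\<lambda>h. 2 * (x $ p * h $ p + x $ r * h $ r))) (at x)"
    unfolding dsq_def[abs_def] by (auto intro!: derivative_eq_intros bounded_linear_imp_has_derivative bounded_linear_vec_nth simp: field_simps)
  from has_derivative_compose[OF this assms[unfolded has_field_derivative_def]] show ?thesis .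
qed

lemma has_derivative_w: "((\<lambda>y. w y i) has_derivative (\<lambda>h. h $ p * P i + h $ r * R i)) (at x)"
  unfolding w_def
  by (intro has_derivative_add has_derivative_mult_left bounded_linear_imp_has_derivative bounded_linear_vec_nth)

text \<open>The argument \<open>t\<close> stands for \<open>|z\<^sub>p|\<^sup>2\<close>. Since \<open>|z\<^sub>q|\<^sup>2 = 1 - t\<close>, \<open>cD\<close> is the function \<open>\<Delta>\<close>. The metric is
  \<open>cA \<cdot> kd + cB \<cdot> w \<otimes> w + cS \<cdot> Q \<otimes> Q + flat\<close>, the Christoffel symbols have the coefficients \<open>cM\<close>, \<open>cK1\<close>, \<open>cK2\<close>, \<open>cK3\<close> and \<open>- cB\<close>
  (see \<open>Gam\<close>), and a prime marks the derivative with respect to \<open>t\<close>. Moreover \<open>cM\<close> is the derivative of \<open>- ln \<Delta>\<close>, that is, of the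
  potential.\<close>

definition cD :: "real \<Rightarrow> real" where "cD t = a + (b - a) * t"
definition cA :: "real \<Rightarrow> real" where "cA t = a / cD t"
definition cB :: "real \<Rightarrow> real" where "cB t = b / (cD t * (1 - t))"
definition cS :: "real \<Rightarrow> real" where "cS t = b * (1 - t) / cD t"
definition cA' :: "real \<Rightarrow> real" where "cA' t = - a * (b - a) / (cD t)^2"
definition cB' :: "real \<Rightarrow> real" where "cB' t = b * (cD t - (b - a) * (1 - t)) / (cD t * (1 - t))^2"
definition cS' :: "real \<Rightarrow> real" where "cS' t = - (b^2) / (cD t)^2"
definition cM :: "real \<Rightarrow> real" where "cM t = - (b - a) / cD t"
definition cM' :: "real \<Rightarrow> real" where "cM' t = (b - a)^2 / (cD t)^2"
definition cK1 :: "real \<Rightarrow> real" where "cK1 t = b / cD t + a * (b - a) * (1 - t) / (cD t)^2"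
definition cK1' :: "real \<Rightarrow> real" where
  "cK1' t = - b * (b - a) / (cD t)^2 - a * (b - a) / (cD t)^2 - 2 * a * (b - a)^2 * (1 - t) / (cD t)^3"
definition cK2 :: "real \<Rightarrow> real" where "cK2 t = b * (b - a) / (cD t)^2 + cB t"
definition cK2' :: "real \<Rightarrow> real" where "cK2' t = - 2 * b * (b - a)^2 / (cD t)^3 + cB' t"
definition cK3 :: "real \<Rightarrow> real" where "cK3 t = (1 - t) * b^2 / (cD t)^2"
definition cK3' :: "real \<Rightarrow> real" where "cK3' t = - (b^2) / (cD t)^2 - 2 * (b - a) * (1 - t) * b^2 / (cD t)^3"

lemma cD_pos: assumes "0 \<le> t" "t < 1" shows "cD t > 0"
proof -
  have "cD t = a * (1 - t) + b * t" by (simp add: cD_def algebra_simps)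
  then show ?thesis using assms a_pos b_pos by (simp add: add_pos_nonneg)
qed

lemma cD_DERIV: "(cD has_real_derivative (b - a)) (at t)"
  unfolding cD_def[abs_def] by (auto intro!: derivative_eq_intros)

lemma coeff_DERIV:
  assumes "0 \<le> t" "t < 1"
  shows "(cA has_real_derivative cA' t) (at t)" "(cB has_real_derivative cB' t) (at t)"
    "(cS has_real_derivative cS' t) (at t)" "(cM has_real_derivative cM' t) (at t)"
    "(cK1 has_real_derivative cK1' t) (at t)" "(cK2 has_real_derivative cK2' t) (at t)"
    "(cK3 has_real_derivative cK3' t) (at t)"
proof -
  have D: "cD t \<noteq> 0" "1 - t \<noteq> 0" using cD_pos[OF assms] assms by auto
  then have D3: "cD t * (1 - t) \<noteq> 0" "(cD t)^2 \<noteq> 0" by auto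
  have D2: "cD t = a + (b - a) * t" by (rule cD_def)
  have "DERIV (\<lambda>t. a / cD t) t :> cA' t"
    by (rule derivative_eq_intros cD_DERIV D D3 refl)+ (use D in \<open>simp add: cA'_def power2_eq_square\<close>)
  then show "(cA has_real_derivative cA' t) (at t)" by (simp add: cA_def[abs_def])
  have "DERIV (\<lambda>t. b / (cD t * (1 - t))) t :> cB' t"
    by (rule derivative_eq_intros cD_DERIV D D3 refl)+ (use D in \<open>simp add: cB'_def power2_eq_square algebra_simps\<close>)
  then show B: "(cB has_real_derivative cB' t) (at t)" by (simp add: cB_def[abs_def])
  have "DERIV (\<lambda>t. b * (1 - t) / cD t) t :> cS' t"
    apply (rule derivative_eq_intros cD_DERIV D D3 refl)+
    using D by (simp add: cS'_def power2_eq_square divide_simps) (simp add: D2 algebra_simps)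
  then show "(cS has_real_derivative cS' t) (at t)" by (simp add: cS_def[abs_def])
  have "DERIV (\<lambda>t. - (b - a) / cD t) t :> cM' t"
    by (rule derivative_eq_intros cD_DERIV D D3 refl)+ (use D in \<open>simp add: cM'_def power2_eq_square algebra_simps\<close>)
  then show "(cM has_real_derivative cM' t) (at t)" by (simp add: cM_def[abs_def])
  have "DERIV (\<lambda>t. b / cD t + a * (b - a) * (1 - t) / (cD t)^2) t :> cK1' t"
    apply (rule derivative_eq_intros cD_DERIV D D3 refl)+
    using D by (simp add: cK1'_def divide_simps) algebra
  then show "(cK1 has_real_derivative cK1' t) (at t)" by (simp add: cK1_def[abs_def])
  have "DERIV (\<lambda>t. b * (b - a) / (cD t)^2 + cB t) t :> cK2' t"
    apply (rule derivative_eq_intros cD_DERIV D D3 B refl)+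
    using D by (simp add: cK2'_def divide_simps) algebra
  then show "(cK2 has_real_derivative cK2' t) (at t)" by (simp add: cK2_def[abs_def])
  have "DERIV (\<lambda>t. (1 - t) * b^2 / (cD t)^2) t :> cK3' t"
    apply (rule derivative_eq_intros cD_DERIV D D3 refl)+
    using D by (simp add: cK3'_def divide_simps) algebra
  then show "(cK3 has_real_derivative cK3' t) (at t)" by (simp add: cK3_def[abs_def])
qed

text \<open>The equations for the coefficients of the inverse metric \<open>GI\<close>.\<close>

lemma inverse_coeffs:
  assumes "0 \<le> t" "t < 1"
  shows "cD t * cA t / a = 1" "cD t * cB t / a = b / a * (cA t + cB t * t)" "cS t * (1 / cS t) = 1"
  using cD_pos[OF assms] assms a_pos b_pos
  by (simp_all add: cA_def cB_def cS_def divide_simps) (simp_all add: cD_def algebra_simps)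

text \<open>Raising the first index of the Christoffel symbols turns the derivatives of \<open>cA\<close>, \<open>cB\<close>, \<open>cS\<close> into the coefficients of \<open>Gam\<close>.\<close>

lemma raise_coeffs:
  assumes "0 \<le> t" "t < 1"
  shows "cD t / a * cA' t = cM t"
    "- (cD t / a) * cA' t + cD t / a * cB t - b / a * (cB t * t - t * cA' t) = cK1 t"
    "cD t / a * cB' t - b / a * (2 * cA' t + cB' t * t) = cK2 t"
    "- (cD t / a - b / a * t) * cS' t = cK3 t"
    "cS' t / cS t = - cB t"
proof -
  have D: "cD t \<noteq> 0" "1 - t \<noteq> 0" "a \<noteq> 0" "b \<noteq> 0" using cD_pos[OF assms] assms a_pos b_pos by auto
  show "cD t / a * cA' t = cM t" using D by (simp add: cA'_def cM_def divide_simps power2_eq_square)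
  show "- (cD t / a) * cA' t + cD t / a * cB t - b / a * (cB t * t - t * cA' t) = cK1 t"
    using D by (simp add: cA'_def cB_def cK1_def divide_simps) (simp add: cD_def algebra_simps power2_eq_square power3_eq_cube)
  show "cD t / a * cB' t - b / a * (2 * cA' t + cB' t * t) = cK2 t"
    using D by (simp add: cA'_def cB'_def cB_def cK2_def divide_simps) (simp add: cD_def algebra_simps power2_eq_square power3_eq_cube)
  show "- (cD t / a - b / a * t) * cS' t = cK3 t"
    using D by (simp add: cS'_def cK3_def divide_simps) (simp add: cD_def algebra_simps power2_eq_square)
  show "cS' t / cS t = - cB t"
    using D by (simp add: cS'_def cS_def cB_def divide_simps power2_eq_square)
qed

text \<open>The first identity says that the trace \<open>\<Gamma>\<^sup>i\<^sub>i\<^sub>j\<close>, which is the logarithmic derivative of the volume density \<open>sqrt (a * b) / \<Delta>\<close>,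
  equals \<open>\<partial>\<^sub>jf\<close>. The other three are the coefficients of \<open>kd\<close>, \<open>w \<otimes> w\<close> and \<open>Q \<otimes> Q\<close> in the equation \<open>Rc + \<nabla>\<^sup>2f = H\<^sup>2/4\<close>.\<close>

lemma soliton_coeffs:
  assumes "0 \<le> t" "t < 1"
  shows "3 * cM t + cK1 t + cK2 t * t - cB t = 2 * cM t"
    "2 * cM t + 2 * cK1 t + 2 * t * cK1' t - 2 * cM t * t * cK1 t = 2 * a * b / (cD t)^2 * cA t"
    "4 * cM' t + 4 * cK2 t + 2 * t * cK2' t - (5 * (cM t)^2 + 2 * cM t * (cK1 t + cK2 t * t)
       + 2 * cM t * t * cK2 t + (cK1 t + cK2 t * t)^2 + (cB t)^2) = 2 * a * b / (cD t)^2 * cB t"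
    "2 * cK3 t + 2 * t * cK3' t + 2 * cB t * t * cK3 t = 2 * a * b / (cD t)^2 * cS t"
proof -
  \<comment> \<open>In the variables \<open>\<Delta>\<close>, \<open>1 - t\<close> and \<open>b - a\<close> no relation between the quantities is left, and clearing denominators gives polynomial identities.\<close>
  define D where "D = cD t"
  define c where "c = 1 - t"
  define d where "d = b - a"
  have nz: "D \<noteq> 0" "c \<noteq> 0" using cD_pos[OF assms] assms by (auto simp: D_def c_def)
  have t: "t = 1 - c" by (simp add: c_def)
  have b: "b = D + d * c" by (simp add: D_def c_def d_def cD_def algebra_simps)
  have a: "a = D + d * c - d" using b by (simp add: d_def)
  note e = cM_def cM'_def cB_def cB'_def cK1_def cK1'_def cK2_def cK2'_def cK3_def cK3'_def cA_def cS_def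
    D_def[symmetric] c_def[symmetric] d_def[symmetric]
  show "3 * cM t + cK1 t + cK2 t * t - cB t = 2 * cM t"
    unfolding e using nz by (simp add: t a b divide_simps) algebra
  show "2 * cM t + 2 * cK1 t + 2 * t * cK1' t - 2 * cM t * t * cK1 t = 2 * a * b / (cD t)^2 * cA t"
    unfolding e using nz by (simp add: t a b divide_simps) algebra
  show "2 * cK3 t + 2 * t * cK3' t + 2 * cB t * t * cK3 t = 2 * a * b / (cD t)^2 * cS t"
    unfolding e using nz by (simp add: t a b divide_simps) algebra
  show "4 * cM' t + 4 * cK2 t + 2 * t * cK2' t - (5 * (cM t)^2 + 2 * cM t * (cK1 t + cK2 t * t)
       + 2 * cM t * t * cK2 t + (cK1 t + cK2 t * t)^2 + (cB t)^2) = 2 * a * b / (cD t)^2 * cB t"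
    unfolding e using nz by (simp add: t a b divide_simps) algebra
qed

section \<open>Curvature, Hessian and flux in a chart\<close>

text \<open>The metric and its inverse in coordinates.\<close>

definition G :: "real^'n \<Rightarrow> 'n \<Rightarrow> 'n \<Rightarrow> real" where
  "G x i j = cA (dsq p r x) * kd i j + cB (dsq p r x) * w x i * w x j + cS (dsq p r x) * Q i * Q j + flat i j"

definition GI :: "real^'n \<Rightarrow> 'n \<Rightarrow> 'n \<Rightarrow> real" where
  "GI x i j = cD (dsq p r x) / a * kd i j - b / a * w x i * w x j + 1 / cS (dsq p r x) * Q i * Q j + flat i j"

lemma dsq_bounds: "x \<in> solid p r \<Longrightarrow> 0 \<le> dsq p r x" "x \<in> solid p r \<Longrightarrow> dsq p r x < 1"
  by (auto simp: solid_def dsq_def)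

lemma w_simps [simp]: "w x p = x $ p" "w x r = x $ r" "w x q = 0"
  by (simp_all add: w_def)

lemma index_cases: obtains "i = p" | "i = r" | "i = q" | "i \<noteq> p" "i \<noteq> r" "i \<noteq> q"
  by blast

lemma off_w [simp]: "i \<noteq> p \<Longrightarrow> i \<noteq> r \<Longrightarrow> w x i = 0"
  by (simp add: w_def)

lemma GI_G:
  assumes x: "x \<in> solid p r"
  shows "(\<Sum>m\<in>UNIV. GI x i m * G x m j) = (if i = j then 1 else 0)"
proof -
  define A B C D' F where "A = cA (dsq p r x)" and "B = cB (dsq p r x)" and "C = cS (dsq p r x)"
    and "D' = cD (dsq p r x) / a" and "F = b / a"
  have s: "dsq p r x = x $ p * x $ p + x $ r * x $ r" by (simp add: dsq_def power2_eq_square)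
  have e: "D' * A = 1" "D' * B = F * (A + B * (x $ p * x $ p + x $ r * x $ r))" "C * (1 / C) = 1"
    using inverse_coeffs[OF dsq_bounds[OF x]] by (simp_all add: A_def B_def C_def D'_def F_def s)
  define C' where "C' = 1 / C"
  have e3: "C * C' = 1" using e(3) by (simp add: C'_def)
  have G: "G x i j = A * kd i j + B * w x i * w x j + C * Q i * Q j + flat i j" for i j
    by (simp add: G_def A_def B_def C_def)
  have GI: "GI x i j = D' * kd i j - F * w x i * w x j + C' * Q i * Q j + flat i j" for i j
    by (simp add: GI_def D'_def F_def C'_def C_def)
  show ?thesis
  proof (cases "i \<noteq> p \<and> i \<noteq> r \<and> i \<noteq> q")
    case True
    then have "GI x i m * G x m j = (if i = m then G x m j else 0)" for m
      by (auto simp: GI kd_def flat_def)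
    then have "(\<Sum>m\<in>UNIV. GI x i m * G x m j) = G x i j" by simp
    then show ?thesis using True by (simp add: G kd_def flat_def)
  next
    case False
    then have "(\<Sum>m\<in>UNIV. GI x i m * G x m j) = GI x i p * G x p j + GI x i r * G x r j + GI x i q * G x q j"
      by (intro sum_axes) (auto simp: GI kd_def flat_def)
    also have "\<dots> = (if i = j then 1 else 0)"
    proof -
      define u v where "u = x $ p" and "v = x $ r"
      note d = G GI kd_def w_def PRQ_simps flat_simps u_def[symmetric] v_def[symmetric]
      have 1: "D' * B = F * (A + B * (u * u + v * v))" using e(2) by (simp add: u_def v_def)
      have "GI x p p * G x p j + GI x p r * G x r j + GI x p q * G x q j = P j"
        unfolding d using e(1) 1 by algebra
      moreover have "GI x r p * G x p j + GI x r r * G x r j + GI x r q * G x q j = R j"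
        unfolding d using e(1) 1 by algebra
      moreover have "GI x q p * G x p j + GI x q r * G x r j + GI x q q * G x q j = Q j"
        unfolding d using e3 by algebra
      ultimately show ?thesis using False by (auto simp: P_def R_def Q_def)
    qed
    finally show ?thesis .
  qed
qed

lemma ginv_eq:
  assumes g: "\<And>i j. g c x i j = G x i j" and x: "x \<in> solid p r"
  shows "ginv g c x i j = GI x i j"
proof -
  let ?I = "\<chi> i j. GI x i j"
  have "?I ** metric_matrix g c x = mat 1"
    using GI_G[OF x] by (simp add: vec_eq_iff matrix_matrix_mult_def metric_matrix_def g mat_def)
  then have 1: "?I ** metric_matrix g c x = mat 1" "metric_matrix g c x ** ?I = mat 1"
    using matrix_left_right_inverse by blast+
  then have "\<exists>B. metric_matrix g c x ** B = mat 1 \<and> B ** metric_matrix g c x = mat 1" by blast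
  then have "metric_matrix g c x ** matrix_inv (metric_matrix g c x) = mat 1"
    unfolding matrix_inv_def by (metis (mono_tags, lifting) someI_ex)
  then have "?I = matrix_inv (metric_matrix g c x)"
    by (metis 1(1) matrix_mul_assoc matrix_mul_lid matrix_mul_rid)
  then show ?thesis by (metis (no_types, lifting) ginv_def vec_lambda_beta)
qed

definition dG :: "'n \<Rightarrow> real^'n \<Rightarrow> 'n \<Rightarrow> 'n \<Rightarrow> real" where
  "dG m x i j = cA' (dsq p r x) * (2 * w x m) * kd i j
     + (cB' (dsq p r x) * (2 * w x m) * w x i * w x j + cB (dsq p r x) * (kd m i * w x j + w x i * kd m j))
     + cS' (dsq p r x) * (2 * w x m) * Q i * Q j"

lemma pd_radial_w:
  "2 * (x $ p * axis m (1::real) $ p + x $ r * axis m 1 $ r) = 2 * w x m"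
  "axis m (1::real) $ p * P i + axis m 1 $ r * R i = kd m i"
  by (simp_all add: axis_nth_PRQ w_def kd_def)

lemma pd_G:
  assumes x: "x \<in> solid p r"
  shows "pd m (\<lambda>y. G y i j) x = dG m x i j"
proof -
  note c = coeff_DERIV[OF dsq_bounds[OF x], THEN has_derivative_radial]
  have "((\<lambda>y. G y i j) has_derivative (\<lambda>h.
     cA' (dsq p r x) * (2 * (x $ p * h $ p + x $ r * h $ r)) * kd i j
     + (cB (dsq p r x) * w x i * (h $ p * P j + h $ r * R j)
        + (cB (dsq p r x) * (h $ p * P i + h $ r * R i) + cB' (dsq p r x) * (2 * (x $ p * h $ p + x $ r * h $ r)) * w x i) * w x j)
     + cS' (dsq p r x) * (2 * (x $ p * h $ p + x $ r * h $ r)) * Q i * Q j + 0)) (at x)"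
    unfolding G_def
    by (intro has_derivative_add has_derivative_mult has_derivative_mult_left has_derivative_w c has_derivative_const)
  from pd_eqI[OF this, of m] show ?thesis
    unfolding pd_radial_w dG_def by (simp add: algebra_simps)
qed

text \<open>The Christoffel symbols \<open>\<Gamma>\<^sup>l\<^sub>i\<^sub>j\<close>; \<open>Gam_low\<close> is the same with the first index lowered.\<close>

definition Gam :: "real^'n \<Rightarrow> 'n \<Rightarrow> 'n \<Rightarrow> 'n \<Rightarrow> real" where
  "Gam x l i j = cM (dsq p r x) * (w x i * kd j l + w x j * kd i l)
     + (cK1 (dsq p r x) * (w x l * kd i j) + cK2 (dsq p r x) * (w x l * w x i * w x j) + cK3 (dsq p r x) * (w x l * Q i * Q j))
     - cB (dsq p r x) * (Q l * (w x i * Q j + w x j * Q i))"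

definition Gam_low :: "real^'n \<Rightarrow> 'n \<Rightarrow> 'n \<Rightarrow> 'n \<Rightarrow> real" where
  "Gam_low x m i j = cA' (dsq p r x) * (w x i * kd j m + w x j * kd i m - w x m * kd i j)
     + cB (dsq p r x) * kd i j * w x m + cB' (dsq p r x) * w x i * w x j * w x m
     + cS' (dsq p r x) * (w x i * Q j * Q m + w x j * Q i * Q m - w x m * Q i * Q j)"

lemma christoffel_eq:
  assumes S: "open S" "x \<in> S" "S \<subseteq> solid p r" and g: "\<And>y i j. y \<in> S \<Longrightarrow> g c y i j = G y i j"
  shows "christoffel g c x l i j = Gam x l i j"
proof -
  have x: "x \<in> solid p r" using S by auto
  have pdg: "pd m (\<lambda>y. g c y i j) x = dG m x i j" for m i j
    using pd_cong_open[OF S(1,2), of "\<lambda>y. g c y i j" "\<lambda>y. G y i j"] g pd_G[OF x] by simp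
  have low: "dG i x j m + dG j x i m - dG m x i j = 2 * Gam_low x m i j" for m
    unfolding dG_def Gam_low_def kd_def by algebra
  have "christoffel g c x l i j = (\<Sum>m\<in>UNIV. GI x l m * (2 * Gam_low x m i j)) / 2"
    unfolding christoffel_def pdg low using ginv_eq[of g c x, OF g[OF S(2)] x] by simp
  also have "(\<Sum>m\<in>UNIV. GI x l m * (2 * Gam_low x m i j)) =
      GI x l p * (2 * Gam_low x p i j) + GI x l r * (2 * Gam_low x r i j) + GI x l q * (2 * Gam_low x q i j)"
    by (rule sum_axes) (simp add: Gam_low_def kd_def)
  also have "\<dots> / 2 = Gam x l i j"
  proof -
    define A1 B B1 S1 M K1 K2 K3 D' F C' where "A1 = cA' (dsq p r x)" and "B = cB (dsq p r x)"
      and "B1 = cB' (dsq p r x)" and "S1 = cS' (dsq p r x)" and "M = cM (dsq p r x)" and "K1 = cK1 (dsq p r x)"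
      and "K2 = cK2 (dsq p r x)" and "K3 = cK3 (dsq p r x)" and "D' = cD (dsq p r x) / a" and "F = b / a"
      and "C' = 1 / cS (dsq p r x)"
    have s: "dsq p r x = x $ p * x $ p + x $ r * x $ r" by (simp add: dsq_def power2_eq_square)
    define u v where "u = x $ p" and "v = x $ r"
    have e: "D' * A1 = M" "- D' * A1 + D' * B - F * (B * (u * u + v * v) - (u * u + v * v) * A1) = K1"
       "D' * B1 - F * (2 * A1 + B1 * (u * u + v * v)) = K2" "- (D' - F * (u * u + v * v)) * S1 = K3" "S1 * C' = - B"
      using raise_coeffs[OF dsq_bounds[OF x]]
      by (simp_all add: A1_def B_def B1_def S1_def M_def K1_def K2_def K3_def D'_def F_def C'_def s u_def v_def)
    note d = GI_def Gam_def Gam_low_def kd_def w_def PRQ_simps flat_simps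
      A1_def[symmetric] B_def[symmetric] B1_def[symmetric] S1_def[symmetric] M_def[symmetric] K1_def[symmetric]
      K2_def[symmetric] K3_def[symmetric] D'_def[symmetric] F_def[symmetric] C'_def[symmetric] u_def[symmetric] v_def[symmetric]
    have "GI x p p * (2 * Gam_low x p i j) + GI x p r * (2 * Gam_low x r i j) + GI x p q * (2 * Gam_low x q i j) = 2 * Gam x p i j"
      unfolding d e(1-4)[symmetric] by algebra
    moreover have "GI x r p * (2 * Gam_low x p i j) + GI x r r * (2 * Gam_low x r i j) + GI x r q * (2 * Gam_low x q i j) = 2 * Gam x r i j"
      unfolding d e(1-4)[symmetric] by algebra
    moreover have "GI x q p * (2 * Gam_low x p i j) + GI x q r * (2 * Gam_low x r i j) + GI x q q * (2 * Gam_low x q i j) = 2 * Gam x q i j"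
      unfolding d using e(5) by algebra
    ultimately show ?thesis
      by (cases l rule: index_cases) (simp_all add: GI_def Gam_def kd_def)
  qed
  finally show ?thesis .
qed

text \<open>The derivative of the first identity in \<open>soliton_coeffs\<close>.\<close>

lemma trace_coeff_derivative:
  assumes "0 \<le> t" "t < 1"
  shows "3 * cM' t + cK1' t + cK2' t * t + cK2 t - cB' t = 2 * cM' t"
proof -
  define D where "D = cD t"
  define c where "c = 1 - t"
  define d where "d = b - a"
  have nz: "D \<noteq> 0" "c \<noteq> 0" using cD_pos[OF assms] assms by (auto simp: D_def c_def)
  have t: "t = 1 - c" by (simp add: c_def)
  have b: "b = D + d * c" by (simp add: D_def c_def d_def cD_def algebra_simps)
  have a: "a = D + d * c - d" using b by (simp add: d_def)
  show ?thesis
    unfolding cM'_def cB_def cB'_def cK1'_def cK2_def cK2'_def D_def[symmetric] c_def[symmetric] d_def[symmetric]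
    using nz by (simp add: t a b divide_simps) algebra
qed

definition dGam :: "'n \<Rightarrow> real^'n \<Rightarrow> 'n \<Rightarrow> 'n \<Rightarrow> 'n \<Rightarrow> real" where
  "dGam m x l i j =
     cM' (dsq p r x) * (2 * w x m) * (w x i * kd j l + w x j * kd i l) + cM (dsq p r x) * (kd m i * kd j l + kd m j * kd i l)
     + kd m l * (cK1 (dsq p r x) * kd i j + cK2 (dsq p r x) * w x i * w x j + cK3 (dsq p r x) * Q i * Q j)
     + w x l * (2 * w x m) * (cK1' (dsq p r x) * kd i j + cK2' (dsq p r x) * w x i * w x j + cK3' (dsq p r x) * Q i * Q j)
     + w x l * cK2 (dsq p r x) * (kd m i * w x j + w x i * kd m j)
     - cB' (dsq p r x) * (2 * w x m) * (Q l * (w x i * Q j + w x j * Q i))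
     - cB (dsq p r x) * (Q l * (kd m i * Q j + kd m j * Q i))"

lemma pd_Gam:
  assumes x: "x \<in> solid p r"
  shows "pd m (\<lambda>y. Gam y l i j) x = dGam m x l i j"
proof -
  let ?s = "dsq p r x" and ?d = "\<lambda>h::real^'n. 2 * (x $ p * h $ p + x $ r * h $ r)"
  let ?w = "\<lambda>h::real^'n. \<lambda>i. h $ p * P i + h $ r * R i"
  note c = coeff_DERIV[OF dsq_bounds[OF x], THEN has_derivative_radial]
  have "((\<lambda>y. Gam y l i j) has_derivative (\<lambda>h.
     (cM ?s * (?w h i * kd j l + ?w h j * kd i l) + cM' ?s * ?d h * (w x i * kd j l + w x j * kd i l))
     + ((cK1 ?s * (?w h l * kd i j) + cK1' ?s * ?d h * (w x l * kd i j))
        + (cK2 ?s * ((w x l * w x i) * ?w h j + (w x l * ?w h i + ?w h l * w x i) * w x j) + cK2' ?s * ?d h * (w x l * w x i * w x j))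
        + (cK3 ?s * (?w h l * Q i * Q j) + cK3' ?s * ?d h * (w x l * Q i * Q j)))
     - (cB ?s * (Q l * (?w h i * Q j + ?w h j * Q i)) + cB' ?s * ?d h * (Q l * (w x i * Q j + w x j * Q i))))) (at x)"
    unfolding Gam_def
    by (intro has_derivative_add has_derivative_diff has_derivative_mult has_derivative_mult_left has_derivative_mult_right has_derivative_w c)
  from pd_eqI[OF this, of m] show ?thesis
    unfolding pd_radial_w dGam_def by (simp add: algebra_simps)
qed

text \<open>The three coefficients are written as in \<open>soliton_coeffs\<close>, followed by the negatives of the coefficients of the Hessian in
  \<open>hessian_eq\<close>. In this form \<open>einstein_equation\<close> follows by cancellation.\<close>

lemma ricci_eq:
  assumes S: "open S" "x \<in> S" "S \<subseteq> solid p r" and g: "\<forall>y\<in>S. \<forall>i j. g c y i j = G y i j"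
  defines "s \<equiv> dsq p r x"
  shows "ricci g c x j k =
      (2 * cM s + 2 * cK1 s + 2 * s * cK1' s - 2 * cM s * s * cK1 s - 2 * cM s + 2 * cM s * (s * cK1 s)) * kd j k
    + (4 * cM' s + 4 * cK2 s + 2 * s * cK2' s - (5 * (cM s)^2 + 2 * cM s * (cK1 s + cK2 s * s)
       + 2 * cM s * s * cK2 s + (cK1 s + cK2 s * s)^2 + (cB s)^2) - 4 * cM' s + 2 * cM s * (2 * cM s + s * cK2 s)) * (w x j * w x k)
    + (2 * cK3 s + 2 * s * cK3' s + 2 * cB s * s * cK3 s + 2 * cM s * (s * cK3 s)) * (Q j * Q k)"
proof -
  have x: "x \<in> solid p r" using S by auto
  have ch: "christoffel g c y l i j = Gam y l i j" if "y \<in> S" for y l i j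
    using christoffel_eq[OF S(1) that S(3), of g c] g by blast
  have pdch: "pd m (\<lambda>y. christoffel g c y l i j) x = dGam m x l i j" for m l i j
    using pd_cong_open[OF S(1,2), of "\<lambda>y. christoffel g c y l i j" "\<lambda>y. Gam y l i j"] ch pd_Gam[OF x] by simp
  have z: "Gam x l i j = 0" "dGam m x l i j = 0" if "l \<noteq> p" "l \<noteq> r" "l \<noteq> q" for l i j m
    using that by (simp_all add: Gam_def dGam_def kd_def)
  have z2: "Gam x l i j = 0" if "j \<noteq> p" "j \<noteq> r" "j \<noteq> q" for l i j
    using that by (simp add: Gam_def kd_def)
  have "ricci g c x j k = (\<Sum>i\<in>UNIV. dGam i x i j k - dGam j x i i k + (\<Sum>n\<in>UNIV. Gam x i i n * Gam x n j k - Gam x i j n * Gam x n i k))"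
    by (simp add: ricci_def riemann_def pdch ch[OF S(2)])
  also have "\<dots> = (\<Sum>i\<in>UNIV. dGam i x i j k - dGam j x i i k + ((Gam x i i p * Gam x p j k - Gam x i j p * Gam x p i k)
     + (Gam x i i r * Gam x r j k - Gam x i j r * Gam x r i k) + (Gam x i i q * Gam x q j k - Gam x i j q * Gam x q i k)))"
    by (intro sum.cong refl, subst sum_axes) (simp_all add: z)
  also have "\<dots> = (\<lambda>i. dGam i x i j k - dGam j x i i k + ((Gam x i i p * Gam x p j k - Gam x i j p * Gam x p i k)
     + (Gam x i i r * Gam x r j k - Gam x i j r * Gam x r i k) + (Gam x i i q * Gam x q j k - Gam x i j q * Gam x q i k))) p
    + (\<lambda>i. dGam i x i j k - dGam j x i i k + ((Gam x i i p * Gam x p j k - Gam x i j p * Gam x p i k)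
     + (Gam x i i r * Gam x r j k - Gam x i j r * Gam x r i k) + (Gam x i i q * Gam x q j k - Gam x i j q * Gam x q i k))) r
    + (\<lambda>i. dGam i x i j k - dGam j x i i k + ((Gam x i i p * Gam x p j k - Gam x i j p * Gam x p i k)
     + (Gam x i i r * Gam x r j k - Gam x i j r * Gam x r i k) + (Gam x i i q * Gam x q j k - Gam x i j q * Gam x q i k))) q"
    by (rule sum_axes) (simp add: z)
  finally have R: "ricci g c x j k = \<dots>" .
  define u v where "u = x $ p" and "v = x $ r"
  define M M1 K1 K1' K2 K2' K3 K3' B B' where "M = cM s" and "M1 = cM' s" and "K1 = cK1 s" and "K1' = cK1' s"
    and "K2 = cK2 s" and "K2' = cK2' s" and "K3 = cK3 s" and "K3' = cK3' s" and "B = cB s" and "B' = cB' s"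
  note ab = u_def[symmetric] v_def[symmetric] M_def[symmetric] M1_def[symmetric] K1_def[symmetric] K1'_def[symmetric]
    K2_def[symmetric] K2'_def[symmetric] K3_def[symmetric] K3'_def[symmetric] B_def[symmetric] B'_def[symmetric]
  have s: "s = u * u + v * v" by (simp add: s_def u_def v_def dsq_def power2_eq_square)
  \<comment> \<open>The trace identity and its derivative are the only relations between the coefficients that the computation uses.\<close>
  have T: "B = M + K1 + K2 * (u * u + v * v)" "B' = M1 + K1' + K2' * (u * u + v * v) + K2"
    using soliton_coeffs(1)[OF dsq_bounds[OF x]] trace_coeff_derivative[OF dsq_bounds[OF x]]
    unfolding s_def[symmetric] ab unfolding s by algebra+
  show ?thesis
    unfolding R Gam_def dGam_def kd_def w_def s_def[symmetric] PRQ_simps ab mult_zero_left mult_zero_right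
      mult_1_left mult_1_right add_0_left add_0_right diff_zero
    unfolding s using T by algebra
qed

lemma DERIV_ln_cD:
  assumes "0 \<le> t" "t < 1"
  shows "((\<lambda>t. - ln (cD t)) has_real_derivative cM t) (at t)"
  using cD_pos[OF assms] by (auto intro!: derivative_eq_intros cD_DERIV simp: cM_def divide_simps)

lemma pd_potential:
  assumes x: "x \<in> solid p r"
  shows "pd j (\<lambda>y. - ln (cD (dsq p r y))) x = 2 * cM (dsq p r x) * w x j"
  using pd_eqI[OF has_derivative_radial[OF DERIV_ln_cD[OF dsq_bounds[OF x]]], of j]
  unfolding pd_radial_w by simp

lemma hessian_eq:
  assumes S: "open S" "x \<in> S" "S \<subseteq> solid p r" and g: "\<forall>y\<in>S. \<forall>i j. g c y i j = G y i j"
    and f: "\<forall>y\<in>S. (f \<circ> pt c) y = - ln (cD (dsq p r y))"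
  defines "s \<equiv> dsq p r x"
  shows "hessian g f c x j k = (2 * cM s - 2 * cM s * (s * cK1 s)) * kd j k
    + (4 * cM' s - 2 * cM s * (2 * cM s + s * cK2 s)) * (w x j * w x k) - 2 * cM s * (s * cK3 s) * (Q j * Q k)"
proof -
  have x: "x \<in> solid p r" using S by auto
  have pf: "pd j (f \<circ> pt c) y = 2 * cM (dsq p r y) * w y j" if "y \<in> S" for y j
  proof -
    have "pd j (f \<circ> pt c) y = pd j (\<lambda>y. - ln (cD (dsq p r y))) y"
      by (rule pd_cong_open[OF S(1) that f[rule_format]])
    then show ?thesis using pd_potential[of y j] S(3) that by auto
  qed
  have "((\<lambda>y. 2 * cM (dsq p r y) * w y k) has_derivative
      (\<lambda>h. 2 * cM s * (h $ p * P k + h $ r * R k) + 2 * (cM' s * (2 * (x $ p * h $ p + x $ r * h $ r))) * w x k)) (at x)"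
    unfolding s_def
    by (intro has_derivative_mult has_derivative_mult_right has_derivative_w has_derivative_radial coeff_DERIV(4) dsq_bounds[OF x])
  from pd_eqI[OF this, of j]
  have 1: "pd j (\<lambda>y. 2 * cM (dsq p r y) * w y k) x = 2 * cM s * kd j k + 4 * cM' s * w x j * w x k"
    unfolding pd_radial_w by (simp add: algebra_simps)
  have 2: "pd j (pd k (f \<circ> pt c)) x = 2 * cM s * kd j k + 4 * cM' s * w x j * w x k"
    unfolding 1[symmetric] by (rule pd_cong_open[OF S(1,2) pf])
  have ch: "christoffel g c x l j k = Gam x l j k" for l
    using christoffel_eq[OF S, of g c] g by blast
  have s: "s = x $ p * x $ p + x $ r * x $ r" by (simp add: s_def dsq_def power2_eq_square)
  have "(\<Sum>l\<in>UNIV. Gam x l j k * (2 * cM s * w x l))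
     = Gam x p j k * (2 * cM s * w x p) + Gam x r j k * (2 * cM s * w x r) + Gam x q j k * (2 * cM s * w x q)"
    by (rule sum_axes) (simp add: Gam_def kd_def)
  also have "\<dots> = 2 * cM s * (2 * cM s * (w x j * w x k) + s * (cK1 s * kd j k + cK2 s * (w x j * w x k) + cK3 s * (Q j * Q k)))"
    unfolding Gam_def kd_def w_def PRQ_simps s_def[symmetric] unfolding s by algebra
  finally show ?thesis
    unfolding hessian_def 2 ch pf[OF S(2)] s_def[symmetric] by (simp add: algebra_simps)
qed

text \<open>In coordinates \<open>H\<close> is \<open>cH\<close> times the standard volume form \<open>eps\<close> in the three directions \<open>p\<close>, \<open>r\<close>, \<open>q\<close>.\<close>

definition cH :: "real \<Rightarrow> real" where "cH t = 2 * a * b / (cD t)^2"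

definition eps :: "'n \<Rightarrow> 'n \<Rightarrow> 'n \<Rightarrow> real" where
  "eps i j k = P i * (R j * Q k - R k * Q j) + R i * (Q j * P k - Q k * P j) + Q i * (P j * R k - P k * R j)"

lemma eps_off: "i \<noteq> p \<Longrightarrow> i \<noteq> r \<Longrightarrow> i \<noteq> q \<Longrightarrow> eps i j k = 0 \<and> eps j i k = 0 \<and> eps j k i = 0"
  by (simp add: eps_def)

text \<open>Radial covectors are eigenvectors of the inverse metric, with eigenvalue \<open>\<Delta>/a - (b/a)|z\<^sub>p|\<^sup>2 = |z\<^sub>q|\<^sup>2\<close>.\<close>

lemma inverse_metric_radial:
  assumes x: "x \<in> solid p r"
  shows "GI x k p * x $ p + GI x k r * x $ r = (1 - dsq p r x) * w x k"
proof -
  have "cD (dsq p r x) / a - b / a * dsq p r x = 1 - dsq p r x"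
    using a_pos by (simp add: cD_def field_simps)
  moreover have "GI x k p * x $ p + GI x k r * x $ r = (cD (dsq p r x) / a - b / a * (x $ p * x $ p + x $ r * x $ r)) * w x k"
    unfolding GI_def kd_def w_def PRQ_simps flat_simps by algebra
  ultimately show ?thesis by (simp add: dsq_def power2_eq_square)
qed

lemma flux_coeffs:
  assumes "0 \<le> t" "t < 1"
  shows "(cH t)^2 * (cD t / a) * (1 - t) = 4 * a * b / (cD t)^2 * cS t"
    "(cH t)^2 * (1 / cS t) * (1 - t) = 4 * a * b / (cD t)^2 * cA t"
    "(cH t)^2 * (1 / cS t) * (b / a) = 4 * a * b / (cD t)^2 * cB t"
proof -
  have D: "cD t \<noteq> 0" "1 - t \<noteq> 0" "a \<noteq> 0" "b \<noteq> 0" using cD_pos[OF assms] assms a_pos b_pos by auto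
  show "(cH t)^2 * (cD t / a) * (1 - t) = 4 * a * b / (cD t)^2 * cS t"
    "(cH t)^2 * (1 / cS t) * (1 - t) = 4 * a * b / (cD t)^2 * cA t"
    "(cH t)^2 * (1 / cS t) * (b / a) = 4 * a * b / (cD t)^2 * cB t"
    using D by (simp_all add: cH_def cS_def cA_def cB_def divide_simps power2_eq_square)
qed

text \<open>A three-form in three dimensions is a multiple of the Riemannian volume form, so \<open>H\<^sup>2\<close> is a multiple of the metric of the
  \<open>S\<^sup>3\<close> factor, here \<open>8ab/\<Delta>\<^sup>2\<close> times.\<close>

lemma H_squared_eq:
  assumes g: "\<And>i j. g c x i j = G x i j" and x: "x \<in> solid p r"
    and H: "\<And>i j k. H c x i j k = cH (dsq p r x) * eps i j k"
  defines "s \<equiv> dsq p r x"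
  shows "H_squared g H c x i j = 8 * a * b / (cD s)^2 * (cA s * kd i j + cB s * (w x i * w x j) + cS s * (Q i * Q j))"
proof -
  define h where "h = cH s"
  define Y where "Y m n l k = GI x m l * GI x n k * (h * eps i m n) * (h * eps j l k)" for m n l k
  define Z where "Z m n = (Y m n p p + Y m n p r + Y m n p q) + (Y m n r p + Y m n r r + Y m n r q)
    + (Y m n q p + Y m n q r + Y m n q q)" for m n
  have "H_squared g H c x i j = (\<Sum>m\<in>UNIV. \<Sum>n\<in>UNIV. \<Sum>l\<in>UNIV. \<Sum>k\<in>UNIV. Y m n l k)"
    unfolding H_squared_def H ginv_eq[of g c x, OF g x] Y_def h_def s_def ..
  also have "\<dots> = (\<Sum>m\<in>UNIV. \<Sum>n\<in>UNIV. \<Sum>l\<in>UNIV. Y m n l p + Y m n l r + Y m n l q)"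
    by (intro sum.cong refl sum_axes) (simp add: Y_def eps_off)
  also have "\<dots> = (\<Sum>m\<in>UNIV. \<Sum>n\<in>UNIV. Z m n)"
    unfolding Z_def by (intro sum.cong refl sum_axes) (simp add: Y_def eps_off)
  also have "\<dots> = (\<Sum>m\<in>UNIV. Z m p + Z m r + Z m q)"
    by (intro sum.cong refl sum_axes) (simp add: Z_def Y_def eps_off)
  also have "\<dots> = (Z p p + Z p r + Z p q) + (Z r p + Z r r + Z r q) + (Z q p + Z q r + Z q q)"
    by (rule sum_axes) (simp add: Z_def Y_def eps_off)
  finally have E: "H_squared g H c x i j = \<dots>" .
  define u v A B C D' F C' kap where "u = x $ p" and "v = x $ r" and "A = cA s" and "B = cB s" and "C = cS s"
    and "D' = cD s / a" and "F = b / a" and "C' = 1 / cS s" and "kap = 4 * a * b / (cD s)^2"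
  have s: "s = u * u + v * v" by (simp add: s_def u_def v_def dsq_def power2_eq_square)
  have e: "h^2 * D' * (1 - s) = kap * C" "h^2 * C' * (1 - s) = kap * A" "h^2 * C' * F = kap * B"
    using flux_coeffs[OF dsq_bounds[OF x]] by (simp_all add: h_def D'_def C_def A_def B_def F_def C'_def kap_def s_def)
  have c: "D' - F * s = 1 - s" using a_pos by (simp add: D'_def F_def cD_def field_simps)
  have C': "1 / C = C'" by (simp add: C_def C'_def)
  have k: "8 * a * b / (cD s)^2 = 2 * kap" by (simp add: kap_def)
  show ?thesis
    unfolding E k Z_def Y_def eps_def GI_def kd_def w_def PRQ_simps s_def[symmetric]
      u_def[symmetric] v_def[symmetric] A_def[symmetric] B_def[symmetric] C_def[symmetric] D'_def[symmetric] F_def[symmetric]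
      C' flat_simps mult_zero_left mult_zero_right
      mult_1_left mult_1_right add_0_left add_0_right diff_zero
    using e c unfolding s by algebra
qed

lemma einstein_equation:
  assumes S: "open S" "x \<in> S" "S \<subseteq> solid p r" and g: "\<forall>y\<in>S. \<forall>i j. g c y i j = G y i j"
    and f: "\<forall>y\<in>S. (f \<circ> pt c) y = - ln (cD (dsq p r y))"
    and H: "\<And>i j k. H c x i j k = cH (dsq p r x) * eps i j k"
  shows "ricci g c x i j - 1/4 * H_squared g H c x i j + hessian g f c x i j = 0"
proof -
  have x: "x \<in> solid p r" using S by auto
  note e = soliton_coeffs(2-4)[OF dsq_bounds[OF x]]
  show ?thesis
    unfolding ricci_eq[where g=g and c=c, OF S g] hessian_eq[where g=g and c=c and f=f, OF S g f] H_squared_eq[of g c x H, OF g[rule_format, OF S(2)] x H] e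
    by (simp add: algebra_simps)
qed

lemma gradient_eq:
  assumes S: "open S" "x \<in> S" "S \<subseteq> solid p r" and g: "\<forall>y\<in>S. \<forall>i j. g c y i j = G y i j"
    and f: "\<forall>y\<in>S. (f \<circ> pt c) y = - ln (cD (dsq p r y))"
  shows "gradient g f c x k = 2 * cM (dsq p r x) * (1 - dsq p r x) * w x k"
proof -
  have x: "x \<in> solid p r" using S by auto
  have pf: "pd j (f \<circ> pt c) x = 2 * cM (dsq p r x) * w x j" for j
    unfolding pd_potential[OF x, symmetric] by (rule pd_cong_open[OF S(1,2) f[rule_format]])
  have "gradient g f c x k = (\<Sum>l\<in>UNIV. GI x k l * (2 * cM (dsq p r x) * w x l))"
    unfolding gradient_def pf ginv_eq[of g c x, OF g[rule_format, OF S(2)] x] ..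
  also have "\<dots> = 2 * cM (dsq p r x) * (GI x k p * x $ p + GI x k r * x $ r)"
    by (subst sum_axes) (simp_all add: algebra_simps)
  finally show ?thesis unfolding inverse_metric_radial[OF x] by simp
qed

text \<open>The covector \<open>x\<^sub>p dx\<^sub>r - x\<^sub>r dx\<^sub>p = |z\<^sub>p|\<^sup>2 d(arg z\<^sub>p)\<close>; \<open>cC\<close> is the coefficient of \<open>- i\<^bsub>\<nabla>f\<^esub> H\<close> in terms of \<open>ang \<and> Q\<close>.\<close>

definition ang :: "real^'n \<Rightarrow> 'n \<Rightarrow> real" where "ang x i = x $ p * R i - x $ r * P i"

definition cC :: "real \<Rightarrow> real" where "cC t = 4 * a * b * (b - a) * (1 - t) / (cD t)^3"

lemma flux_equation:
  assumes S: "open S" "x \<in> S" "S \<subseteq> solid p r" and g: "\<forall>y\<in>S. \<forall>i j. g c y i j = G y i j"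
    and f: "\<forall>y\<in>S. (f \<circ> pt c) y = - ln (cD (dsq p r y))"
    and H: "\<And>i j k. H c x i j k = cH (dsq p r x) * eps i j k"
    and D: "\<And>i j. D c x i j = cC (dsq p r x) * (ang x i * Q j - ang x j * Q i)"
  shows "1/2 * D c x i j + interior_product (\<lambda>c x k. 1/2 * gradient g f c x k) H c x i j = 0"
proof -
  have x: "x \<in> solid p r" using S by auto
  let ?s = "dsq p r x"
  have "interior_product (\<lambda>c x k. 1/2 * gradient g f c x k) H c x i j
     = (\<Sum>k\<in>UNIV. cM ?s * (1 - ?s) * w x k * (cH ?s * eps k i j))"
    unfolding interior_product_def gradient_eq[where g=g and c=c and f=f, OF S g f] H by (simp add: algebra_simps)
  also have "\<dots> = cM ?s * (1 - ?s) * cH ?s * (x $ p * eps p i j + x $ r * eps r i j)"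
    by (subst sum_axes) (simp_all add: eps_off algebra_simps)
  also have "x $ p * eps p i j + x $ r * eps r i j = ang x i * Q j - ang x j * Q i"
    unfolding eps_def ang_def PRQ_simps by algebra
  also have "cM ?s * (1 - ?s) * cH ?s = - 1/2 * cC ?s"
    using cD_pos[OF dsq_bounds[OF x]] by (simp add: cM_def cH_def cC_def divide_simps power2_eq_square power3_eq_cube algebra_simps)
  finally show ?thesis by (simp add: D)
qed

text \<open>A three-form that involves only three of the coordinates, with coefficients depending on the same three, has no room for a differential.\<close>

lemma flux_closed:
  assumes S: "open S" "x \<in> S" "S \<subseteq> solid p r"
    and H: "\<And>y i j k. y \<in> S \<Longrightarrow> H c y i j k = cH (dsq p r y) * eps i j k"
  shows "ext_deriv3 H c x i j k l = 0"
proof -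
  have x: "x \<in> solid p r" using S by auto
  have "DERIV (\<lambda>t. 2 * a * b / (cD t)^2) (dsq p r x) :> 4 * a * b * (a - b) / (cD (dsq p r x))^3"
    using cD_pos[OF dsq_bounds[OF x]]
    by (auto intro!: derivative_eq_intros cD_DERIV simp: divide_simps power2_eq_square power3_eq_cube algebra_simps)
  then have d: "DERIV cH (dsq p r x) :> 4 * a * b * (a - b) / (cD (dsq p r x))^3" by (simp add: cH_def[abs_def])
  define K where "K = 4 * a * b * (a - b) / (cD (dsq p r x))^3"
  have pdH: "pd m (\<lambda>y. H c y i j k) x = K * (2 * w x m) * eps i j k" for m i j k
  proof -
    have "pd m (\<lambda>y. H c y i j k) x = pd m (\<lambda>y. cH (dsq p r y) * eps i j k) x"
      by (rule pd_cong_open[OF S(1,2) H])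
    also have "\<dots> = K * (2 * w x m) * eps i j k"
      using pd_eqI[OF has_derivative_mult_left[OF has_derivative_radial[OF d]], of m "eps i j k"]
      unfolding pd_radial_w K_def .
    finally show ?thesis .
  qed
  show ?thesis unfolding ext_deriv3_def pdH eps_def w_def by algebra
qed

end

section \<open>The fields as restrictions of ambient forms\<close>

text \<open>Scalar product and determinant of two vectors in the \<open>k\<close>-th complex coordinate plane.\<close>

definition dotc :: "'n::finite \<Rightarrow> 'n ambient \<Rightarrow> 'n ambient \<Rightarrow> real" where
  "dotc k v w = fst v $ k * fst w $ k + snd v $ k * snd w $ k"

definition crossc :: "'n::finite \<Rightarrow> 'n ambient \<Rightarrow> 'n ambient \<Rightarrow> real" where
  "crossc k v w = fst v $ k * snd w $ k - snd v $ k * fst w $ k"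

text \<open>The function \<open>\<Delta>\<close> of the introduction.\<close>

definition dil :: "'n::finite \<Rightarrow> 'n \<Rightarrow> real \<Rightarrow> real \<Rightarrow> 'n ambient \<Rightarrow> real" where
  "dil p q a b y = b * dotc p y y + a * dotc q y y"

definition metric_form :: "'n::finite \<Rightarrow> 'n \<Rightarrow> 'n \<Rightarrow> real \<Rightarrow> real \<Rightarrow> 'n ambient \<Rightarrow> 'n ambient \<Rightarrow> 'n ambient \<Rightarrow> real" where
  "metric_form p r q a b y v w = (a * dotc p v w + b * dotc q v w) / dil p q a b y + (\<Sum>k\<in>- {p, r, q}. dotc k v w)"

text \<open>Up to the factor, \<open>\<omega>\<^sub>p \<and> \<eta>\<^sub>q + \<omega>\<^sub>q \<and> \<eta>\<^sub>p\<close> with \<open>\<omega>\<^sub>k = dx\<^sub>k \<and> dy\<^sub>k\<close> and \<open>\<eta>\<^sub>k = x\<^sub>k dy\<^sub>k - y\<^sub>k dx\<^sub>k\<close>, the standard volume form of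
  \<open>S\<^sup>3\<close> written symmetrically in \<open>p\<close> and \<open>q\<close>. The two-form \<open>coflux_form\<close> is, up to its factor, \<open>\<eta>\<^sub>p \<and> \<eta>\<^sub>q\<close>; it will turn out to be \<open>d\<^sup>*H\<close>.\<close>

definition flux_form :: "'n::finite \<Rightarrow> 'n \<Rightarrow> real \<Rightarrow> real \<Rightarrow> 'n ambient \<Rightarrow> 'n ambient \<Rightarrow> 'n ambient \<Rightarrow> 'n ambient \<Rightarrow> real" where
  "flux_form p q a b y u v w = 2 * a * b / (dil p q a b y)^2 *
     (crossc p y u * crossc q v w + crossc p y v * crossc q w u + crossc p y w * crossc q u v
    + crossc q y u * crossc p v w + crossc q y v * crossc p w u + crossc q y w * crossc p u v)"

definition coflux_form :: "'n::finite \<Rightarrow> 'n \<Rightarrow> real \<Rightarrow> real \<Rightarrow> 'n ambient \<Rightarrow> 'n ambient \<Rightarrow> 'n ambient \<Rightarrow> real" where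
  "coflux_form p q a b y v w = 4 * a * b * (b - a) / (dil p q a b y)^3 *
     (crossc p y v * crossc q y w - crossc p y w * crossc q y v)"

definition potential :: "'n::finite \<Rightarrow> 'n \<Rightarrow> real \<Rightarrow> real \<Rightarrow> 'n ambient \<Rightarrow> real" where
  "potential p q a b y = - ln (dil p q a b y)"

lemma dil_swap: "dil q p b a y = dil p q a b y" by (simp add: dil_def)

text \<open>The exchange of \<open>(p, a)\<close> and \<open>(q, b)\<close> reverses the signs of both \<open>b - a\<close> and \<open>\<eta>\<^sub>p \<and> \<eta>\<^sub>q\<close>, so it preserves \<open>coflux_form\<close> as well.\<close>

lemma forms_swap:
  "metric_form q r p b a = metric_form p r q a b" "flux_form q p b a = flux_form p q a b"
  "coflux_form q p b a = coflux_form p q a b" "potential q p b a = potential p q a b"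
proof -
  show "metric_form q r p b a = metric_form p r q a b"
    unfolding metric_form_def[abs_def] dil_swap[of q p b a] by (simp add: add.commute insert_commute)
  show "flux_form q p b a = flux_form p q a b"
    unfolding flux_form_def[abs_def] dil_swap[of q p b a] by (simp add: algebra_simps)
  show "coflux_form q p b a = coflux_form p q a b"
    unfolding coflux_form_def[abs_def] dil_swap[of q p b a] by (intro ext) (simp add: divide_simps, algebra)
  show "potential q p b a = potential p q a b"
    unfolding potential_def[abs_def] dil_swap[of q p b a] ..
qed

lemma linear_dotc: "linear (dotc k v)" "linear (\<lambda>v. dotc k v w)"
  by (auto simp: dotc_def algebra_simps intro!: linearI)

lemma linear_crossc: "linear (crossc k v)" "linear (\<lambda>v. crossc k v w)"
  by (auto simp: crossc_def algebra_simps intro!: linearI)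

lemma linear_add_fun: "linear f \<Longrightarrow> linear g \<Longrightarrow> linear (\<lambda>x. f x + g x :: real)"
  by (rule linear_compose_add)

lemma linear_mult_fun: "linear f \<Longrightarrow> linear (\<lambda>x. c * f x :: real)" "linear f \<Longrightarrow> linear (\<lambda>x. f x * c :: real)"
  by (auto simp: linear_iff algebra_simps)

lemma linear_divide_fun: "linear f \<Longrightarrow> linear (\<lambda>x. f x / c :: real)"
  by (auto simp: linear_iff algebra_simps add_divide_distrib)

lemma linear_metric_form: "linear (metric_form p r q a b y v)" "linear (\<lambda>v. metric_form p r q a b y v w)"
  unfolding metric_form_def[abs_def]
  by (intro linear_add_fun linear_divide_fun linear_mult_fun linear_compose_sum ballI linear_dotc)+

lemma linear_flux_form: "linear (flux_form p q a b y u v)" "linear (\<lambda>v. flux_form p q a b y u v w)"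
  "linear (\<lambda>u. flux_form p q a b y u v w)"
  unfolding flux_form_def[abs_def]
  by (intro linear_add_fun linear_mult_fun linear_crossc)+

lemma linear_coflux_form: "linear (coflux_form p q a b y v)" "linear (\<lambda>v. coflux_form p q a b y v w)"
  unfolding coflux_form_def[abs_def]
  by (intro linear_compose_sub linear_mult_fun linear_crossc)+

context two_weights begin

lemma has_derivative_nth: "((\<lambda>x::real^'n. x $ k) has_derivative (\<lambda>h. h $ k)) (at x)"
  by (rule bounded_linear_imp_has_derivative[OF bounded_linear_vec_nth])

lemma pd_param_disc:
  "pd i (\<lambda>x. fst (param p r q x) $ p) x = P i" "pd i (\<lambda>x. snd (param p r q x) $ p) x = R i"
  "pd i (\<lambda>x. fst (param p r q x) $ r) x = 0" "pd i (\<lambda>x. snd (param p r q x) $ r) x = 0"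
  using pd_eqI[OF has_derivative_nth[of p x], of i] pd_eqI[OF has_derivative_nth[of r x], of i]
  by (simp_all add: param_nth axis_nth_PRQ pd_eqI[OF has_derivative_const])

lemma pd_param_q:
  assumes x: "x \<in> solid p r"
  defines "\<sigma> \<equiv> sqrt (1 - dsq p r x)"
  shows "pd i (\<lambda>x. fst (param p r q x) $ q) x = - (w x i / \<sigma>) * cos (x $ q) - \<sigma> * sin (x $ q) * Q i"
    "pd i (\<lambda>x. snd (param p r q x) $ q) x = - (w x i / \<sigma>) * sin (x $ q) + \<sigma> * cos (x $ q) * Q i"
proof -
  have "DERIV (\<lambda>t. sqrt (1 - t)) (dsq p r x) :> - 1 / (2 * \<sigma>)"
    using dsq_bounds[OF x] by (auto intro!: derivative_eq_intros simp: \<sigma>_def divide_simps)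
  note m = has_derivative_radial[OF this]
  have c: "((\<lambda>x. cos (x $ q)) has_derivative (\<lambda>h. - sin (x $ q) * h $ q)) (at x)"
    "((\<lambda>x. sin (x $ q)) has_derivative (\<lambda>h. cos (x $ q) * h $ q)) (at x)"
    by (auto intro!: derivative_eq_intros has_derivative_nth)
  have "pd i (\<lambda>x. sqrt (1 - dsq p r x) * cos (x $ q)) x = \<sigma> * (- sin (x $ q) * Q i) + - 1 / (2 * \<sigma>) * (2 * w x i) * cos (x $ q)"
    using pd_eqI[OF has_derivative_mult[OF m c(1)], of i] unfolding pd_radial_w unfolding axis_nth_PRQ \<sigma>_def .
  then show "pd i (\<lambda>x. fst (param p r q x) $ q) x = - (w x i / \<sigma>) * cos (x $ q) - \<sigma> * sin (x $ q) * Q i"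
    by (simp add: param_nth modulus_def)
  have "pd i (\<lambda>x. sqrt (1 - dsq p r x) * sin (x $ q)) x = \<sigma> * (cos (x $ q) * Q i) + - 1 / (2 * \<sigma>) * (2 * w x i) * sin (x $ q)"
    using pd_eqI[OF has_derivative_mult[OF m c(2)], of i] unfolding pd_radial_w unfolding axis_nth_PRQ \<sigma>_def .
  then show "pd i (\<lambda>x. snd (param p r q x) $ q) x = - (w x i / \<sigma>) * sin (x $ q) + \<sigma> * cos (x $ q) * Q i"
    by (simp add: param_nth modulus_def)
qed

lemma pd_param_other:
  assumes k: "k \<noteq> p" "k \<noteq> r" "k \<noteq> q"
  shows "pd i (\<lambda>x. fst (param p r q x) $ k) x = - sin (x $ k) * (if i = k then 1 else 0)"
    "pd i (\<lambda>x. snd (param p r q x) $ k) x = cos (x $ k) * (if i = k then 1 else 0)"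
proof -
  have c: "((\<lambda>x. cos (x $ k)) has_derivative (\<lambda>h. - sin (x $ k) * h $ k)) (at x)"
    "((\<lambda>x. sin (x $ k)) has_derivative (\<lambda>h. cos (x $ k) * h $ k)) (at x)"
    by (auto intro!: derivative_eq_intros has_derivative_nth)
  show "pd i (\<lambda>x. fst (param p r q x) $ k) x = - sin (x $ k) * (if i = k then 1 else 0)"
    "pd i (\<lambda>x. snd (param p r q x) $ k) x = cos (x $ k) * (if i = k then 1 else 0)"
    using pd_eqI[OF c(1), of i] pd_eqI[OF c(2), of i] k by (auto simp: param_nth modulus_def axis_def)
qed

lemma tframe_nth:
  assumes x: "x \<in> box_around p r \<theta>"
  shows "fst (tframe (torus_chart p r q \<theta>) x i) $ k = pd i (\<lambda>x. fst (param p r q x) $ k) x"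
    "snd (tframe (torus_chart p r q \<theta>) x i) $ k = pd i (\<lambda>x. snd (param p r q x) $ k) x"
proof -
  have d: "(param p r q has_derivative frechet_derivative (param p r q) (at x)) (at x)"
    by (rule smooth_on_has_derivative[OF smooth_param]) (use x box_solid in blast)
  have e: "frechet_derivative (pt (torus_chart p r q \<theta>)) (at x) = frechet_derivative (param p r q) (at x)"
    by (rule frechet_derivative_cong_open[OF open_box x pt_torus_chart])
  have l: "bounded_linear (\<lambda>y::'n ambient. fst y $ k)" "bounded_linear (\<lambda>y::'n ambient. snd y $ k)"
    by (rule bounded_linear_compose[OF bounded_linear_vec_nth bounded_linear_fst],
        rule bounded_linear_compose[OF bounded_linear_vec_nth bounded_linear_snd])
  show "fst (tframe (torus_chart p r q \<theta>) x i) $ k = pd i (\<lambda>x. fst (param p r q x) $ k) x"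
    "snd (tframe (torus_chart p r q \<theta>) x i) $ k = pd i (\<lambda>x. snd (param p r q x) $ k) x"
    unfolding tframe_def e
    by (rule pd_eqI[OF bounded_linear.has_derivative[OF l(1) d], symmetric],
        rule pd_eqI[OF bounded_linear.has_derivative[OF l(2) d], symmetric])
qed

text \<open>These products of the coordinate vector fields determine the components of all four fields.\<close>

lemma frame_products:
  assumes x: "x \<in> box_around p r \<theta>"
  defines "E \<equiv> tframe (torus_chart p r q \<theta>) x" and "y \<equiv> pt (torus_chart p r q \<theta>) x" and "s \<equiv> dsq p r x"
  shows "dotc p (E i) (E j) = kd i j" "dotc q (E i) (E j) = w x i * w x j / (1 - s) + (1 - s) * Q i * Q j"
    "(\<Sum>k\<in>- {p, r, q}. dotc k (E i) (E j)) = flat i j"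
    "crossc p y (E i) = ang x i" "crossc q y (E i) = (1 - s) * Q i"
    "crossc p (E i) (E j) = P i * R j - R i * P j" "crossc q (E i) (E j) = w x j * Q i - w x i * Q j"
    "dil p q a b y = cD s"
proof -
  have xs: "x \<in> solid p r" using x box_solid by blast
  note t = tframe_nth[OF x, folded E_def]
  have y: "y = param p r q x" using pt_torus_chart[OF x] by (simp add: y_def)
  define \<sigma> C S where "\<sigma> = sqrt (1 - s)" and "C = cos (x $ q)" and "S = sin (x $ q)"
  have s2: "1 - s = \<sigma> * \<sigma>" and sp: "\<sigma> > 0" using dsq_bounds[OF xs] by (auto simp: \<sigma>_def s_def)
  have cs: "C * C + S * S = 1" by (simp add: C_def S_def power2_eq_square[symmetric])
  define K where "K = 1 / \<sigma>"
  have K: "K * \<sigma> = 1" using sp by (simp add: K_def)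
  have q: "fst (E i) $ q = - (w x i * K) * C - \<sigma> * S * Q i" "snd (E i) $ q = - (w x i * K) * S + \<sigma> * C * Q i" for i
    using pd_param_q[OF xs] by (simp_all add: t \<sigma>_def s_def C_def S_def K_def)
  have yq: "fst y $ q = \<sigma> * C" "snd y $ q = \<sigma> * S" by (simp_all add: y param_nth modulus_def \<sigma>_def s_def C_def S_def)
  show "dotc p (E i) (E j) = kd i j" by (simp add: dotc_def t pd_param_disc kd_def)
  have "w x i * w x j / (1 - s) = w x i * w x j * (K * K)" using sp by (simp add: s2 K_def)
  then show "dotc q (E i) (E j) = w x i * w x j / (1 - s) + (1 - s) * Q i * Q j"
    unfolding dotc_def q s2 using cs by algebra
  have "dotc k (E i) (E j) = (if i = k \<and> j = k then 1 else 0)" if "k \<in> - {p, r, q}" for k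
    using that pd_param_other[of k] by (simp add: dotc_def t power2_eq_square[symmetric])
  then have "(\<Sum>k\<in>- {p, r, q}. dotc k (E i) (E j)) = (\<Sum>k\<in>- {p, r, q}. if i = k then (if j = k then 1 else 0) else 0)"
    by (intro sum.cong) auto
  then show "(\<Sum>k\<in>- {p, r, q}. dotc k (E i) (E j)) = flat i j"
    by (simp add: flat_def)
  show "crossc p y (E i) = ang x i" unfolding crossc_def t pd_param_disc y by (simp add: param_nth ang_def)
  show "crossc q y (E i) = (1 - s) * Q i" unfolding crossc_def yq q s2 using cs K by algebra
  show "crossc p (E i) (E j) = P i * R j - R i * P j" by (simp add: crossc_def t pd_param_disc)
  show "crossc q (E i) (E j) = w x j * Q i - w x i * Q j" unfolding crossc_def q using cs K by algebra
  have d1: "dotc p y y = s" by (simp add: dotc_def y param_nth s_def dsq_def power2_eq_square)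
  have d2: "dotc q y y = 1 - s" unfolding dotc_def yq s2 using cs by algebra
  show "dil p q a b y = cD s" unfolding dil_def cD_def d1 d2 by algebra
qed

abbreviation met :: "('n ambient, 'n) tensor2" where "met \<equiv> pull2 (metric_form p r q a b)"
abbreviation flux :: "('n ambient, 'n) tensor3" where "flux \<equiv> pull3 (flux_form p q a b)"
abbreviation coflux :: "('n ambient, 'n) tensor2" where "coflux \<equiv> pull2 (coflux_form p q a b)"
abbreviation pot :: "'n ambient \<Rightarrow> real" where "pot \<equiv> potential p q a b"

lemma components:
  assumes x: "x \<in> box_around p r \<theta>"
  defines "c \<equiv> torus_chart p r q \<theta>" and "s \<equiv> dsq p r x"
  shows "met c x i j = G x i j" "flux c x i j k = cH s * eps i j k"
    "coflux c x i j = cC s * (ang x i * Q j - ang x j * Q i)" "(pot \<circ> pt c) x = - ln (cD s)"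
proof -
  note f = frame_products[OF x, folded c_def s_def]
  have xs: "x \<in> solid p r" using x box_solid by blast
  have D: "cD s > 0" "s < 1" using cD_pos[OF dsq_bounds[OF xs]] dsq_bounds[OF xs] by (simp_all add: s_def)
  show "met c x i j = G x i j"
    unfolding pull2_def metric_form_def f G_def s_def[symmetric] cA_def cB_def cS_def
    using D by (simp add: divide_simps) (simp add: algebra_simps)
  have s: "s = x $ p * x $ p + x $ r * x $ r" by (simp add: s_def dsq_def power2_eq_square)
  show "flux c x i j k = cH s * eps i j k"
    unfolding pull3_def flux_form_def f cH_def
    by (rule arg_cong[where f = "(*) _"]) (unfold eps_def ang_def w_def s, algebra)
  show "coflux c x i j = cC s * (ang x i * Q j - ang x j * Q i)"
    unfolding pull2_def coflux_form_def f cC_def using D by (simp add: divide_simps) algebra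
  show "(pot \<circ> pt c) x = - ln (cD s)" by (simp add: potential_def f)
qed

lemma smooth_w: "open S \<Longrightarrow> smooth_on S (\<lambda>x. w x i)"
  unfolding w_def by (intro smooth_on_add smooth_on_mult smooth_on_nth smooth_on_const)

lemma smooth_cD: "open S \<Longrightarrow> smooth_on S (\<lambda>x. cD (dsq p r x))"
  unfolding cD_def by (intro smooth_on_add smooth_on_mult smooth_dsq smooth_on_const)

lemma smooth_1_dsq: "open S \<Longrightarrow> smooth_on S (\<lambda>x. 1 - dsq p r x)"
  by (intro smooth_on_diff smooth_dsq smooth_on_const)

lemma smooth_components:
  assumes S: "open S" "S \<subseteq> solid p r"
  shows "smooth_on S (\<lambda>x. G x i j)" "smooth_on S (\<lambda>x. cH (dsq p r x) * eps i j k)"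
    "smooth_on S (\<lambda>x. cC (dsq p r x) * (ang x i * Q j - ang x j * Q i))"
    "smooth_on S (\<lambda>x. - ln (cD (dsq p r x)))"
proof -
  have pos: "cD (dsq p r x) > 0" "1 - dsq p r x > 0" if "x \<in> S" for x
    using that S(2) cD_pos dsq_bounds[of x] by auto
  have div: "smooth_on S (\<lambda>x. f x / (cD (dsq p r x) * (1 - dsq p r x)))" "smooth_on S (\<lambda>x. f x / cD (dsq p r x) ^ n)"
    if "smooth_on S f" for f n
    using that pos
    by (auto intro!: smooth_on_divide smooth_on_mult smooth_on_power smooth_cD smooth_1_dsq S(1))
  have div1: "smooth_on S (\<lambda>x. f x / cD (dsq p r x))" if "smooth_on S f" for f using div(2)[OF that, of 1] by simp
  note i = smooth_on_add smooth_on_diff smooth_on_mult smooth_w smooth_on_nth smooth_on_const smooth_1_dsq div div1 S(1)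
  show "smooth_on S (\<lambda>x. G x i j)" unfolding G_def cA_def cB_def cS_def by (intro i)
  show "smooth_on S (\<lambda>x. cH (dsq p r x) * eps i j k)" unfolding cH_def by (intro i)
  show "smooth_on S (\<lambda>x. cC (dsq p r x) * (ang x i * Q j - ang x j * Q i))" unfolding cC_def ang_def by (intro i)
  show "smooth_on S (\<lambda>x. - ln (cD (dsq p r x)))"
    by (intro smooth_on_minus smooth_on_ln smooth_cD S(1) pos)
qed

lemma sum_indicators: "(\<Sum>i\<in>UNIV. P i * F i) = F p" "(\<Sum>i\<in>UNIV. R i * F i) = F r" "(\<Sum>i\<in>UNIV. Q i * F i) = F q"
  by (subst sum_axes, simp_all)+

text \<open>The quadratic form is a sum of squares with positive coefficients, and these squares together control every component of \<open>v\<close>.\<close>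

lemma metric_positive:
  assumes x: "x \<in> solid p r" and v: "v \<noteq> 0"
  shows "(\<Sum>i\<in>UNIV. \<Sum>j\<in>UNIV. G x i j * v $ i * v $ j) > 0"
proof -
  define A B C where "A = cA (dsq p r x)" and "B = cB (dsq p r x)" and "C = cS (dsq p r x)"
  have pos: "A > 0" "B > 0" "C > 0"
    using cD_pos[OF dsq_bounds[OF x]] dsq_bounds[OF x] a_pos b_pos by (simp_all add: A_def B_def C_def cA_def cB_def cS_def)
  have sp: "(\<Sum>i\<in>UNIV. \<Sum>j\<in>UNIV. c * (f i * f j)) = c * (\<Sum>i\<in>UNIV. f i)^2" for f :: "'n \<Rightarrow> real" and c
    unfolding power2_eq_square sum_product by (simp add: sum_distrib_left)
  have "(\<Sum>i\<in>UNIV. \<Sum>j\<in>UNIV. flat i j * v $ i * v $ j) = (\<Sum>i\<in>UNIV. \<Sum>j\<in>UNIV. if i = j then (if i \<noteq> p \<and> i \<noteq> r \<and> i \<noteq> q then (v $ i)^2 else 0) else 0)"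
    by (intro sum.cong refl) (auto simp: flat_def power2_eq_square)
  then have fl: "(\<Sum>i\<in>UNIV. \<Sum>j\<in>UNIV. flat i j * v $ i * v $ j) = (\<Sum>i\<in>UNIV. if i \<noteq> p \<and> i \<noteq> r \<and> i \<noteq> q then (v $ i)^2 else 0)"
    by simp
  define F where "F = (\<Sum>i\<in>UNIV. if i \<noteq> p \<and> i \<noteq> r \<and> i \<noteq> q then (v $ i)^2 else 0)"
  have "(\<Sum>i\<in>UNIV. \<Sum>j\<in>UNIV. G x i j * v $ i * v $ j)
     = (\<Sum>i\<in>UNIV. \<Sum>j\<in>UNIV. A * ((P i * v $ i) * (P j * v $ j)) + A * ((R i * v $ i) * (R j * v $ j))
       + B * ((w x i * v $ i) * (w x j * v $ j)) + C * ((Q i * v $ i) * (Q j * v $ j)) + flat i j * v $ i * v $ j)"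
    unfolding G_def A_def B_def C_def kd_def by (intro sum.cong refl) algebra
  also have "\<dots> = A * (v $ p)^2 + A * (v $ r)^2 + B * (\<Sum>i\<in>UNIV. w x i * v $ i)^2 + C * (v $ q)^2 + F"
    unfolding sum.distrib sp sum_indicators fl F_def ..
  finally have E: "(\<Sum>i\<in>UNIV. \<Sum>j\<in>UNIV. G x i j * v $ i * v $ j) = \<dots>" .
  obtain k where k: "v $ k \<noteq> 0" using v by (metis vec_eq_iff zero_index)
  have F0: "F \<ge> 0" unfolding F_def by (intro sum_nonneg) auto
  have nn: "A * (v $ p)^2 \<ge> 0" "A * (v $ r)^2 \<ge> 0" "B * (\<Sum>i\<in>UNIV. w x i * v $ i)^2 \<ge> 0" "C * (v $ q)^2 \<ge> 0"
    using pos by simp_all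
  consider "k = p" | "k = r" | "k = q" | "k \<noteq> p \<and> k \<noteq> r \<and> k \<noteq> q" by blast
  then show ?thesis
  proof cases
    case 1
    then have "A * (v $ p)^2 > 0" using k pos by simp
    then show ?thesis unfolding E using nn F0 by linarith
  next
    case 2
    then have "A * (v $ r)^2 > 0" using k pos by simp
    then show ?thesis unfolding E using nn F0 by linarith
  next
    case 3
    then have "C * (v $ q)^2 > 0" using k pos by simp
    then show ?thesis unfolding E using nn F0 by linarith
  next
    case 4
    then have "(v $ k)^2 \<le> F"
      unfolding F_def
      using member_le_sum[of k UNIV "\<lambda>i. if i \<noteq> p \<and> i \<noteq> r \<and> i \<noteq> q then (v $ i)^2 else 0"] by simp
    moreover have "(v $ k)^2 > 0" using k by simp
    ultimately show ?thesis unfolding E using nn by linarith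
  qed
qed

text \<open>Every chart has a disc coordinate \<open>z\<^sub>p\<close> after possibly exchanging the roles of \<open>(p, a)\<close> and \<open>(q, b)\<close>. This is how computations
  in the locale are transferred to arbitrary charts.\<close>

lemma atlas_weights:
  assumes c: "c \<in> torus_atlas p r q"
  obtains p' q' a' b' \<theta> where "two_weights p' r q' a' b'" "c = torus_chart p' r q' \<theta>"
    "sphere_torus p' r q' = sphere_torus p r q" "torus_atlas p' r q' = torus_atlas p r q"
    "metric_form p' r q' a' b' = metric_form p r q a b" "flux_form p' q' a' b' = flux_form p q a b"
    "coflux_form p' q' a' b' = coflux_form p q a b" "potential p' q' a' b' = potential p q a b"
    "p' = p \<and> q' = q \<and> a' = a \<and> b' = b \<or> p' = q \<and> q' = p \<and> a' = b \<and> b' = a"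
proof (rule atlas_cases[OF c])
  fix \<theta> assume "c = torus_chart p r q \<theta>"
  then show thesis by (intro that[of p q a b \<theta>] two_weights_axioms) auto
next
  fix \<theta> assume "c = torus_chart q r p \<theta>"
  then show thesis
    by (intro that[of q p b a \<theta>] swapped_weights forms_swap sphere_torus_swap torus_atlas_swap) auto
qed

lemma smooth_pt_atlas: "c \<in> torus_atlas p r q \<Longrightarrow> smooth_on (img c) (pt c)"
proof (erule atlas_weights)
  fix p' q' a' b' \<theta> assume "two_weights p' r q' a' b'" "c = torus_chart p' r q' \<theta>"
  then interpret c: two_weights p' r q' a' b' by simp
  show "smooth_on (img c) (pt c)" unfolding \<open>c = _\<close> c.img_torus_chart by (rule c.smooth_pt)
qed

text \<open>The local results of the locale, for all charts of the atlas.\<close>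

lemma chart_fields:
  assumes c: "c \<in> torus_atlas p r q"
  shows "smooth_on (img c) (\<lambda>x. met c x i j)" "smooth_on (img c) (\<lambda>x. flux c x i j k)"
    "smooth_on (img c) (\<lambda>x. coflux c x i j)" "smooth_on (img c) (pot \<circ> pt c)"
    and "x \<in> img c \<Longrightarrow> met c x i j = met c x j i"
    and "x \<in> img c \<Longrightarrow> v \<noteq> 0 \<Longrightarrow> (\<Sum>i\<in>UNIV. \<Sum>j\<in>UNIV. met c x i j * v $ i * v $ j) > 0"
    and "x \<in> img c \<Longrightarrow> coflux c x j i = - coflux c x i j"
    and "x \<in> img c \<Longrightarrow> flux c x j i k = - flux c x i j k \<and> flux c x i k j = - flux c x i j k"
    and "x \<in> img c \<Longrightarrow> ext_deriv3 flux c x i j k l = 0"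
    and "x \<in> img c \<Longrightarrow> ricci met c x i j - 1/4 * H_squared met flux c x i j + hessian met pot c x i j = 0"
    and "x \<in> img c \<Longrightarrow> 1/2 * coflux c x i j + interior_product (\<lambda>c x k. 1/2 * gradient met pot c x k) flux c x i j = 0"
proof -
  obtain p' q' a' b' \<theta> where c: "two_weights p' r q' a' b'" "c = torus_chart p' r q' \<theta>"
    and e: "metric_form p' r q' a' b' = metric_form p r q a b" "flux_form p' q' a' b' = flux_form p q a b"
    "coflux_form p' q' a' b' = coflux_form p q a b" "potential p' q' a' b' = potential p q a b"
    by (rule atlas_weights[OF c]) (rule that; assumption)
  interpret c: two_weights p' r q' a' b' by (rule c(1))
  have img: "img c = box_around p' r \<theta>" using c(2) c.img_torus_chart by simp
  note comp = c.components[where \<theta> = \<theta>, folded c(2) img, unfolded e]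
  have S: "open (img c)" "img c \<subseteq> solid p' r" unfolding img by (rule c.open_box c.box_solid)+
  note sm = c.smooth_components[OF S]
  show "smooth_on (img c) (\<lambda>x. met c x i j)" by (rule smooth_on_cong[OF S(1) comp(1)[symmetric] sm(1)])
  show "smooth_on (img c) (\<lambda>x. flux c x i j k)" by (rule smooth_on_cong[OF S(1) comp(2)[symmetric] sm(2)])
  show "smooth_on (img c) (\<lambda>x. coflux c x i j)" by (rule smooth_on_cong[OF S(1) comp(3)[symmetric] sm(3)])
  show "smooth_on (img c) (pot \<circ> pt c)" by (rule smooth_on_cong[OF S(1) comp(4)[symmetric] sm(4)])
  have gm: "\<forall>y\<in>img c. \<forall>i j. met c y i j = c.G y i j" using comp(1) by blast
  have fm: "\<forall>y\<in>img c. (pot \<circ> pt c) y = - ln (c.cD (dsq p' r y))" using comp(4) by blast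
  assume x: "x \<in> img c"
  show "met c x i j = met c x j i" by (auto simp: comp(1)[OF x] c.G_def c.kd_def c.flat_def mult_ac)
  show "v \<noteq> 0 \<Longrightarrow> (\<Sum>i\<in>UNIV. \<Sum>j\<in>UNIV. met c x i j * v $ i * v $ j) > 0"
    unfolding comp(1)[OF x] by (rule c.metric_positive) (use x S in auto)
  show "coflux c x j i = - coflux c x i j" unfolding comp(3)[OF x] by (simp add: algebra_simps)
  show "flux c x j i k = - flux c x i j k \<and> flux c x i k j = - flux c x i j k"
    unfolding comp(2)[OF x] c.eps_def by (simp add: algebra_simps)
  show "ext_deriv3 flux c x i j k l = 0" by (rule c.flux_closed[OF S(1) x S(2)]) (rule comp(2))
  show "ricci met c x i j - 1/4 * H_squared met flux c x i j + hessian met pot c x i j = 0"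
    by (rule c.einstein_equation[where g = met and f = pot and H = flux and c = c, OF S(1) x S(2) gm fm comp(2)[OF x]])
  show "1/2 * coflux c x i j + interior_product (\<lambda>c x k. 1/2 * gradient met pot c x k) flux c x i j = 0"
    by (rule c.flux_equation[where g = met and f = pot and H = flux and D = coflux and c = c, OF S(1) x S(2) gm fm comp(2)[OF x] comp(3)[OF x]])
qed

lemma riemannian_metric_met: "riemannian_metric (torus_atlas p r q) met"
  unfolding riemannian_metric_def
  by (intro conjI smooth_tensor2_pull2[OF smooth_manifold_torus] smooth_pt_atlas linear_metric_form chart_fields(1) ballI allI impI)
    (auto intro: chart_fields(5,6))

lemma closed_flux: "closed_three_form (torus_atlas p r q) flux"
  unfolding closed_three_form_def three_form_def
  by (intro conjI smooth_tensor3_pull3[OF smooth_manifold_torus] smooth_pt_atlas linear_flux_form chart_fields(2) ballI allI impI)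
    (auto dest: chart_fields(8,9))

lemma two_form_coflux: "two_form (torus_atlas p r q) coflux"
  unfolding two_form_def
  by (intro conjI smooth_tensor2_pull2[OF smooth_manifold_torus] smooth_pt_atlas linear_coflux_form chart_fields(3) ballI allI impI)
    (auto intro: chart_fields(7))

lemma smooth_potential: "smooth_function (torus_atlas p r q) pot"
  unfolding smooth_function_def using chart_fields(4) by blast

end

section \<open>Volume preserving maps\<close>

text \<open>A bijection of the index types carries permutations to permutations of the same sign, so it permutes the terms of the Leibniz formula.\<close>

lemma det_reindex:
  fixes h :: "'m::finite \<Rightarrow> 'n::finite" and A :: "real^'n^'n"
  assumes h: "bij h"
  shows "det (\<chi> i j. A $ h i $ h j) = det A"
proof -
  have inj: "inj_on h UNIV" and r: "h ` UNIV = UNIV" using h by (auto simp: bij_def)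
  have bb: "bij_betw h UNIV UNIV" "bij_betw (inv h) UNIV UNIV" using h bij_imp_bij_inv by auto
  have injv: "inj (inv h)" using bb(2) by (simp add: bij_betw_def)
  have "det (\<chi> i j. A $ h i $ h j)
      = (\<Sum>p | p permutes (UNIV::'m set). of_int (sign p) * (\<Prod>i\<in>UNIV. A $ h i $ h (p i)))"
    by (simp add: det_def)
  also have "\<dots> = (\<Sum>p | p permutes (UNIV::'n set). of_int (sign p) * (\<Prod>i\<in>UNIV. A $ i $ p i))"
  proof (rule sum.reindex_bij_witness[where i = "map_permutation UNIV (inv h)" and j = "map_permutation UNIV h"])
    fix p assume p: "p \<in> {p. p permutes (UNIV::'m set)}"
    show "map_permutation UNIV (inv h) (map_permutation UNIV h p) = p"
      by (rule map_permutation_compose_inv[OF bb(1)]) (use p h in \<open>auto simp: bij_is_inj\<close>)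
    show "map_permutation UNIV h p \<in> {p. p permutes (UNIV::'n set)}"
      using map_permutation_permutes[OF bb(1)] p by auto
    have "(\<Prod>i\<in>UNIV. A $ i $ map_permutation UNIV h p i) = (\<Prod>i\<in>UNIV. A $ h i $ map_permutation UNIV h p (h i))"
      using prod.reindex_bij_betw[OF bb(1), of "\<lambda>i. A $ i $ map_permutation UNIV h p i"] by simp
    also have "\<dots> = (\<Prod>i\<in>UNIV. A $ h i $ h (p i))"
      by (simp add: map_permutation_apply[OF inj])
    finally show "of_int (sign (map_permutation UNIV h p)) * (\<Prod>i\<in>UNIV. A $ i $ map_permutation UNIV h p i)
        = of_int (sign p) * (\<Prod>i\<in>UNIV. A $ h i $ h (p i))"
      using sign_map_permutation[OF inj] p by simp
  next
    fix p assume p: "p \<in> {p. p permutes (UNIV::'n set)}"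
    show "map_permutation UNIV h (map_permutation UNIV (inv h) p) = p"
      by (rule map_permutation_compose_inv[OF bb(2)]) (use p h in \<open>auto simp: bij_is_surj surj_f_inv_f\<close>)
    show "map_permutation UNIV (inv h) p \<in> {p. p permutes (UNIV::'m set)}"
      using map_permutation_permutes[OF bb(2)] p by auto
  qed
  also have "\<dots> = det A" by (simp add: det_def)
  finally show ?thesis .
qed

text \<open>The change of variables theorem \<open>has_measure_differentiable_image\<close> concerns \<open>\<real>\<^sup>n\<close> for a well-ordered index type, while the
  index type here is an arbitrary finite one. A copy of the index type, ordered by an enumeration, serves to
  transfer the special case needed.\<close>

typedef 'a ordered_index = "UNIV :: 'a set" ..

instance ordered_index :: (finite) finite
proof
  have "(UNIV :: 'a ordered_index set) = range Abs_ordered_index"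
    by (metis Rep_ordered_index_inverse surjI)
  then show "finite (UNIV :: 'a ordered_index set)" by (metis finite_code finite_imageI)
qed

instantiation ordered_index :: (finite) wellorder
begin

definition less_eq_ordered_index :: "'a ordered_index \<Rightarrow> 'a ordered_index \<Rightarrow> bool" where
  "x \<le> y \<longleftrightarrow> to_nat (Rep_ordered_index x) \<le> to_nat (Rep_ordered_index y)"

definition less_ordered_index :: "'a ordered_index \<Rightarrow> 'a ordered_index \<Rightarrow> bool" where
  "x < y \<longleftrightarrow> to_nat (Rep_ordered_index x) < to_nat (Rep_ordered_index y)"

instance
proof
  fix x y z :: "'a ordered_index"
  show "x < y \<longleftrightarrow> x \<le> y \<and> \<not> y \<le> x" "x \<le> x" "x \<le> y \<Longrightarrow> y \<le> z \<Longrightarrow> x \<le> z" "x \<le> y \<or> y \<le> x"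
    by (auto simp: less_eq_ordered_index_def less_ordered_index_def)
  show "x \<le> y \<Longrightarrow> y \<le> x \<Longrightarrow> x = y"
    by (auto simp: less_eq_ordered_index_def Rep_ordered_index_inject)
next
  fix P :: "'a ordered_index \<Rightarrow> bool" and a :: "'a ordered_index"
  assume step: "\<And>x. (\<And>y. y < x \<Longrightarrow> P y) \<Longrightarrow> P x"
  show "P a"
    by (rule measure_induct_rule[of "\<lambda>x. to_nat (Rep_ordered_index x)"], rule step)
      (simp add: less_ordered_index_def)
qed

end

definition relabel :: "real^'n \<Rightarrow> real^('n::finite ordered_index)" where
  "relabel x = (\<chi> i. x $ Rep_ordered_index i)"

definition unlabel :: "real^('n::finite ordered_index) \<Rightarrow> real^'n" where
  "unlabel y = (\<chi> i. y $ Abs_ordered_index i)"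

lemma relabel_inverse [simp]: "unlabel (relabel x) = x" "relabel (unlabel y) = y"
  by (simp_all add: relabel_def unlabel_def vec_eq_iff Abs_ordered_index_inverse Rep_ordered_index_inverse)

lemma bij_index: "bij (Rep_ordered_index :: 'n ordered_index \<Rightarrow> 'n)"
  by (metis Abs_ordered_index_inverse Rep_ordered_index_inverse UNIV_I bijI')

lemma linear_relabel: "linear relabel" "linear unlabel"
  by (auto simp: relabel_def unlabel_def vec_eq_iff intro!: linearI)

lemma bounded_linear_relabel: "bounded_linear relabel" "bounded_linear unlabel"
  using linear_relabel linear_conv_bounded_linear by blast+

lemma continuous_relabel: "continuous_on S relabel" "continuous_on T unlabel"
  by (rule linear_continuous_on[OF bounded_linear_relabel(1)], rule linear_continuous_on[OF bounded_linear_relabel(2)])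

lemma prod_Basis_cart: "(\<Prod>b\<in>(Basis::(real^'n::finite) set). (v::real^'n) \<bullet> b) = (\<Prod>i\<in>UNIV. v $ i)"
proof -
  have B: "(Basis::(real^'n) set) = range (\<lambda>i. axis i 1)" by (auto simp: Basis_vec_def)
  have i: "inj (\<lambda>i::'n. axis i (1::real))" by (auto simp: inj_def axis_eq_axis)
  show ?thesis unfolding B prod.reindex[OF i] o_def by (simp add: inner_axis)
qed

lemma lborel_relabel: "distr lborel borel (relabel :: real^'n::finite \<Rightarrow> _) = lborel"
proof (rule lborel_eqI[symmetric])
  fix l u :: "real^('n ordered_index)"
  assume le: "\<And>b. b \<in> Basis \<Longrightarrow> l \<bullet> b \<le> u \<bullet> b"
  then have le': "l $ i \<le> u $ i" for i
    using le[of "axis i 1"] axis_in_Basis_iff[of i "1::real"] by (simp add: inner_axis del: axis_in_Basis_iff)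
  have pre: "relabel -` box l u = box (unlabel l) (unlabel u)"
    by (auto simp: mem_box_cart relabel_def unlabel_def) (metis Abs_ordered_index_inverse Rep_ordered_index_inverse UNIV_I)+
  have "emeasure (distr lborel borel relabel) (box l u) = emeasure lborel (box (unlabel l) (unlabel u))"
    by (subst emeasure_distr) (auto simp: pre intro: borel_measurable_continuous_onI continuous_relabel)
  also have "\<dots> = (\<Prod>b\<in>Basis. (unlabel u - unlabel l) \<bullet> b)"
    by (rule emeasure_lborel_box) (auto simp: Basis_vec_def inner_axis unlabel_def le')
  also have "(\<Prod>b\<in>Basis. (unlabel u - unlabel l) \<bullet> b) = (\<Prod>i\<in>UNIV. (u - l) $ Abs_ordered_index i)"
    unfolding prod_Basis_cart by (simp add: unlabel_def)
  also have "\<dots> = (\<Prod>i\<in>UNIV. (u - l) $ i)"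
    by (rule prod.reindex_bij_betw[of Abs_ordered_index UNIV UNIV "\<lambda>i. (u - l) $ i"])
       (metis Abs_ordered_index_inverse Rep_ordered_index_inverse UNIV_I bijI')
  also have "\<dots> = (\<Prod>b\<in>Basis. (u - l) \<bullet> b)" by (rule prod_Basis_cart[symmetric])
  finally show "emeasure (distr lborel borel relabel) (box l u) = (\<Prod>b\<in>Basis. (u - l) \<bullet> b)" .
qed simp

lemma emeasure_relabel:
  fixes S :: "(real^'n::finite) set"
  assumes S: "S \<in> sets borel"
  shows "unlabel -` S \<in> sets borel" "emeasure lborel (unlabel -` S :: (real^('n ordered_index)) set) = emeasure lborel S"
proof -
  show b: "unlabel -` S \<in> sets borel"
    using measurable_sets[OF borel_measurable_continuous_onI[OF continuous_relabel(2)] S] by simp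
  have "emeasure lborel (unlabel -` S :: (real^('n ordered_index)) set) = emeasure (distr lborel borel (relabel :: real^'n \<Rightarrow> _)) (unlabel -` S)"
    by (simp add: lborel_relabel)
  also have "\<dots> = emeasure lborel (relabel -` (unlabel -` S :: (real^('n ordered_index)) set))"
    by (subst emeasure_distr) (auto intro: borel_measurable_continuous_onI continuous_relabel b)
  also have "relabel -` (unlabel -` S :: (real^('n ordered_index)) set) = S" by auto
  finally show "emeasure lborel (unlabel -` S :: (real^('n ordered_index)) set) = emeasure lborel S" .
qed

text \<open>Conjugation with the relabelling of coordinates reduces this to the change of variables theorem with Jacobian 1.\<close>

lemma emeasure_volume_preserving_image:
  fixes f :: "real^'n::finite \<Rightarrow> real^'n"
  assumes S: "S \<in> sets borel" "bounded S" "f ` S \<in> sets borel" and inj: "inj_on f S"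
    and f: "\<And>x. x \<in> S \<Longrightarrow> (f has_derivative f' x) (at x)"
    and det: "\<And>x. x \<in> S \<Longrightarrow> \<bar>det (matrix (f' x))\<bar> = 1"
  shows "emeasure lborel (f ` S) = emeasure lborel S"
proof -
  define F where "F y = relabel (f (unlabel y))" for y
  define T :: "(real^('n ordered_index)) set" where "T = unlabel -` S"
  have T: "T \<in> sets borel" "emeasure lborel T = emeasure lborel S" using emeasure_relabel[OF S(1)] by (auto simp: T_def)
  have FT: "F ` T = unlabel -` (f ` S)"
  proof (intro equalityI subsetI)
    fix z assume "z \<in> F ` T" then show "z \<in> unlabel -` (f ` S)" by (auto simp: F_def T_def)
  next
    fix z :: "real^('n ordered_index)" assume "z \<in> unlabel -` (f ` S)"
    then obtain x where x: "x \<in> S" "unlabel z = f x" by auto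
    then have "z = F (relabel x)" by (simp add: F_def x(2)[symmetric])
    moreover have "relabel x \<in> T" using x by (simp add: T_def)
    ultimately show "z \<in> F ` T" by blast
  qed
  have FTm: "F ` T \<in> sets borel" "emeasure lborel (F ` T) = emeasure lborel (f ` S)"
    using emeasure_relabel[OF S(3)] by (auto simp: FT)
  have fin: "emeasure lborel T < \<infinity>" unfolding T(2) using S(2) emeasure_bounded_finite by blast
  define F' where "F' y h = relabel (f' (unlabel y) (unlabel h))" for y h
  have dF: "(F has_derivative F' y) (at y)" if "y \<in> T" for y
  proof -
    have "((\<lambda>y. f (unlabel y)) has_derivative (\<lambda>h. f' (unlabel y) (unlabel h))) (at y)"
      by (rule has_derivative_compose[OF bounded_linear_imp_has_derivative[OF bounded_linear_relabel(2)] f])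
         (use that in \<open>simp add: T_def\<close>)
    then show ?thesis unfolding F_def[abs_def] F'_def[abs_def]
      by (rule bounded_linear.has_derivative[OF bounded_linear_relabel(1)])
  qed
  have dt: "\<bar>det (matrix (F' y))\<bar> = 1" if "y \<in> T" for y
  proof -
    have ax: "unlabel (axis j 1) = axis (Rep_ordered_index j) (1::real)" for j :: "'n ordered_index"
      by (auto simp: unlabel_def axis_def vec_eq_iff Abs_ordered_index_inverse Rep_ordered_index_inverse)
    have "matrix (F' y) = (\<chi> i j. matrix (f' (unlabel y)) $ Rep_ordered_index i $ Rep_ordered_index j)"
      by (simp add: matrix_def F'_def relabel_def ax)
    then have "det (matrix (F' y)) = det (matrix (f' (unlabel y)))"
      using det_reindex[OF bij_index] by metis
    then show ?thesis using det that by (simp add: T_def)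
  qed
  have injF: "inj_on F T"
  proof (rule inj_onI)
    fix y z assume yz: "y \<in> T" "z \<in> T" "F y = F z"
    then have "f (unlabel y) = f (unlabel z)" unfolding F_def by (metis relabel_inverse(1))
    then have "unlabel y = unlabel z" using inj yz by (auto simp: T_def inj_on_def)
    then show "y = z" by (metis relabel_inverse(2))
  qed
  have Tl: "T \<in> sets lebesgue" "T \<in> lmeasurable"
    using T(1) fin by (auto simp: fmeasurable_def)
  have "((\<lambda>x. 1::real) has_integral measure lebesgue T) T" using Tl(2) by (simp add: has_integral_iff lmeasurable_iff_integrable_on[symmetric] lmeasure_integral)
  then have "((\<lambda>x. \<bar>det (matrix (F' x))\<bar>) has_integral measure lebesgue T) T"
    by (rule has_integral_eq[rotated]) (simp add: dt)
  then have "F ` T \<in> lmeasurable \<and> measure lebesgue (F ` T) = measure lebesgue T"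
    using has_measure_differentiable_image[OF Tl(1) has_derivative_at_withinI[OF dF] injF] by blast
  then have "emeasure lebesgue (F ` T) = emeasure lebesgue T"
    using Tl(2) by (simp add: emeasure_eq_measure2 fmeasurableD2)
  then have "emeasure lborel (F ` T) = emeasure lborel T" using FTm(1) T(1) by simp
  then show ?thesis using T(2) FTm(2) by simp
qed

context two_weights begin

section \<open>The Riemannian measure\<close>

text \<open>Elementary row and column operations remove the off-diagonal entries in the directions \<open>p\<close> and \<open>r\<close>. The result is a product of
  the radial and tangential eigenvalues on the disc, the length of the angular direction and ones.\<close>

lemma det_G:
  assumes x: "x \<in> solid p r"
  shows "det (\<chi> i j. G x i j) = a * b / (cD (dsq p r x))^2"
proof -
  \<comment> \<open>D0 is the diagonal matrix left after the elimination; R1 and R2 undo the row and the column operation.\<close>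
  define k where "k = G x p r / G x p p"
  define d where "d = G x r r - k * G x p r"
  define D0 :: "real^'n^'n" where "D0 = (\<chi> i j. if i = j then (if i = r then d else G x i i) else 0)"
  define R1 :: "real^'n^'n" where "R1 = (\<chi> i. if i = r then row r D0 + k *s row p D0 else row i D0)"
  define R2 :: "real^'n^'n" where "R2 = (\<chi> i. if i = r then row r (transpose R1) + k *s row p (transpose R1) else row i (transpose R1))"
  define s where "s = dsq p r x"
  have D: "cD s > 0" "s < 1" "s \<ge> 0" using cD_pos[OF dsq_bounds[OF x]] dsq_bounds[OF x] by (simp_all add: s_def)
  have pos: "cA s > 0" "cB s > 0" using D a_pos b_pos by (simp_all add: cA_def cB_def)
  have g: "G x p p = cA s + cB s * (x $ p * x $ p)" "G x r r = cA s + cB s * (x $ r * x $ r)"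
    "G x p r = cB s * (x $ p * x $ r)" "G x q q = cS s" "G x r p = G x p r"
    by (simp_all add: G_def kd_def s_def)
  have gpp: "G x p p > 0" unfolding g using pos zero_le_square[of "x $ p"] by (simp add: add_pos_nonneg)
  have z: "G x i j = 0" if "i \<noteq> j" "i \<noteq> p \<or> j \<noteq> r" "i \<noteq> r \<or> j \<noteq> p" for i j
    using that by (cases i rule: index_cases; cases j rule: index_cases; simp add: G_def kd_def flat_def)
  have kp: "k * G x p p = G x p r" using gpp by (simp add: k_def)
  have dr: "d + k * G x p r = G x r r" by (simp add: d_def)
  have "R2 $ i $ j = G x i j" for i j
    using z[of i j] kp dr g(5)
    by (cases "i = r"; cases "j = r"; cases "i = p"; cases "j = p"; cases "i = j";
        simp add: R2_def R1_def D0_def row_def transpose_def algebra_simps)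
  then have "R2 = (\<chi> i j. G x i j)" by (simp add: vec_eq_iff)
  moreover have "det R2 = det (transpose R1)" unfolding R2_def by (rule det_row_operation) simp
  moreover have "det R1 = det D0" unfolding R1_def by (rule det_row_operation) simp
  moreover have "det D0 = (\<Prod>i\<in>UNIV. if i = r then d else G x i i)"
    by (subst det_diagonal) (auto simp: D0_def)
  moreover have "(\<Prod>i\<in>UNIV. if i = r then d else G x i i) = (\<Prod>i\<in>{p, r, q}. if i = r then d else G x i i)"
    by (rule prod.mono_neutral_right) (auto simp: G_def kd_def flat_def)
  ultimately have "det (\<chi> i j. G x i j) = (G x p p * d) * G x q q" by (simp add: det_transpose)
  also have "G x p p * d = G x p p * G x r r - (k * G x p p) * G x p r" by (simp add: d_def algebra_simps)
  also have "\<dots> = G x p p * G x r r - G x p r * G x p r" unfolding kp ..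
  also have "\<dots> = cA s * (cA s + cB s * s)"
    unfolding g s_def dsq_def by algebra
  also have "\<dots> * G x q q = a * b / (cD s)^2"
  proof -
    have "cA s + cB s * s = 1 / (1 - s)"
      using D by (simp add: cA_def cB_def divide_simps) (simp add: cD_def algebra_simps)
    then show ?thesis unfolding g using D by (simp add: cA_def cS_def divide_simps power2_eq_square)
  qed
  finally show ?thesis unfolding s_def .
qed

abbreviation M :: "'n ambient set" where "M \<equiv> sphere_torus p r q"
abbreviation Atl :: "('n ambient, 'n) chart set" where "Atl \<equiv> torus_atlas p r q"

lemma dil_pos:
  assumes "c \<in> Atl" "x \<in> img c"
  shows "dil p q a b (pt c x) > 0" "det (metric_matrix met c x) = a * b / (dil p q a b (pt c x))^2"
proof -
  obtain p' q' a' b' \<theta> where c: "two_weights p' r q' a' b'" "c = torus_chart p' r q' \<theta>"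
    and e: "metric_form p' r q' a' b' = metric_form p r q a b"
    and pq: "p' = p \<and> q' = q \<and> a' = a \<and> b' = b \<or> p' = q \<and> q' = p \<and> a' = b \<and> b' = a"
    by (rule atlas_weights[OF assms(1)]) (rule that; assumption)
  interpret c: two_weights p' r q' a' b' by (rule c(1))
  have x: "x \<in> box_around p' r \<theta>" using assms(2) c(2) c.img_torus_chart by simp
  then have xs: "x \<in> solid p' r" using c.box_solid by blast
  have d: "dil p q a b (pt c x) = c.cD (dsq p' r x)"
    using c.frame_products(8)[OF x] pq unfolding c(2) by (auto simp: dil_swap)
  then show "dil p q a b (pt c x) > 0" using c.cD_pos[OF c.dsq_bounds[OF xs]] by simp
  have "metric_matrix met c x = (\<chi> i j. c.G x i j)"
    unfolding metric_matrix_def e[symmetric] c(2) by (simp add: vec_eq_iff c.components(1)[OF x])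
  then show "det (metric_matrix met c x) = a * b / (dil p q a b (pt c x))^2"
    unfolding d using c.det_G[OF xs] pq by (auto simp: mult.commute)
qed

text \<open>By \<open>dil_pos\<close> this is the volume density \<open>sqrt (det g)\<close> in every chart. It is a function of the point, not of the chart.\<close>

definition dens :: "'n ambient \<Rightarrow> real" where "dens y = sqrt (a * b) / dil p q a b y"

lemma sqrt_det_metric:
  assumes "c \<in> Atl" "x \<in> img c"
  shows "sqrt (det (metric_matrix met c x)) = dens (pt c x)"
  unfolding dil_pos(2)[OF assms] dens_def using dil_pos(1)[OF assms] by (simp add: real_sqrt_divide)

text \<open>The metric matrices in two charts have the same determinant, so the transformation law forces the square of the Jacobian determinant to be 1.\<close>

lemma transition_volume:
  assumes c: "c \<in> Atl" "d \<in> Atl" and x: "x \<in> overlap c d"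
  shows "\<bar>det (matrix (frechet_derivative (transition c d) (at x)))\<bar> = 1"
proof -
  note o = overlapD[OF smooth_manifold_torus c x]
  let ?J = "matrix (frechet_derivative (transition c d) (at x))" and ?y = "transition c d x"
  have J: "?J $ k $ i = jac c d x k i" for k i by (simp add: matrix_def jac_def)
  have "metric_matrix met c x $ i $ j = (transpose ?J ** metric_matrix met d ?y ** ?J) $ i $ j" for i j
  proof -
    have "met c x i j = (\<Sum>k\<in>UNIV. \<Sum>l\<in>UNIV. jac c d x k i * jac c d x l j * met d ?y k l)"
      using riemannian_metric_met c x unfolding riemannian_metric_def smooth_tensor2_def by blast
    also have "\<dots> = (\<Sum>l\<in>UNIV. (\<Sum>k\<in>UNIV. jac c d x k i * met d ?y k l) * jac c d x l j)"
      by (subst sum.swap) (simp add: sum_distrib_right sum_distrib_left mult_ac)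
    finally show ?thesis by (simp add: metric_matrix_def matrix_matrix_mult_def transpose_def J)
  qed
  then have "metric_matrix met c x = transpose ?J ** metric_matrix met d ?y ** ?J" by (simp add: vec_eq_iff)
  then have "det (metric_matrix met c x) = det ?J * det (metric_matrix met d ?y) * det ?J"
    by (simp add: det_mul det_transpose)
  moreover have "det (metric_matrix met c x) = det (metric_matrix met d ?y)"
    using dil_pos(2)[OF c(1) o(1)] dil_pos(2)[OF c(2) o(4)] o(6) by simp
  moreover have "det (metric_matrix met d ?y) > 0"
    unfolding dil_pos(2)[OF c(2) o(4)] using dil_pos(1)[OF c(2) o(4)] a_pos b_pos by simp
  ultimately have "det ?J * det ?J = 1" by (simp add: mult.commute mult.left_commute)
  then have "(det ?J)^2 = 1" by (simp add: power2_eq_square)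
  then have "det ?J = 1 \<or> det ?J = - 1" by (simp add: power2_eq_1_iff)
  then show ?thesis by auto
qed

text \<open>The points not covered by a chart \<open>torus_chart p r q \<theta>\<close> have some angle exactly opposite to \<open>\<theta>\<close>. In a chart with the same disc coordinate this
  places a coordinate in a discrete set. In a chart with the other disc coordinate, whose real and imaginary
  parts sit in the slots \<open>q\<close> and \<open>r\<close>, the opposite ray lies on a line through the origin. Hyperplanes cover all
  these possibilities.\<close>

definition cuts :: "real^'n \<Rightarrow> (real^'n) set" where
  "cuts \<theta> = (\<Union>k. \<Union>m::int. {x. x $ k = \<theta> $ k + of_int m * pi}) \<union> {x. cos (\<theta> $ q) * x $ r = sin (\<theta> $ q) * x $ q}"

lemma null_cuts: "cuts \<theta> \<in> null_sets lborel"
proof -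
  have n: "S \<in> null_sets lborel" if "negligible S" "closed S" for S :: "(real^'n) set"
    using that negligible_iff_null_sets null_sets_completion_iff[of S lborel] by auto
  have "{x. x $ k = \<theta> $ k + of_int m * pi} \<in> null_sets lborel" for k and m :: int
  proof (intro n closed_Collect_eq continuous_intros)
    have "{x. x $ k = \<theta> $ k + of_int m * pi} = {x. axis k 1 \<bullet> x = \<theta> $ k + of_int m * pi}"
      by (simp add: inner_axis')
    then show "negligible {x. x $ k = \<theta> $ k + of_int m * pi}"
      using negligible_hyperplane[of "axis k (1::real)"] by (simp add: axis_eq_0_iff)
  qed
  moreover have "{x::real^'n. cos (\<theta> $ q) * x $ r = sin (\<theta> $ q) * x $ q} \<in> null_sets lborel"
  proof (intro n closed_Collect_eq continuous_intros)
    let ?v = "cos (\<theta> $ q) *\<^sub>R axis r 1 - sin (\<theta> $ q) *\<^sub>R axis q (1::real)"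
    have "?v $ r = cos (\<theta> $ q)" "?v $ q = - sin (\<theta> $ q)" by (simp_all add: axis_def)
    then have "?v \<noteq> 0" using sin_cos_squared_add[of "\<theta> $ q"] by (metis neg_equal_0_iff_equal power_zero_numeral add_0 zero_index zero_neq_one)
    moreover have "{x::real^'n. cos (\<theta> $ q) * x $ r = sin (\<theta> $ q) * x $ q} = {x. ?v \<bullet> x = 0}"
      by (auto simp: inner_diff_left inner_axis')
    ultimately show "negligible {x::real^'n. cos (\<theta> $ q) * x $ r = sin (\<theta> $ q) * x $ q}"
      using negligible_hyperplane[of ?v 0] by simp
  qed
  ultimately show ?thesis unfolding cuts_def by (intro null_sets_UN null_sets.Un null_sets_UN') auto
qed

lemma outside_cuts:
  assumes c: "c \<in> Atl" and x: "x \<in> img c" and out: "pt c x \<notin> cdom (torus_chart p r q \<theta>)"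
  shows "x \<in> cuts \<theta>"
proof -
  have im: "cos t * s = sin t * k" if "\<not> off_cut t k s" for t k s
  proof -
    have "Im (cis (- t) * Complex k s) = 0" using that by (auto simp: off_cut_def complex_nonpos_Reals_iff)
    then show ?thesis by simp
  qed
  have sn: "\<exists>m::int. y = t + of_int m * pi" if "\<not> off_cut t (\<rho> * cos y) (\<rho> * sin y)" "\<rho> > 0" for t \<rho> y
  proof -
    have "\<rho> * sin (y - t) = 0" using im[OF that(1)] by (simp add: sin_diff algebra_simps)
    then have "sin (y - t) = 0" using that(2) by simp
    then obtain m :: int where "y - t = of_int m * pi" using sin_zero_iff_int2 by blast
    then show ?thesis by (intro exI[of _ m]) simp
  qed
  from c show ?thesis
  proof (rule atlas_cases)
    fix \<theta>' assume c: "c = torus_chart p r q \<theta>'"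
    have xb: "x \<in> box_around p r \<theta>'" using x unfolding c img_torus_chart .
    then have xs: "x \<in> solid p r" using box_solid by blast
    obtain k where k: "k \<noteq> p" "k \<noteq> r" "\<not> off_cut (\<theta> $ k) (fst (param p r q x) $ k) (snd (param p r q x) $ k)"
      using out param_in[OF xs] unfolding c pt_torus_chart[OF xb] by (auto simp: torus_chart_def patch_def)
    then have "\<exists>m::int. x $ k = \<theta> $ k + of_int m * pi"
      using sn[OF _ modulus_pos[OF xs, of k]] by (simp add: param_nth)
    then show ?thesis by (auto simp: cuts_def)
  next
    interpret s: two_weights q r p b a by (rule swapped_weights)
    fix \<theta>' assume c: "c = torus_chart q r p \<theta>'"
    have xb: "x \<in> box_around q r \<theta>'" using x unfolding c s.img_torus_chart .
    then have xs: "x \<in> solid q r" using s.box_solid by blast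
    obtain k where k: "k \<noteq> p" "k \<noteq> r" "\<not> off_cut (\<theta> $ k) (fst (param q r p x) $ k) (snd (param q r p x) $ k)"
      using out s.param_in[OF xs] unfolding c s.pt_torus_chart[OF xb] by (auto simp: torus_chart_def patch_def sphere_torus_swap)
    show ?thesis
    proof (cases "k = q")
      case True
      then show ?thesis using im[OF k(3)] by (simp add: s.param_nth cuts_def)
    next
      case False
      then have "\<exists>m::int. x $ k = \<theta> $ k + of_int m * pi"
        using sn[OF _ s.modulus_pos[OF xs, of k]] k by (simp add: s.param_nth)
      then show ?thesis by (auto simp: cuts_def)
    qed
  qed
qed

lemma outside_null:
  assumes d: "d \<in> Atl"
  shows "\<exists>N\<in>null_sets lborel. \<forall>c\<in>Atl. \<forall>x\<in>img c. pt c x \<notin> cdom d \<longrightarrow> x \<in> N"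
  using d
proof (rule atlas_cases)
  fix \<theta> assume d: "d = torus_chart p r q \<theta>"
  show ?thesis
    by (intro bexI[OF _ null_cuts[of \<theta>]] ballI impI) (rule outside_cuts, simp_all add: d)
next
  interpret s: two_weights q r p b a by (rule swapped_weights)
  fix \<theta> assume d: "d = torus_chart q r p \<theta>"
  show ?thesis
    by (intro bexI[OF _ s.null_cuts[of \<theta>]] ballI impI)
      (rule s.outside_cuts, simp_all add: d torus_atlas_swap)
qed

lemma bounded_box: "bounded (box_around p r \<theta>)"
proof -
  have "norm x \<le> (\<Sum>k\<in>UNIV. \<bar>\<theta> $ k\<bar> + 4)" if "x \<in> box_around p r \<theta>" for x
  proof -
    have "(x $ p)^2 \<le> 1" "(x $ r)^2 \<le> 1"
      using that unfolding box_around_def dsq_def by (auto) (smt (verit) zero_le_power2)+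
    then have "\<bar>x $ p\<bar> \<le> 1" "\<bar>x $ r\<bar> \<le> 1" by (simp_all add: abs_square_le_1)
    moreover have "\<bar>x $ k\<bar> \<le> \<bar>\<theta> $ k\<bar> + 4" if "k \<noteq> p" "k \<noteq> r" for k
    proof -
      have "\<bar>x $ k - \<theta> $ k\<bar> < pi" using \<open>x \<in> _\<close> that by (simp add: box_around_def)
      then show ?thesis using pi_less_4 by linarith
    qed
    ultimately have "\<bar>x $ k\<bar> \<le> \<bar>\<theta> $ k\<bar> + 4" for k
      by (cases "k = p"; cases "k = r") (auto intro: order_trans)
    then show ?thesis using norm_le_l1_cart[of x] sum_mono[of UNIV "\<lambda>k. \<bar>x $ k\<bar>" "\<lambda>k. \<bar>\<theta> $ k\<bar> + 4"] by force
  qed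
  then show ?thesis using bounded_iff by blast
qed

lemma bounded_img: "c \<in> Atl \<Longrightarrow> bounded (img c)"
proof (erule atlas_weights)
  fix p' q' a' b' \<theta> assume "two_weights p' r q' a' b'" "c = torus_chart p' r q' \<theta>"
  then interpret c: two_weights p' r q' a' b' by simp
  show "bounded (img c)" unfolding \<open>c = _\<close> c.img_torus_chart by (rule c.bounded_box)
qed

lemma
  assumes c: "c \<in> Atl"
  shows borel_img: "img c \<in> sets borel" and borel_dom: "cdom c \<in> sets borel"
    and dom_subset: "cdom c \<subseteq> M"
    and pt_measurable: "pt c \<in> borel_measurable (restrict_space borel (img c))"
    and borel_pullback: "E \<in> sets borel \<Longrightarrow> {x \<in> img c. pt c x \<in> E} \<in> sets borel"
    and borel_image: "B \<in> sets borel \<Longrightarrow> B \<subseteq> img c \<Longrightarrow> pt c ` B \<in> sets borel"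
    and pt_dom: "x \<in> img c \<Longrightarrow> pt c x \<in> cdom c"
    and pt_inj: "inj_on (pt c) (img c)"
proof -
  note m = smooth_manifold_torus
  show i: "img c \<in> sets borel" using chart_img_open[OF m c] by simp
  obtain T where T: "open T" "cdom c = M \<inter> T" using chart_dom_open[OF m c] openin_open by blast
  have "closed M" using compact_torus compact_imp_closed by blast
  then show d: "cdom c \<in> sets borel" using T by auto
  show "cdom c \<subseteq> M" using T by auto
  show pm: "pt c \<in> borel_measurable (restrict_space borel (img c))"
    by (rule borel_measurable_continuous_on_restrict[OF smooth_on_continuous_on[OF smooth_pt_atlas[OF c]]])
  show "{x \<in> img c. pt c x \<in> E} \<in> sets borel" if "E \<in> sets borel"
  proof -
    have "pt c -` E \<inter> space (restrict_space borel (img c)) \<in> sets (restrict_space borel (img c))"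
      by (rule measurable_sets[OF pm that])
    moreover have "pt c -` E \<inter> space (restrict_space borel (img c)) = {x \<in> img c. pt c x \<in> E}"
      by (auto simp: space_restrict_space)
    ultimately show ?thesis using i by (simp add: sets_restrict_space_iff)
  qed
  have inv: "coord c (pt c x) = x" "pt c x \<in> cdom c" if "x \<in> img c" for x
    using that by (auto simp: pt_def img_def f_inv_into_f inv_into_into)
  show "x \<in> img c \<Longrightarrow> pt c x \<in> cdom c" by (rule inv(2))
  show "inj_on (pt c) (img c)" by (rule inj_on_inverseI[of _ "coord c"]) (rule inv(1))
  have inv2: "pt c (coord c y) = y" if "y \<in> cdom c" for y
    using inv_into_f_f[OF chart_inj[OF m c] that] by (simp add: pt_def)
  show "pt c ` B \<in> sets borel" if B: "B \<in> sets borel" "B \<subseteq> img c"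
  proof -
    have "subtopology (top_of_set M) (cdom c) = top_of_set (cdom c)"
      using T(2) by (simp add: subtopology_subtopology Int_absorb1)
    then have "continuous_on (cdom c) (coord c)"
      using chart_homeomorphic[OF m c] homeomorphic_imp_continuous_map by (metis continuous_map_in_subtopology continuous_map_iff_continuous)
    then have "coord c \<in> borel_measurable (restrict_space borel (cdom c))" by (rule borel_measurable_continuous_on_restrict)
    from measurable_sets[OF this B(1)] have "coord c -` B \<inter> cdom c \<in> sets borel"
      using d by (simp add: sets_restrict_space_iff space_restrict_space)
    moreover have "coord c -` B \<inter> cdom c = pt c ` B"
    proof (intro equalityI subsetI)
      fix y assume "y \<in> coord c -` B \<inter> cdom c"
      then show "y \<in> pt c ` B" using inv2 by (metis IntE image_eqI vimage_eq)
    next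
      fix y assume "y \<in> pt c ` B"
      then show "y \<in> coord c -` B \<inter> cdom c" using inv B(2) by auto
    qed
    ultimately show ?thesis by simp
  qed
qed

text \<open>Up to null sets both sides are measures of subsets of the overlap, which the volume preserving
  coordinate change maps to each other.\<close>

lemma chart_measure_independent:
  assumes c: "c \<in> Atl" "d \<in> Atl" and E: "E \<in> sets borel"
  shows "emeasure lborel {x \<in> img c. pt c x \<in> E} = emeasure lborel {x \<in> img d. pt d x \<in> E}"
proof -
  note m = smooth_manifold_torus
  \<comment> \<open>Points outside the other chart form a null set.\<close>
  have red: "emeasure lborel {x \<in> img c. pt c x \<in> E} = emeasure lborel {x \<in> overlap c d. pt c x \<in> E}"
    "{x \<in> overlap c d. pt c x \<in> E} \<in> sets borel"
    if c: "c \<in> Atl" "d \<in> Atl" for c d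
  proof -
    obtain N where N: "N \<in> null_sets lborel" "\<And>c x. c \<in> Atl \<Longrightarrow> x \<in> img c \<Longrightarrow> pt c x \<notin> cdom d \<Longrightarrow> x \<in> N"
      using outside_null[OF c(2)] by blast
    have "{x \<in> overlap c d. pt c x \<in> E} = {x \<in> img c. pt c x \<in> E} \<inter> overlap c d"
      using overlapD(1)[OF m c] by blast
    then show 1: "{x \<in> overlap c d. pt c x \<in> E} \<in> sets borel"
      using borel_pullback[OF c(1) E] overlap_open[OF m c] by simp
    have ov: "x \<in> overlap c d" if "x \<in> img c" "pt c x \<in> cdom d" for x
    proof -
      have "coord c (pt c x) = x" "pt c x \<in> cdom c"
        using that by (auto simp: pt_def img_def f_inv_into_f inv_into_into)
      then show ?thesis unfolding overlap_def using that(2) by (metis IntI imageI)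
    qed
    have "{x \<in> img c. pt c x \<in> E} \<union> N = {x \<in> overlap c d. pt c x \<in> E} \<union> N"
      using N(2)[OF c(1)] ov overlapD(1)[OF m c] by blast
    moreover have "emeasure lborel ({x \<in> img c. pt c x \<in> E} \<union> N) = emeasure lborel {x \<in> img c. pt c x \<in> E}"
      using borel_pullback[OF c(1) E] by (intro emeasure_Un_null_set N(1)) simp
    moreover have "emeasure lborel ({x \<in> overlap c d. pt c x \<in> E} \<union> N) = emeasure lborel {x \<in> overlap c d. pt c x \<in> E}"
      using 1 by (intro emeasure_Un_null_set N(1)) simp
    ultimately show "emeasure lborel {x \<in> img c. pt c x \<in> E} = emeasure lborel {x \<in> overlap c d. pt c x \<in> E}"
      by simp
  qed
  let ?\<tau> = "transition c d" and ?S = "{x \<in> overlap c d. pt c x \<in> E}"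
  have im: "?\<tau> ` ?S = {x \<in> overlap d c. pt d x \<in> E}"
  proof (intro equalityI subsetI)
    fix y assume "y \<in> ?\<tau> ` ?S"
    then show "y \<in> {x \<in> overlap d c. pt d x \<in> E}" using overlapD(5,6)[OF m c] by auto
  next
    fix y assume y: "y \<in> {x \<in> overlap d c. pt d x \<in> E}"
    then have "y = ?\<tau> (transition d c y)" "transition d c y \<in> overlap c d" "pt c (transition d c y) = pt d y"
      using overlapD(5,6,7)[OF m c(2,1)] by auto
    then show "y \<in> ?\<tau> ` ?S" using y by (metis (mono_tags, lifting) image_eqI mem_Collect_eq)
  qed
  have "emeasure lborel (?\<tau> ` ?S) = emeasure lborel ?S"
  proof (rule emeasure_volume_preserving_image)
    show "?S \<in> sets borel" by (rule red(2)[OF c])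
    show "?\<tau> ` ?S \<in> sets borel" unfolding im by (rule red(2)[OF c(2,1)])
    show "bounded ?S" by (rule bounded_subset[OF bounded_img[OF c(1)]]) (use overlapD(1)[OF m c] in blast)
    show "inj_on ?\<tau> ?S"
      by (rule inj_on_inverseI[of _ "transition d c"]) (use overlapD(7)[OF m c] in blast)
    show "(?\<tau> has_derivative frechet_derivative ?\<tau> (at x)) (at x)" if "x \<in> ?S" for x
      using smooth_on_has_derivative[OF transition_smooth(1)[OF m c]] that by blast
    show "\<bar>det (matrix (frechet_derivative ?\<tau> (at x)))\<bar> = 1" if "x \<in> ?S" for x
      using transition_volume[OF c] that by blast
  qed
  then show ?thesis unfolding im red(1)[OF c] red(1)[OF c(2,1)] by simp
qed

definition borel_M :: "'n ambient measure" where "borel_M = restrict_space borel M"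

lemma closed_M: "closed M" using compact_torus compact_imp_closed by blast

lemma space_borel_M: "space borel_M = M" by (simp add: borel_M_def space_restrict_space)

lemma sets_borel_M_iff: "E \<in> sets borel_M \<longleftrightarrow> E \<in> sets borel \<and> E \<subseteq> M"
  using closed_M by (auto simp: borel_M_def sets_restrict_space_iff)

lemma sets_borel_M: "sets borel_M = sigma_sets M {U. openin (top_of_set M) U}"
proof -
  have "M \<in> sigma_sets UNIV {S. open S}" using closed_M by (metis borel_closed sets_borel)
  then have "(\<inter>) M ` sigma_sets UNIV {S. open S} = sigma_sets M ((\<inter>) M ` {S. open S})"
    by (rule sigma_sets_Int) simp
  moreover have "(\<inter>) M ` {S. open S} = {U. openin (top_of_set M) U}"
    by (auto simp: openin_open)
  ultimately show ?thesis by (simp add: borel_M_def sets_restrict_space sets_borel)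
qed

definition chart_measure :: "('n ambient, 'n) chart \<Rightarrow> 'n ambient measure" where
  "chart_measure c = distr (restrict_space lborel (img c)) borel_M (pt c)"

lemma pt_measurable_borel_M:
  assumes c: "c \<in> Atl"
  shows "pt c \<in> measurable (restrict_space lborel (img c)) borel_M"
  unfolding borel_M_def
proof (rule measurable_restrict_space2)
  show "pt c \<in> space (restrict_space lborel (img c)) \<rightarrow> M"
    using pt_dom[OF c] dom_subset[OF c] by (auto simp: space_restrict_space)
  have "sets (restrict_space lborel (img c)) = sets (restrict_space borel (img c))"
    by (rule sets_restrict_space_cong) simp
  then show "pt c \<in> borel_measurable (restrict_space lborel (img c))"
    using pt_measurable[OF c] measurable_cong_sets by blast
qed

lemma emeasure_chart_measure:
  assumes c: "c \<in> Atl" and E: "E \<in> sets borel_M"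
  shows "emeasure (chart_measure c) E = emeasure lborel {x \<in> img c. pt c x \<in> E}"
proof -
  have "emeasure (chart_measure c) E = emeasure (restrict_space lborel (img c)) (pt c -` E \<inter> img c)"
    unfolding chart_measure_def by (subst emeasure_distr[OF pt_measurable_borel_M[OF c] E]) (simp add: space_restrict_space)
  also have "\<dots> = emeasure lborel (pt c -` E \<inter> img c)"
    by (rule emeasure_restrict_space) (use borel_img[OF c] in auto)
  also have "pt c -` E \<inter> img c = {x \<in> img c. pt c x \<in> E}" by auto
  finally show ?thesis .
qed

lemma chart_measure_eq:
  assumes "c \<in> Atl" "d \<in> Atl"
  shows "chart_measure c = chart_measure d"
proof (rule measure_eqI)
  show "sets (chart_measure c) = sets (chart_measure d)" by (simp add: chart_measure_def)
  fix E assume "E \<in> sets (chart_measure c)"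
  then have E: "E \<in> sets borel_M" by (simp add: chart_measure_def)
  then show "emeasure (chart_measure c) E = emeasure (chart_measure d) E"
    unfolding emeasure_chart_measure[OF assms(1) E] emeasure_chart_measure[OF assms(2) E]
    by (intro chart_measure_independent assms) (simp add: sets_borel_M_iff)
qed

definition base :: "('n ambient, 'n) chart" where "base = torus_chart p r q 0"

lemma base_in: "base \<in> Atl" by (simp add: base_def atlas_in)

text \<open>The choice of the chart \<open>base\<close> is immaterial by \<open>chart_measure_eq\<close>.\<close>

definition vol :: "'n ambient measure" where "vol = density (chart_measure base) (\<lambda>y. ennreal (dens y))"

lemma continuous_dil: "continuous_on S (dil p q a b)"
  unfolding dil_def[abs_def] dotc_def by (intro continuous_intros)

lemma dens_measurable: "dens \<in> borel_measurable borel_M"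
proof -
  have "dil p q a b \<in> borel_measurable borel" by (rule borel_measurable_continuous_onI[OF continuous_dil])
  then have "dens \<in> borel_measurable borel" unfolding dens_def[abs_def] by measurable
  then show ?thesis unfolding borel_M_def by (rule measurable_restrict_space1)
qed

lemma vol_chart: "c \<in> Atl \<Longrightarrow> vol = density (chart_measure c) (\<lambda>y. ennreal (dens y))"
  unfolding vol_def using chart_measure_eq[OF base_in] by simp

lemma emeasure_vol:
  assumes c: "c \<in> Atl" and E: "E \<in> sets borel_M"
  shows "emeasure vol E = (\<integral>\<^sup>+x\<in>{x \<in> img c. pt c x \<in> E}. ennreal (dens (pt c x)) \<partial>lborel)"
proof -
  have d: "(\<lambda>y. ennreal (dens y)) \<in> borel_measurable borel_M" using dens_measurable by simp
  have dE: "(\<lambda>y. ennreal (dens y) * indicator E y) \<in> borel_measurable borel_M" using d E by simp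
  have "emeasure vol E = (\<integral>\<^sup>+y. ennreal (dens y) * indicator E y \<partial>chart_measure c)"
    unfolding vol_chart[OF c] by (rule emeasure_density) (use d E in \<open>auto simp: chart_measure_def\<close>)
  also have "\<dots> = (\<integral>\<^sup>+x. ennreal (dens (pt c x)) * indicator E (pt c x) \<partial>restrict_space lborel (img c))"
    unfolding chart_measure_def by (rule nn_integral_distr[OF pt_measurable_borel_M[OF c]]) (use dE in simp)
  also have "\<dots> = (\<integral>\<^sup>+x. ennreal (dens (pt c x)) * indicator E (pt c x) * indicator (img c) x \<partial>lborel)"
    by (rule nn_integral_restrict_space) (use borel_img[OF c] in auto)
  also have "\<dots> = (\<integral>\<^sup>+x\<in>{x \<in> img c. pt c x \<in> E}. ennreal (dens (pt c x)) \<partial>lborel)"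
    by (intro nn_integral_cong) (auto simp: indicator_def)
  finally show ?thesis .
qed

lemma is_riemannian_vol: "is_riemannian_measure (top_of_set M) Atl met vol"
  unfolding is_riemannian_measure_def
proof (intro conjI ballI impI)
  show "space vol = topspace (top_of_set M)" by (simp add: vol_def chart_measure_def space_borel_M)
  show "sets vol = sigma_sets (topspace (top_of_set M)) {U. openin (top_of_set M) U}"
    by (simp add: vol_def chart_measure_def sets_borel_M)
  fix c B assume c: "c \<in> Atl" and B: "B \<in> sets borel" "B \<subseteq> img c"
  have E: "pt c ` B \<in> sets borel_M"
    unfolding sets_borel_M_iff using borel_image[OF c B] pt_dom[OF c] dom_subset[OF c] B(2) by blast
  have "{x \<in> img c. pt c x \<in> pt c ` B} = B"
    using B(2) pt_inj[OF c] by (auto simp: inj_on_def)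
  then show "emeasure vol (pt c ` B) = (\<integral>\<^sup>+x\<in>B. ennreal (sqrt (det (metric_matrix met c x))) \<partial>lborel)"
    unfolding emeasure_vol[OF c E]
    by (intro nn_integral_cong) (use B(2) sqrt_det_metric[OF c] in \<open>auto simp: indicator_def\<close>)
qed

lemma finite_subatlas: "\<exists>F. finite F \<and> F \<subseteq> Atl \<and> M \<subseteq> (\<Union>c\<in>F. cdom c)"
proof -
  have "\<forall>c\<in>Atl. \<exists>T. open T \<and> cdom c = M \<inter> T"
    using chart_dom_open[OF smooth_manifold_torus] openin_open by blast
  then obtain T where T: "\<And>c. c \<in> Atl \<Longrightarrow> open (T c)" "\<And>c. c \<in> Atl \<Longrightarrow> cdom c = M \<inter> T c" by metis
  have "M = (\<Union>c\<in>Atl. cdom c)" using smooth_manifold_torus by (simp add: smooth_manifold_def)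
  then have "M \<subseteq> (\<Union>c\<in>Atl. T c)" using T(2) by blast
  from compactE_image[OF compact_torus T(1) this]
  obtain F where F: "F \<subseteq> Atl" "finite F" "M \<subseteq> (\<Union>c\<in>F. T c)" by metis
  then have "M \<subseteq> (\<Union>c\<in>F. cdom c)" using T(2) by blast
  then show ?thesis using F by blast
qed

text \<open>A Riemannian measure is prescribed on subsets of each chart. Finitely many charts suffice, and each meets the complement of
  \<open>base\<close> in a null set, so the measure of any set is determined by its part in \<open>base\<close>.\<close>

lemma riemannian_measure_determined:
  assumes \<mu>: "is_riemannian_measure (top_of_set M) Atl met \<mu>" and E: "E \<in> sets borel_M"
  shows "emeasure \<mu> E = (\<integral>\<^sup>+x\<in>{x \<in> img base. pt base x \<in> E}. ennreal (dens (pt base x)) \<partial>lborel)"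
proof -
  have s: "sets \<mu> = sets borel_M" using \<mu> by (simp add: is_riemannian_measure_def sets_borel_M)
  have ch: "emeasure \<mu> (pt c ` B) = (\<integral>\<^sup>+x\<in>B. ennreal (dens (pt c x)) \<partial>lborel)"
    if "c \<in> Atl" "B \<in> sets borel" "B \<subseteq> img c" for c B
  proof -
    have "emeasure \<mu> (pt c ` B) = (\<integral>\<^sup>+x\<in>B. ennreal (sqrt (det (metric_matrix met c x))) \<partial>lborel)"
      using \<mu> that by (simp add: is_riemannian_measure_def)
    also have "\<dots> = (\<integral>\<^sup>+x\<in>B. ennreal (dens (pt c x)) \<partial>lborel)"
      by (intro nn_integral_cong) (use that(3) sqrt_det_metric[OF that(1)] in \<open>auto simp: indicator_def\<close>)
    finally show ?thesis .
  qed
  obtain F where F: "finite F" "F \<subseteq> Atl" "M \<subseteq> (\<Union>c\<in>F. cdom c)" using finite_subatlas by blast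
  obtain N where N: "N \<in> null_sets lborel" "\<And>c x. c \<in> Atl \<Longrightarrow> x \<in> img c \<Longrightarrow> pt c x \<notin> cdom base \<Longrightarrow> x \<in> N"
    using outside_null[OF base_in] by blast
  define Z :: "('n ambient, 'n) chart \<Rightarrow> (real^'n) set" where "Z c = {x \<in> img c. pt c x \<in> - cdom base}" for c
  have Zb: "Z c \<in> sets borel" if "c \<in> Atl" for c
    unfolding Z_def by (rule borel_pullback[OF that]) (use borel_dom[OF base_in] in auto)
  have Z0: "pt c ` Z c \<in> null_sets \<mu>" if c: "c \<in> Atl" for c
  proof -
    have im: "pt c ` Z c \<in> sets borel_M"
      unfolding sets_borel_M_iff using borel_image[OF c Zb[OF c]] pt_dom[OF c] dom_subset[OF c] unfolding Z_def by blast
    have "AE x in lborel. x \<notin> N" using N(1) by (rule AE_not_in)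
    then have "AE x in lborel. ennreal (dens (pt c x)) * indicator (Z c) x = 0"
      by eventually_elim (use N(2)[OF c] in \<open>auto simp: Z_def indicator_def\<close>)
    then have "(\<integral>\<^sup>+x\<in>Z c. ennreal (dens (pt c x)) \<partial>lborel) = (\<integral>\<^sup>+(x::real^'n). 0 \<partial>lborel)"
      by (rule nn_integral_cong_AE)
    then have "emeasure \<mu> (pt c ` Z c) = 0"
      using ch[OF c Zb[OF c]] by (simp add: Z_def)
    then show ?thesis using im s by blast
  qed
  have N0: "(\<Union>c\<in>F. pt c ` Z c) \<in> null_sets \<mu>"
    using F(1,2) Z0 by (intro null_sets.finite_UN) auto
  let ?B = "{x \<in> img base. pt base x \<in> E}"
  have Eb: "E \<in> sets borel" "E \<subseteq> M" using E by (simp_all add: sets_borel_M_iff)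
  have B: "?B \<in> sets borel" by (rule borel_pullback[OF base_in Eb(1)])
  have im: "pt base ` ?B \<in> sets \<mu>"
    unfolding s sets_borel_M_iff using borel_image[OF base_in B] Eb(2) by auto
  have "E \<union> (\<Union>c\<in>F. pt c ` Z c) = pt base ` ?B \<union> (\<Union>c\<in>F. pt c ` Z c)"
  proof (intro equalityI subsetI)
    fix y assume y: "y \<in> E \<union> (\<Union>c\<in>F. pt c ` Z c)"
    show "y \<in> pt base ` ?B \<union> (\<Union>c\<in>F. pt c ` Z c)"
    proof (cases "y \<in> E")
      case True
      show ?thesis
      proof (cases "y \<in> cdom base")
        case True
        then have "y = pt base (coord base y)" "coord base y \<in> img base"
          using inv_into_f_f[OF chart_inj[OF smooth_manifold_torus base_in] True] by (auto simp: pt_def img_def)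
        then show ?thesis using \<open>y \<in> E\<close> by (metis (mono_tags, lifting) UnI1 image_eqI mem_Collect_eq)
      next
        case False
        obtain c where c: "c \<in> F" "y \<in> cdom c" using True Eb(2) F(3) by blast
        then have "c \<in> Atl" using F(2) by blast
        then have "y = pt c (coord c y)" "coord c y \<in> img c"
          using inv_into_f_f[OF chart_inj[OF smooth_manifold_torus] c(2)] c(2) by (auto simp: pt_def img_def)
        then have "y \<in> pt c ` Z c" using False unfolding Z_def
          by (metis (mono_tags, lifting) ComplI image_eqI mem_Collect_eq)
        then show ?thesis using c(1) by blast
      qed
    next
      case False
      then show ?thesis using y by (simp only: Un_iff simp_thms)
    qed
  next
    fix y assume "y \<in> pt base ` ?B \<union> (\<Union>c\<in>F. pt c ` Z c)"
    moreover have "pt base ` ?B \<subseteq> E" by (rule image_subsetI) simp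
    ultimately show "y \<in> E \<union> (\<Union>c\<in>F. pt c ` Z c)" by (meson Un_iff subsetD)
  qed
  then have "emeasure \<mu> (E \<union> (\<Union>c\<in>F. pt c ` Z c)) = emeasure \<mu> (pt base ` ?B \<union> (\<Union>c\<in>F. pt c ` Z c))" by simp
  moreover have "emeasure \<mu> (E \<union> (\<Union>c\<in>F. pt c ` Z c)) = emeasure \<mu> E"
    by (rule emeasure_Un_null_set[OF _ N0]) (simp add: s E)
  moreover have "emeasure \<mu> (pt base ` ?B \<union> (\<Union>c\<in>F. pt c ` Z c)) = emeasure \<mu> (pt base ` ?B)"
    by (rule emeasure_Un_null_set[OF im N0])
  ultimately have "emeasure \<mu> E = emeasure \<mu> (pt base ` ?B)" by (simp only:)
  also have "\<dots> = (\<integral>\<^sup>+x\<in>?B. ennreal (dens (pt base x)) \<partial>lborel)"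
    by (rule ch[OF base_in B]) auto
  finally show ?thesis .
qed

lemma riemannian_measure_eq_vol: "riemannian_measure (top_of_set M) Atl met = vol"
proof -
  let ?\<mu> = "riemannian_measure (top_of_set M) Atl met"
  have r: "is_riemannian_measure (top_of_set M) Atl met ?\<mu>"
    unfolding riemannian_measure_def by (rule someI[of _ vol]) (rule is_riemannian_vol)
  show ?thesis
  proof (rule measure_eqI)
    show "sets ?\<mu> = sets vol" using r is_riemannian_vol by (simp add: is_riemannian_measure_def)
    fix E assume "E \<in> sets ?\<mu>"
    then have E: "E \<in> sets borel_M" using r by (simp add: is_riemannian_measure_def sets_borel_M)
    show "emeasure ?\<mu> E = emeasure vol E"
      unfolding riemannian_measure_determined[OF r E] riemannian_measure_determined[OF is_riemannian_vol E] ..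
  qed
qed

lemma dens_nonneg_AE: "AE y in chart_measure base. 0 \<le> dens y"
proof -
  have "AE x in restrict_space lborel (img base). 0 \<le> dens (pt base x)"
  proof (rule AE_I2)
    fix x assume "x \<in> space (restrict_space lborel (img base))"
    then have "x \<in> img base" by (simp add: space_restrict_space)
    then show "0 \<le> dens (pt base x)"
      using dil_pos(1)[OF base_in] a_pos b_pos by (simp add: dens_def less_imp_le)
  qed
  moreover have "{y \<in> space borel_M. 0 \<le> dens y} \<in> sets borel_M" using dens_measurable by measurable
  ultimately show ?thesis
    unfolding chart_measure_def by (subst AE_distr_iff[OF pt_measurable_borel_M[OF base_in]])
qed

lemma
  assumes c: "c \<in> Atl" and F: "F \<in> borel_measurable borel_M"
  shows integral_vol: "(\<integral>y. F y \<partial>vol) = (\<integral>x. indicator (img c) x * (dens (pt c x) * F (pt c x)) \<partial>lborel)"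
    and integrable_vol: "integrable vol F \<longleftrightarrow> integrable lborel (\<lambda>x. indicator (img c) x * (dens (pt c x) * F (pt c x)))"
proof -
  have m: "F \<in> borel_measurable (chart_measure c)" "dens \<in> borel_measurable (chart_measure c)"
    using F dens_measurable by (simp_all add: chart_measure_def)
  have ae: "AE y in chart_measure c. 0 \<le> dens y" using dens_nonneg_AE unfolding chart_measure_eq[OF base_in c] .
  have dF: "(\<lambda>y. dens y * F y) \<in> borel_measurable borel_M" using F dens_measurable by simp
  have sp: "img c \<inter> space lborel \<in> sets lborel" using borel_img[OF c] by simp
  have "(\<integral>y. F y \<partial>vol) = (\<integral>y. dens y * F y \<partial>chart_measure c)"
    unfolding vol_chart[OF c] by (subst integral_density[OF m(1) m(2) ae]) simp
  also have "\<dots> = (\<integral>x. dens (pt c x) * F (pt c x) \<partial>restrict_space lborel (img c))"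
    unfolding chart_measure_def by (rule integral_distr[OF pt_measurable_borel_M[OF c] dF])
  also have "\<dots> = (\<integral>x. indicator (img c) x * (dens (pt c x) * F (pt c x)) \<partial>lborel)"
    using integral_restrict_space[OF sp, of "\<lambda>x. dens (pt c x) * F (pt c x)"] by simp
  finally show "(\<integral>y. F y \<partial>vol) = (\<integral>x. indicator (img c) x * (dens (pt c x) * F (pt c x)) \<partial>lborel)" .
  have "integrable vol F \<longleftrightarrow> integrable (chart_measure c) (\<lambda>y. dens y * F y)"
    unfolding vol_chart[OF c] by (subst integrable_density[OF m(1) m(2) ae]) simp
  also have "\<dots> \<longleftrightarrow> integrable (restrict_space lborel (img c)) (\<lambda>x. dens (pt c x) * F (pt c x))"
    unfolding chart_measure_def by (rule integrable_distr_eq[OF pt_measurable_borel_M[OF c] dF])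
  also have "\<dots> \<longleftrightarrow> integrable lborel (\<lambda>x. indicator (img c) x * (dens (pt c x) * F (pt c x)))"
    using integrable_restrict_space[OF sp, of "\<lambda>x. dens (pt c x) * F (pt c x)"] by simp
  finally show "integrable vol F \<longleftrightarrow> integrable lborel (\<lambda>x. indicator (img c) x * (dens (pt c x) * F (pt c x)))" .
qed

lemma integrable_vol_continuous:
  assumes F: "continuous_on M F"
  shows "F \<in> borel_measurable borel_M" "integrable vol (F :: _ \<Rightarrow> real)"
proof -
  show m: "F \<in> borel_measurable borel_M" unfolding borel_M_def by (rule borel_measurable_continuous_on_restrict[OF F])
  have dp: "dil p q a b y > 0" if "y \<in> M" for y
  proof -
    obtain c where c: "c \<in> Atl" "y \<in> cdom c" using finite_subatlas \<open>y \<in> M\<close> by blast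
    then have "y = pt c (coord c y)" "coord c y \<in> img c"
      using inv_into_f_f[OF chart_inj[OF smooth_manifold_torus c(1)] c(2)] by (auto simp: pt_def img_def)
    then show ?thesis using dil_pos(1)[OF c(1)] by metis
  qed
  have "continuous_on M (\<lambda>y. dens y * F y)"
    unfolding dens_def by (intro continuous_intros continuous_dil F) (use dp in force)
  then have "compact ((\<lambda>y. dens y * F y) ` M)" using compact_continuous_image compact_torus by blast
  then obtain K where K: "\<And>y. y \<in> M \<Longrightarrow> norm (dens y * F y) \<le> K"
    using compact_imp_bounded bounded_iff by (metis (mono_tags, lifting) imageI)
  have "emeasure lborel (img base) < \<infinity>" using emeasure_bounded_finite[OF bounded_img[OF base_in]] .
  have "integrable (restrict_space lborel (img base)) (\<lambda>x. dens (pt base x) * F (pt base x))"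
  proof -
    interpret finite_measure "restrict_space lborel (img base)"
      by (rule finite_measureI) (use \<open>emeasure lborel (img base) < \<infinity>\<close> borel_img[OF base_in] in
        \<open>auto simp: space_restrict_space emeasure_restrict_space\<close>)
    show "integrable (restrict_space lborel (img base)) (\<lambda>x. dens (pt base x) * F (pt base x))"
    proof (rule integrable_const_bound[where B = K])
      show "AE x in restrict_space lborel (img base). norm (dens (pt base x) * F (pt base x)) \<le> K"
      proof (rule AE_I2)
        fix x assume "x \<in> space (restrict_space lborel (img base))"
        then have "pt base x \<in> M" using pt_dom[OF base_in] dom_subset[OF base_in] by (auto simp: space_restrict_space)
        then show "norm (dens (pt base x) * F (pt base x)) \<le> K" by (rule K)
      qed
      show "(\<lambda>x. dens (pt base x) * F (pt base x)) \<in> borel_measurable (restrict_space lborel (img base))"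
        using measurable_compose[OF pt_measurable_borel_M[OF base_in], of "\<lambda>y. dens y * F y"] m dens_measurable by simp
    qed
  qed
  then show "integrable vol F"
    unfolding integrable_vol[OF base_in m]
    using integrable_restrict_space[of "img base" lborel "\<lambda>x. dens (pt base x) * F (pt base x)"] borel_img[OF base_in] by simp
qed

section \<open>Inner products with the flux\<close>

lemma sum_axes3:
  fixes F :: "'n \<Rightarrow> 'n \<Rightarrow> 'n \<Rightarrow> real"
  shows "(\<Sum>l\<in>UNIV. \<Sum>m\<in>UNIV. \<Sum>n\<in>UNIV. F l m n * eps l m n)
    = F p r q - F r p q + F r q p - F q r p + F q p r - F p q r"
proof -
  have "(\<Sum>l\<in>UNIV. \<Sum>m\<in>UNIV. \<Sum>n\<in>UNIV. F l m n * eps l m n)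
      = (\<Sum>l\<in>UNIV. \<Sum>m\<in>UNIV. F l m p * eps l m p + F l m r * eps l m r + F l m q * eps l m q)"
    by (intro sum.cong refl sum_axes) (simp add: eps_off)
  also have "\<dots> = (\<Sum>l\<in>UNIV. (F l p p * eps l p p + F l p r * eps l p r + F l p q * eps l p q)
      + (F l r p * eps l r p + F l r r * eps l r r + F l r q * eps l r q)
      + (F l q p * eps l q p + F l q r * eps l q r + F l q q * eps l q q))"
    by (intro sum.cong refl sum_axes) (simp add: eps_off)
  also have "\<dots> = F p r q - F r p q + F r q p - F q r p + F q p r - F p q r"
    by (subst sum_axes) (simp_all add: eps_def)
  finally show ?thesis .
qed

text \<open>With raised indices \<open>H\<close> has constant components: the factor \<open>2ab/\<Delta>\<^sup>2\<close> is exactly \<open>2 det g\<close>. Therefore the inner product of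
  \<open>H\<close> with a three-form is twice a component of that form (\<open>inner3_local\<close>).\<close>

lemma raise_flux:
  assumes x: "x \<in> solid p r"
  shows "(\<Sum>l\<in>UNIV. \<Sum>m\<in>UNIV. \<Sum>n\<in>UNIV. GI x i l * GI x j m * GI x k n * (cH (dsq p r x) * eps l m n)) = 2 * eps i j k"
proof -
  define s h D' F C' u v where "s = dsq p r x" and "h = cH s" and "D' = cD s / a" and "F = b / a"
    and "C' = 1 / cS s" and "u = x $ p" and "v = x $ r"
  have D: "cD s > 0" "s < 1" using cD_pos[OF dsq_bounds[OF x]] dsq_bounds[OF x] by (simp_all add: s_def)
  have c: "D' - F * s = 1 - s" using a_pos by (simp add: D'_def F_def cD_def field_simps)
  have "h * C' * D' * (1 - s) = 2"
    using D a_pos b_pos by (simp add: h_def C'_def D'_def cH_def cS_def divide_simps power2_eq_square)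
  then have e: "h * C' * D' * (D' - F * (u * u + v * v)) = 2"
    unfolding c[symmetric] by (simp add: s_def u_def v_def dsq_def power2_eq_square)
  have "(\<Sum>l\<in>UNIV. \<Sum>m\<in>UNIV. \<Sum>n\<in>UNIV. GI x i l * GI x j m * GI x k n * (cH (dsq p r x) * eps l m n))
      = (\<Sum>l\<in>UNIV. \<Sum>m\<in>UNIV. \<Sum>n\<in>UNIV. (h * (GI x i l * GI x j m * GI x k n)) * eps l m n)"
    by (simp add: h_def s_def mult_ac)
  also have "\<dots> = h * (GI x i p * GI x j r * GI x k q) - h * (GI x i r * GI x j p * GI x k q)
      + h * (GI x i r * GI x j q * GI x k p) - h * (GI x i q * GI x j r * GI x k p)
      + h * (GI x i q * GI x j p * GI x k r) - h * (GI x i p * GI x j q * GI x k r)"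
    by (rule sum_axes3)
  also have "\<dots> = h * C' * D' * (D' - F * (u * u + v * v)) * eps i j k"
    unfolding GI_def kd_def w_def eps_def PRQ_simps flat_simps s_def[symmetric] D'_def[symmetric] F_def[symmetric]
      C'_def[symmetric] u_def[symmetric] v_def[symmetric] by algebra
  finally show ?thesis unfolding e .
qed

lemma inner3_local:
  assumes g: "\<And>i j. g c x i j = G x i j" and x: "x \<in> solid p r"
    and H: "\<And>i j k. H c x i j k = cH (dsq p r x) * eps i j k"
    and T: "\<And>i j k. T c x j i k = - T c x i j k" "\<And>i j k. T c x i k j = - T c x i j k"
  shows "inner3 g T H c x = 2 * T c x p r q"
proof -
  have "inner3 g T H c x = (\<Sum>i\<in>UNIV. \<Sum>j\<in>UNIV. \<Sum>k\<in>UNIV. T c x i j k *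
      (\<Sum>l\<in>UNIV. \<Sum>m\<in>UNIV. \<Sum>n\<in>UNIV. GI x i l * GI x j m * GI x k n * (cH (dsq p r x) * eps l m n))) / fact 3"
    unfolding inner3_def H ginv_eq[of g c x, OF g x] sum_distrib_left
    by (intro arg_cong[where f = "\<lambda>z. z / fact 3"] sum.cong refl) (simp add: mult_ac)
  also have "\<dots> = (\<Sum>i\<in>UNIV. \<Sum>j\<in>UNIV. \<Sum>k\<in>UNIV. (2 * T c x i j k) * eps i j k) / 6"
    unfolding raise_flux[OF x] by (simp add: fact_numeral mult_ac)
  also have "\<dots> = 2 * T c x p r q"
  proof -
    have "T c x r p q = - T c x p r q" by (rule T(1))
    moreover have "T c x r q p = - T c x r p q" by (rule T(2))
    moreover have "T c x q r p = - T c x r q p" by (rule T(1))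
    moreover have "T c x q p r = - T c x q r p" by (rule T(2))
    moreover have "T c x p q r = - T c x p r q" by (rule T(2))
    ultimately show ?thesis unfolding sum_axes3 by simp
  qed
  finally show ?thesis .
qed

lemma inner2_local:
  assumes g: "\<And>i j. g c x i j = G x i j" and x: "x \<in> solid p r"
    and D: "\<And>i j. D c x i j = cC (dsq p r x) * (ang x i * Q j - ang x j * Q i)"
    and A: "\<And>i j. A c x j i = - A c x i j"
  shows "inner2 g A D c x = 4 * (b - a) / cD (dsq p r x) * (x $ p * A c x r q - x $ r * A c x p q)"
proof -
  define s h D' F C' u v where "s = dsq p r x" and "h = cC s" and "D' = cD s / a" and "F = b / a"
    and "C' = 1 / cS s" and "u = x $ p" and "v = x $ r"
  have pos: "cD s > 0" "s < 1" using cD_pos[OF dsq_bounds[OF x]] dsq_bounds[OF x] by (simp_all add: s_def)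
  have e: "h * D' * C' = 4 * (b - a) / cD s"
    using pos a_pos b_pos by (simp add: h_def C'_def D'_def cC_def cS_def divide_simps power2_eq_square power3_eq_cube)
  have r1: "(\<Sum>l\<in>UNIV. GI x i l * ang x l) = D' * ang x i" for i
  proof -
    have "(\<Sum>l\<in>UNIV. GI x i l * ang x l) = GI x i p * ang x p + GI x i r * ang x r + GI x i q * ang x q"
      by (rule sum_axes) (simp add: ang_def)
    also have "\<dots> = D' * ang x i"
      unfolding GI_def kd_def w_def ang_def PRQ_simps flat_simps s_def[symmetric] D'_def[symmetric] F_def[symmetric] by algebra
    finally show ?thesis .
  qed
  have r2: "(\<Sum>l\<in>UNIV. GI x i l * Q l) = C' * Q i" for i
    using sum_indicators(3)[of "GI x i"] by (simp add: mult.commute GI_def kd_def C'_def s_def)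
  have raise: "(\<Sum>l\<in>UNIV. \<Sum>m\<in>UNIV. GI x i l * GI x j m * D c x l m) = 4 * (b - a) / cD s * (ang x i * Q j - ang x j * Q i)" for i j
  proof -
    have "(\<Sum>l\<in>UNIV. \<Sum>m\<in>UNIV. GI x i l * GI x j m * D c x l m)
       = (\<Sum>l\<in>UNIV. \<Sum>m\<in>UNIV. h * ((GI x i l * ang x l) * (GI x j m * Q m)) - h * ((GI x i l * Q l) * (GI x j m * ang x m)))"
      unfolding D h_def s_def by (intro sum.cong refl) (simp add: algebra_simps)
    also have "\<dots> = h * ((\<Sum>l\<in>UNIV. GI x i l * ang x l) * (\<Sum>m\<in>UNIV. GI x j m * Q m))
        - h * ((\<Sum>l\<in>UNIV. GI x i l * Q l) * (\<Sum>m\<in>UNIV. GI x j m * ang x m))"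
      unfolding sum_subtractf sum_distrib_left[symmetric] sum_product ..
    also have "\<dots> = h * D' * C' * (ang x i * Q j - ang x j * Q i)"
      unfolding r1 r2 by (simp add: algebra_simps)
    finally show ?thesis unfolding e .
  qed
  define K where "K = 4 * (b - a) / cD s"
  have "inner2 g A D c x = (\<Sum>i\<in>UNIV. \<Sum>j\<in>UNIV. A c x i j * (\<Sum>l\<in>UNIV. \<Sum>m\<in>UNIV. GI x i l * GI x j m * D c x l m)) / 2"
    unfolding inner2_def ginv_eq[of g c x, OF g x] sum_distrib_left fact_2
    by (intro arg_cong[where f = "\<lambda>z. z / 2"] sum.cong refl) (simp add: mult_ac)
  also have "\<dots> = (\<Sum>i\<in>UNIV. \<Sum>j\<in>UNIV. A c x i j * (K * (ang x i * Q j - ang x j * Q i))) / 2"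
    unfolding raise K_def ..
  also have "(\<Sum>i\<in>UNIV. \<Sum>j\<in>UNIV. A c x i j * (K * (ang x i * Q j - ang x j * Q i)))
     = (\<Sum>i\<in>UNIV. A c x i p * (K * (ang x i * Q p - ang x p * Q i)) + A c x i r * (K * (ang x i * Q r - ang x r * Q i))
        + A c x i q * (K * (ang x i * Q q - ang x q * Q i)))"
    by (intro sum.cong refl sum_axes) (simp add: ang_def)
  also have "\<dots> = K * (x $ p * (A c x r q - A c x q r) - x $ r * (A c x p q - A c x q p))"
    by (subst sum_axes) (simp_all add: ang_def algebra_simps)
  also have "\<dots> / 2 = K * (x $ p * A c x r q - x $ r * A c x p q)"
    unfolding A[of q r] A[of q p] by (simp add: field_simps)
  finally show ?thesis unfolding K_def s_def .
qed

text \<open>The identity \<open>\<langle>d\<alpha>, H\<rangle> - \<langle>\<alpha>, d\<^sup>*H\<rangle> = \<Delta> \<langle>d(\<alpha>/\<Delta>), H\<rangle>\<close> holds pointwise: the term \<open>d(1/\<Delta>) \<and> \<alpha>\<close> on the right-hand side contributes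
  \<open>\<langle>df \<and> \<alpha>, H\<rangle> = \<langle>\<alpha>, i\<^bsub>\<nabla>f\<^esub> H\<rangle>\<close>.\<close>

lemma inner_difference_local:
  assumes S: "open S" "x \<in> S" "S \<subseteq> solid p r" and g: "\<And>i j. g c x i j = G x i j"
    and H: "\<And>i j k. H c x i j k = cH (dsq p r x) * eps i j k"
    and D: "\<And>i j. D c x i j = cC (dsq p r x) * (ang x i * Q j - ang x j * Q i)"
    and A: "\<And>y i j. y \<in> S \<Longrightarrow> A c y j i = - A c y i j"
    and dA: "\<And>i j. (\<lambda>y. A c y i j) differentiable (at x)"
    and T: "\<And>i j k. ext_deriv2 A c x j i k = - ext_deriv2 A c x i j k" "\<And>i j k. ext_deriv2 A c x i k j = - ext_deriv2 A c x i j k"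
    and T': "\<And>i j k. ext_deriv2 B c x j i k = - ext_deriv2 B c x i j k" "\<And>i j k. ext_deriv2 B c x i k j = - ext_deriv2 B c x i j k"
    and B: "\<And>y i j. y \<in> S \<Longrightarrow> B c y i j = A c y i j / cD (dsq p r y)"
  shows "inner3 g (ext_deriv2 A) H c x - inner2 g A D c x = cD (dsq p r x) * inner3 g (ext_deriv2 B) H c x"
proof -
  have x: "x \<in> solid p r" using S by auto
  have pos: "cD (dsq p r x) > 0" using cD_pos[OF dsq_bounds[OF x]] .
  have "DERIV (\<lambda>t. 1 / cD t) (dsq p r x) :> - (b - a) / (cD (dsq p r x))^2"
    using pos by (auto intro!: derivative_eq_intros cD_DERIV simp: power2_eq_square divide_simps)
  note dI = has_derivative_radial[OF this]
  have dA': "((\<lambda>y. A c y i j) has_derivative frechet_derivative (\<lambda>y. A c y i j) (at x)) (at x)" for i j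
    using dA frechet_derivative_works by blast
  have pdB: "pd k (\<lambda>y. B c y i j) x = A c x i j * (- (b - a) / (cD (dsq p r x))^2 * (2 * w x k)) + pd k (\<lambda>y. A c y i j) x * (1 / cD (dsq p r x))" for k i j
  proof -
    have "pd k (\<lambda>y. B c y i j) x = pd k (\<lambda>y. A c y i j * (1 / cD (dsq p r y))) x"
      by (rule pd_cong_open[OF S(1,2)]) (simp add: B)
    also have "\<dots> = A c x i j * (- (b - a) / (cD (dsq p r x))^2 * (2 * w x k)) + pd k (\<lambda>y. A c y i j) x * (1 / cD (dsq p r x))"
      using pd_eqI[OF has_derivative_mult[OF dA' dI], of k] unfolding pd_radial_w pd_def .
    finally show ?thesis .
  qed
  have "cD (dsq p r x) * (2 * ext_deriv2 B c x p r q) = 2 * ext_deriv2 A c x p r q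
     - 4 * (b - a) / cD (dsq p r x) * (x $ p * A c x r q - x $ r * A c x p q)"
    unfolding ext_deriv2_def pdB using pos by (simp add: divide_simps power2_eq_square) (simp add: algebra_simps)
  then show ?thesis
    using inner3_local[of g c x H "ext_deriv2 A", OF g x H T] inner3_local[of g c x H "ext_deriv2 B", OF g x H T']
      inner2_local[of g c x D A, OF g x D A[OF S(2)]] by simp
qed

text \<open>The angles on the torus factor are shared by all charts up to constants, so they do not depend on the coordinates of \<open>S\<^sup>3\<close>.\<close>

lemma jac_mixed_zero:
  assumes c: "c \<in> Atl" "d \<in> Atl" and x: "x \<in> overlap c d"
    and k: "k \<noteq> p" "k \<noteq> r" "k \<noteq> q" and i: "i = p \<or> i = r \<or> i = q"
  shows "jac c d x k i = 0"
proof -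
  note m = smooth_manifold_torus
  obtain p' q' \<theta> where c': "three_axes p' r q'" "c = torus_chart p' r q' \<theta>" "p' = p \<and> q' = q \<or> p' = q \<and> q' = p"
    using c(1) three_axes_axioms swapped by (auto simp: torus_atlas_def)
  obtain p'' q'' \<theta>' where d': "three_axes p'' r q''" "d = torus_chart p'' r q'' \<theta>'" "p'' = p \<and> q'' = q \<or> p'' = q \<and> q'' = p"
    using c(2) three_axes_axioms swapped by (auto simp: torus_atlas_def)
  interpret c: three_axes p' r q' by (rule c'(1))
  have t: "transition c d y $ k = angle_near (\<theta>' $ k) (cos (y $ k)) (sin (y $ k))"
    "off_cut (\<theta>' $ k) (cos (y $ k)) (sin (y $ k))" if y: "y \<in> overlap c d" for y
  proof -
    have "y \<in> box_around p' r \<theta>" using overlapD(1)[OF m c y] unfolding c'(2) c.img_torus_chart .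
    then have e: "pt c y = param p' r q' y" unfolding c'(2) by (rule c.pt_torus_chart)
    have "param p' r q' y \<in> patch p'' r q'' \<theta>'"
      using overlapD(3)[OF m c y] unfolding e d'(2) torus_chart_def by simp
    moreover have z: "fst (param p' r q' y) $ k = cos (y $ k)" "snd (param p' r q' y) $ k = sin (y $ k)"
      using k c'(3) by (auto simp: c.param_nth modulus_def)
    ultimately show "off_cut (\<theta>' $ k) (cos (y $ k)) (sin (y $ k))"
      using k d'(3) by (auto simp: patch_def)
    show "transition c d y $ k = angle_near (\<theta>' $ k) (cos (y $ k)) (sin (y $ k))"
      unfolding transition_def e using z k d'(2,3) by (auto simp: torus_chart_def coords_def)
  qed
  have "((\<lambda>y. cos (y $ k)) has_derivative (\<lambda>h. - sin (x $ k) * h $ k)) (at x)"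
    "((\<lambda>y. sin (y $ k)) has_derivative (\<lambda>h. cos (x $ k) * h $ k)) (at x)"
    by (auto intro!: derivative_eq_intros has_derivative_nth)
  note der = has_derivative_angle_near[OF this t(2)[OF x]]
  have "axis i (1::real) $ k = 0" using i k by (auto simp: axis_def)
  then have "pd i (\<lambda>y. angle_near (\<theta>' $ k) (cos (y $ k)) (sin (y $ k))) x = 0"
    unfolding pd_eqI[OF der] by simp
  then show ?thesis
    unfolding jac_eq_pd[OF m c x] using pd_cong_open[OF overlap_open[OF m c] x, of "\<lambda>y. transition c d y $ k"] t(1) by simp
qed

end

section \<open>Independence of the chart\<close>

definition alternating :: "('n \<Rightarrow> 'n \<Rightarrow> 'n \<Rightarrow> real) \<Rightarrow> bool" where
  "alternating t \<longleftrightarrow> (\<forall>i j k. t j i k = - t i j k \<and> t i k j = - t i j k)"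

lemma alternatingD:
  assumes "alternating t"
  shows "t j i k = - t i j k" "t i k j = - t i j k"
  using assms unfolding alternating_def by blast+

lemma alternating_ext_deriv2:
  assumes S: "open S" "x \<in> S" and A: "\<And>y i j. y \<in> S \<Longrightarrow> A c y j i = - A c y i j"
    and d: "\<And>i j. (\<lambda>y. A c y i j) differentiable (at x)"
  shows "alternating (ext_deriv2 A c x)"
proof -
  have "pd k (\<lambda>y. A c y j i) x = - pd k (\<lambda>y. A c y i j) x" for i j k
  proof -
    have "pd k (\<lambda>y. A c y j i) x = pd k (\<lambda>y. - A c y i j) x" by (rule pd_cong_open[OF S A])
    also have "\<dots> = - pd k (\<lambda>y. A c y i j) x"
      using pd_eqI[OF has_derivative_minus[OF d[unfolded frechet_derivative_works]]] by (simp add: pd_def)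
    finally show ?thesis .
  qed
  note flip = this
  show ?thesis
    unfolding alternating_def
  proof (intro allI conjI)
    fix i j k
    show "ext_deriv2 A c x j i k = - ext_deriv2 A c x i j k"
      unfolding ext_deriv2_def using flip[of k i j] by linarith
    show "ext_deriv2 A c x i k j = - ext_deriv2 A c x i j k"
      unfolding ext_deriv2_def using flip[of i j k] by linarith
  qed
qed

text \<open>The chart selected in \<open>scalar_at\<close> is irrelevant for expressions that agree on overlaps.\<close>

lemma scalar_at_chart:
  assumes M: "smooth_manifold X A" and c: "c \<in> A" "x \<in> img c"
    and inv: "\<And>d. d \<in> A \<Longrightarrow> x \<in> overlap c d \<Longrightarrow> s d (transition c d x) = s c x"
  shows "scalar_at A s (pt c x) = s c x"
proof -
  have p: "coord c (pt c x) = x" "pt c x \<in> cdom c"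
    using c(2) by (auto simp: pt_def img_def f_inv_into_f inv_into_into)
  define d where "d = (SOME d. d \<in> A \<and> pt c x \<in> cdom d)"
  have d: "d \<in> A" "pt c x \<in> cdom d"
    unfolding d_def using someI[of "\<lambda>d. d \<in> A \<and> pt c x \<in> cdom d" c] c p by auto
  have "x \<in> overlap c d" unfolding overlap_def using p d by (metis IntI imageI)
  then have "s d (transition c d x) = s c x" by (rule inv[OF d(1)])
  then show ?thesis by (simp add: scalar_at_def d_def[symmetric] transition_def)
qed

context two_weights begin

text \<open>In three dimensions alternating tensors are multiples of the volume form.\<close>

lemma alternating_eps:
  assumes t: "alternating t" and k: "k = p \<or> k = r \<or> k = q" "l = p \<or> l = r \<or> l = q" "m = p \<or> m = r \<or> m = q"
  shows "t k l m = t p r q * eps k l m"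
proof -
  have a: "t j i k = - t i j k" "t i k j = - t i j k" for i j k using t unfolding alternating_def by blast+
  have z: "t i i k = 0" "t k i i = 0" "t i k i = 0" for i k
  proof -
    show 1: "t i i k = 0" "t k i i = 0" using a(1)[of i i k] a(2)[of k i i] by simp_all
    show "t i k i = 0" using a(2)[of i k i] 1(1) by simp
  qed
  have "t r p q = - t p r q" by (rule a(1))
  moreover have "t r q p = - t r p q" by (rule a(2))
  moreover have "t q r p = - t r q p" by (rule a(1))
  moreover have "t q p r = - t q r p" by (rule a(2))
  moreover have "t p q r = - t p r q" by (rule a(2))
  ultimately have "t r p q = - t p r q" "t r q p = t p r q" "t q r p = - t p r q" "t q p r = t p r q" "t p q r = - t p r q"
    by simp_all
  note p = this
  show ?thesis
    using k by (elim disjE; simp add: z p eps_def)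
qed

lemma chart_locale:
  assumes c: "c \<in> Atl"
  obtains p' q' a' b' \<theta> where "two_weights p' r q' a' b'" "c = torus_chart p' r q' \<theta>" "img c = box_around p' r \<theta>"
    "metric_form p' r q' a' b' = metric_form p r q a b" "flux_form p' q' a' b' = flux_form p q a b"
    "coflux_form p' q' a' b' = coflux_form p q a b" "dil p' q' a' b' = dil p q a b" "a' * b' = a * b"
    "p' = p \<and> q' = q \<or> p' = q \<and> q' = p"
proof (rule atlas_weights[OF c])
  fix p' q' a' b' \<theta>
  assume h: "two_weights p' r q' a' b'" "c = torus_chart p' r q' \<theta>"
    "metric_form p' r q' a' b' = metric_form p r q a b" "flux_form p' q' a' b' = flux_form p q a b"
    "coflux_form p' q' a' b' = coflux_form p q a b"
    "p' = p \<and> q' = q \<and> a' = a \<and> b' = b \<or> p' = q \<and> q' = p \<and> a' = b \<and> b' = a"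
  interpret c: two_weights p' r q' a' b' by (rule h(1))
  have "img c = box_around p' r \<theta>" unfolding h(2) by (rule c.img_torus_chart)
  moreover have "dil p' q' a' b' = dil p q a b" using h(6) by (auto simp: dil_swap)
  moreover have "a' * b' = a * b" using h(6) by (auto simp: mult.commute)
  moreover have "p' = p \<and> q' = q \<or> p' = q \<and> q' = p" using h(6) by blast
  ultimately show thesis using that[OF h(1,2) _ h(3,4,5)] by blast
qed

text \<open>By \<open>inner3_local\<close> both sides are twice the component in the directions of \<open>S\<^sup>3\<close>. By \<open>jac_mixed_zero\<close> this component changes
  between charts by a factor, a \<open>3 \<times> 3\<close> minor \<open>E\<close> of the Jacobian matrix, which is the same for every three-form. Applied to \<open>H\<close> itself, whose
  component \<open>2ab/\<Delta>\<^sup>2\<close> is the same in both charts, this shows \<open>E = 1\<close>.\<close>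

lemma inner3_invariant:
  assumes c: "c \<in> Atl" "d \<in> Atl" and x: "x \<in> overlap c d"
    and law: "\<And>i j k. T c x i j k = (\<Sum>l\<in>UNIV. \<Sum>m\<in>UNIV. \<Sum>n\<in>UNIV.
       jac c d x l i * jac c d x m j * jac c d x n k * T d (transition c d x) l m n)"
    and alt: "alternating (T c x)" "alternating (T d (transition c d x))"
  shows "inner3 met T flux c x = inner3 met T flux d (transition c d x)"
proof -
  let ?y = "transition c d x"
  note m = smooth_manifold_torus and o = overlapD[OF smooth_manifold_torus c x]
  obtain p1 q1 a1 b1 \<theta>1 where c1: "two_weights p1 r q1 a1 b1" "c = torus_chart p1 r q1 \<theta>1" "img c = box_around p1 r \<theta>1"
    and e1: "metric_form p1 r q1 a1 b1 = metric_form p r q a b" "flux_form p1 q1 a1 b1 = flux_form p q a b"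
    "dil p1 q1 a1 b1 = dil p q a b" "a1 * b1 = a * b" "p1 = p \<and> q1 = q \<or> p1 = q \<and> q1 = p"
    by (rule chart_locale[OF c(1)]) (rule that; assumption)
  obtain p2 q2 a2 b2 \<theta>2 where c2: "two_weights p2 r q2 a2 b2" "d = torus_chart p2 r q2 \<theta>2" "img d = box_around p2 r \<theta>2"
    and e2: "metric_form p2 r q2 a2 b2 = metric_form p r q a b" "flux_form p2 q2 a2 b2 = flux_form p q a b"
    "dil p2 q2 a2 b2 = dil p q a b" "a2 * b2 = a * b" "p2 = p \<and> q2 = q \<or> p2 = q \<and> q2 = p"
    by (rule chart_locale[OF c(2)]) (rule that; assumption)
  interpret c: two_weights p1 r q1 a1 b1 by (rule c1(1))
  interpret d: two_weights p2 r q2 a2 b2 by (rule c2(1))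
  have xb: "x \<in> box_around p1 r \<theta>1" using o(1) c1(3) by simp
  have yb: "?y \<in> box_around p2 r \<theta>2" using o(4) c2(3) by simp
  have xs: "x \<in> solid p1 r" and ys: "?y \<in> solid p2 r" using xb yb c.box_solid d.box_solid by blast+
  have Hc: "flux c x i j k = c.cH (dsq p1 r x) * c.eps i j k" "met c x i j = c.G x i j" for i j k
    using c.components[OF xb] unfolding e1 c1(2) by blast+
  have Hd: "flux d ?y i j k = d.cH (dsq p2 r ?y) * d.eps i j k" "met d ?y i j = d.G ?y i j" for i j k
    using d.components[OF yb] unfolding e2 c2(2) by blast+
  have cH: "c.cH (dsq p1 r x) = 2 * (a * b) / (dil p q a b (pt c x))^2"
    using c.frame_products(8)[OF xb] unfolding e1(3) c1(2) c.cH_def by (simp add: e1(4) mult.assoc)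
  have dH: "d.cH (dsq p2 r ?y) = 2 * (a * b) / (dil p q a b (pt c x))^2"
    using d.frame_products(8)[OF yb] unfolding e2(3) c2(2)[symmetric] d.cH_def o(6) by (simp add: e2(4) mult.assoc)
  have i1: "inner3 met T flux c x = 2 * T c x p1 r q1"
    by (rule c.inner3_local[where g = met and H = flux and T = T and c = c and x = x, OF Hc(2) xs Hc(1)]) (rule alternatingD[OF alt(1)])+
  have i2: "inner3 met T flux d ?y = 2 * T d ?y p2 r q2"
    by (rule d.inner3_local[where g = met and H = flux and T = T and c = d and x = ?y, OF Hd(2) ys Hd(1)]) (rule alternatingD[OF alt(2)])+
  define E where "E = (\<Sum>l\<in>UNIV. \<Sum>m\<in>UNIV. \<Sum>n\<in>UNIV. jac c d x l p1 * jac c d x m r * jac c d x n q1 * d.eps l m n)"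
  have contr: "t1 p1 r q1 = t2 p2 r q2 * E"
    if l: "\<And>i j k. t1 i j k = (\<Sum>l\<in>UNIV. \<Sum>m\<in>UNIV. \<Sum>n\<in>UNIV. jac c d x l i * jac c d x m j * jac c d x n k * t2 l m n)"
      and al: "alternating t2" for t1 t2
  proof -
    have "jac c d x l p1 * jac c d x m r * jac c d x n q1 * t2 l m n
        = t2 p2 r q2 * (jac c d x l p1 * jac c d x m r * jac c d x n q1 * d.eps l m n)" for l m n
    proof (cases "(l = p2 \<or> l = r \<or> l = q2) \<and> (m = p2 \<or> m = r \<or> m = q2) \<and> (n = p2 \<or> n = r \<or> n = q2)")
      case True
      then have "t2 l m n = t2 p2 r q2 * d.eps l m n" using d.alternating_eps[OF al] by blast
      then show ?thesis by simp
    next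
      case False
      have J0: "jac c d x k i = 0" if "\<not> (k = p2 \<or> k = r \<or> k = q2)" "i = p1 \<or> i = r \<or> i = q1" for k i
        by (rule jac_mixed_zero[OF c x]) (use that e1(5) e2(5) in auto)
      have "jac c d x l p1 = 0 \<or> jac c d x m r = 0 \<or> jac c d x n q1 = 0"
        using False J0[of l p1] J0[of m r] J0[of n q1] by blast
      then show ?thesis by auto
    qed
    note each = this
    show ?thesis unfolding l E_def sum_distrib_left each ..
  qed
  have "flux c x p1 r q1 = flux d ?y p2 r q2 * E"
  proof (rule contr)
    show "flux c x i j k = (\<Sum>l\<in>UNIV. \<Sum>m\<in>UNIV. \<Sum>n\<in>UNIV. jac c d x l i * jac c d x m j * jac c d x n k * flux d ?y l m n)" for i j k
      using closed_flux c x unfolding closed_three_form_def three_form_def smooth_tensor3_def by blast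
    show "alternating (flux d ?y)"
      using chart_fields(8)[OF c(2) o(4)] unfolding alternating_def by blast
  qed
  then have "c.cH (dsq p1 r x) = d.cH (dsq p2 r ?y) * E" unfolding Hc Hd c.eps_def d.eps_def by simp
  moreover have "d.cH (dsq p2 r ?y) \<noteq> 0"
    unfolding dH using dil_pos(1)[OF c(1) o(1)] a_pos b_pos by simp
  ultimately have "E = 1" using cH dH by simp
  then have "T c x p1 r q1 = T d ?y p2 r q2" using contr[OF law alt(2)] by simp
  then show ?thesis using i1 i2 by simp
qed

definition scaled :: "('n ambient \<Rightarrow> real) \<Rightarrow> ('n ambient, 'n) tensor2 \<Rightarrow> ('n ambient, 'n) tensor2" where
  "scaled f A c x i j = f (pt c x) * A c x i j"

text \<open>The function whose integral over \<open>M\<close> is to vanish. In a chart it is, up to the density, a curl of the components of \<open>f A\<close>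
  (\<open>curl_local\<close>).\<close>

definition curl :: "('n ambient \<Rightarrow> real) \<Rightarrow> ('n ambient, 'n) tensor2 \<Rightarrow> ('n ambient, 'n) chart \<Rightarrow> real^'n \<Rightarrow> real" where
  "curl f A c x = dil p q a b (pt c x) * inner3 met (ext_deriv2 (scaled f A)) flux c x"

text \<open>Class \<open>C\<^sup>1\<close> suffices for the cutoff functions, since only first derivatives enter.\<close>

definition C1_multiplier :: "('n ambient \<Rightarrow> real) \<Rightarrow> bool" where
  "C1_multiplier f \<longleftrightarrow> (\<forall>c\<in>Atl. (\<forall>x\<in>img c. (\<lambda>y. f (pt c y)) differentiable (at x)) \<and>
     (\<forall>k. continuous_on (img c) (pd k (\<lambda>y. f (pt c y)))))"

lemma
  assumes "two_form Atl A"
  shows two_form_smooth: "c \<in> Atl \<Longrightarrow> smooth_on (img c) (\<lambda>x. A c x i j)"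
    and two_form_law: "c \<in> Atl \<Longrightarrow> d \<in> Atl \<Longrightarrow> x \<in> overlap c d \<Longrightarrow>
      A c x i j = (\<Sum>k\<in>UNIV. \<Sum>l\<in>UNIV. jac c d x k i * jac c d x l j * A d (transition c d x) k l)"
    and two_form_antisym: "c \<in> Atl \<Longrightarrow> x \<in> img c \<Longrightarrow> A c x j i = - A c x i j"
  using assms unfolding two_form_def smooth_tensor2_def by blast+

context
  fixes f :: "'n ambient \<Rightarrow> real" and A :: "('n ambient, 'n) tensor2"
  assumes f: "C1_multiplier f" and A: "two_form Atl A"
begin

lemma scaled_derivative:
  assumes c: "c \<in> Atl" "x \<in> img c"
  shows "((\<lambda>y. scaled f A c y i j) has_derivative (\<lambda>h. f (pt c x) * frechet_derivative (\<lambda>y. A c y i j) (at x) h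
     + frechet_derivative (\<lambda>y. f (pt c y)) (at x) h * A c x i j)) (at x)"
proof -
  have "(\<lambda>y. f (pt c y)) differentiable (at x)" using f c by (simp add: C1_multiplier_def)
  then show ?thesis
    unfolding scaled_def frechet_derivative_works
    by (rule has_derivative_mult[OF _ smooth_on_has_derivative[OF two_form_smooth[OF A c(1)] c(2)]])
qed

lemma scaled_differentiable: "c \<in> Atl \<Longrightarrow> x \<in> img c \<Longrightarrow> (\<lambda>y. scaled f A c y i j) differentiable (at x)"
  using scaled_derivative differentiable_def by blast

lemma pd_scaled:
  assumes c: "c \<in> Atl" "x \<in> img c"
  shows "pd k (\<lambda>y. scaled f A c y i j) x = f (pt c x) * pd k (\<lambda>y. A c y i j) x + pd k (\<lambda>y. f (pt c y)) x * A c x i j"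
  using pd_eqI[OF scaled_derivative[OF c]] by (simp add: pd_def)

lemma continuous_pd_scaled:
  assumes c: "c \<in> Atl"
  shows "continuous_on (img c) (pd k (\<lambda>y. scaled f A c y i j))"
proof -
  have fc: "continuous_on (img c) (\<lambda>x. f (pt c x))"
    using f c unfolding C1_multiplier_def by (auto intro!: continuous_at_imp_continuous_on differentiable_imp_continuous_within)
  have fd: "continuous_on (img c) (pd k (\<lambda>y. f (pt c y)))" using f c by (simp add: C1_multiplier_def)
  have Ac: "continuous_on (img c) (\<lambda>x. A c x i j)" "continuous_on (img c) (pd k (\<lambda>y. A c y i j))"
    by (rule smooth_on_continuous_on[OF two_form_smooth[OF A c]],
        rule smooth_on_continuous_on[OF smooth_on_pd[OF two_form_smooth[OF A c]]])
  have "continuous_on (img c) (\<lambda>x. f (pt c x) * pd k (\<lambda>y. A c y i j) x + pd k (\<lambda>y. f (pt c y)) x * A c x i j)"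
    by (intro continuous_on_add continuous_on_mult fc fd Ac)
  then show ?thesis by (rule continuous_on_eq) (rule pd_scaled[OF c, symmetric])
qed

lemma scaled_antisym: "c \<in> Atl \<Longrightarrow> x \<in> img c \<Longrightarrow> scaled f A c x j i = - scaled f A c x i j"
  unfolding scaled_def using two_form_antisym[OF A, of c x j i] by simp

lemma alternating_scaled:
  assumes c: "c \<in> Atl" "x \<in> img c"
  shows "alternating (ext_deriv2 (scaled f A) c x)"
proof (rule alternating_ext_deriv2[where S = "img c"])
  show "open (img c)" by (rule chart_img_open[OF smooth_manifold_torus c(1)])
  show "scaled f A c y j i = - scaled f A c y i j" if "y \<in> img c" for y i j
    by (rule scaled_antisym[OF c(1) that])
qed (rule c scaled_differentiable[OF c])+

lemma curl_local:
  assumes c: "two_weights p' r q' a' b'" "c = torus_chart p' r q' \<theta>" "c \<in> Atl"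
    and e: "metric_form p' r q' a' b' = metric_form p r q a b" "flux_form p' q' a' b' = flux_form p q a b"
    and x: "x \<in> img c"
  shows "curl f A c x = dil p q a b (pt c x) * (2 * ext_deriv2 (scaled f A) c x p' r q')"
proof -
  interpret c: two_weights p' r q' a' b' by (rule c(1))
  have xb: "x \<in> box_around p' r \<theta>" using x unfolding c(2) c.img_torus_chart .
  have "inner3 met (ext_deriv2 (scaled f A)) flux c x = 2 * ext_deriv2 (scaled f A) c x p' r q'"
  proof (rule c.inner3_local)
    show "met c x i j = c.G x i j" "flux c x i j k = c.cH (dsq p' r x) * c.eps i j k" for i j k
      using c.components[OF xb] unfolding e c(2) by blast+
    show "x \<in> solid p' r" using xb c.box_solid by blast
  qed (rule alternatingD[OF alternating_scaled[OF c(3) x]])+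
  then show ?thesis by (simp add: curl_def)
qed

lemma curl_invariant:
  assumes c: "c \<in> Atl" "d \<in> Atl" and x: "x \<in> overlap c d"
  shows "curl f A d (transition c d x) = curl f A c x"
proof -
  note m = smooth_manifold_torus and o = overlapD[OF smooth_manifold_torus c x]
  have "inner3 met (ext_deriv2 (scaled f A)) flux c x = inner3 met (ext_deriv2 (scaled f A)) flux d (transition c d x)"
  proof (rule inner3_invariant[OF c x])
    show "alternating (ext_deriv2 (scaled f A) c x)" "alternating (ext_deriv2 (scaled f A) d (transition c d x))"
      using alternating_scaled c o by auto
    show "ext_deriv2 (scaled f A) c x i j k = (\<Sum>l\<in>UNIV. \<Sum>m\<in>UNIV. \<Sum>n\<in>UNIV.
       jac c d x l i * jac c d x m j * jac c d x n k * ext_deriv2 (scaled f A) d (transition c d x) l m n)" for i j k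
      unfolding ext_deriv2_def
    proof (rule exterior_derivative_pullback[OF overlap_open[OF m c] x transition_smooth(2)[OF m c],
          where J = "jac c d" and \<alpha> = "\<lambda>j k y. scaled f A c y j k" and \<beta> = "\<lambda>l m y. scaled f A d y l m"])
      show "jac c d y l i = pd i (\<lambda>y. transition c d y $ l) y" if "y \<in> overlap c d" for y l i
        by (rule jac_eq_pd[OF m c that])
      show "scaled f A c y j k = (\<Sum>l\<in>UNIV. \<Sum>m\<in>UNIV. jac c d y l j * jac c d y m k * scaled f A d (transition c d y) l m)"
        if y: "y \<in> overlap c d" for y j k
        unfolding scaled_def two_form_law[OF A c y] overlapD(6)[OF m c y] by (simp add: sum_distrib_left mult_ac)
      show "(\<lambda>y. scaled f A d y l m) differentiable at (transition c d x)" for l m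
        by (rule scaled_differentiable[OF c(2) o(4)])
      show "scaled f A d (transition c d x) m l = - scaled f A d (transition c d x) l m" for l m
        by (rule scaled_antisym[OF c(2) o(4)])
    qed
  qed
  then show ?thesis unfolding curl_def o(6) by simp
qed

lemma scalar_at_curl:
  "c \<in> Atl \<Longrightarrow> x \<in> img c \<Longrightarrow> scalar_at Atl (curl f A) (pt c x) = curl f A c x"
  by (rule scalar_at_chart[OF smooth_manifold_torus]) (auto intro: curl_invariant)

text \<open>Continuity gives measurability and, on the compact manifold, integrability.\<close>

lemma continuous_curl: "continuous_on M (scalar_at Atl (curl f A))"
proof -
  let ?F = "scalar_at Atl (curl f A)"
  have "continuous (at y within M) ?F" if y: "y \<in> M" for y
  proof -
    obtain c where c: "c \<in> Atl" "y \<in> cdom c" using finite_subatlas y by blast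
    obtain p1 q1 a1 b1 \<theta>1 where c1: "two_weights p1 r q1 a1 b1" "c = torus_chart p1 r q1 \<theta>1"
      and e1: "metric_form p1 r q1 a1 b1 = metric_form p r q a b" "flux_form p1 q1 a1 b1 = flux_form p q a b"
      by (rule chart_locale[OF c(1)]) (rule that; assumption)
    have "continuous_on (img c) (\<lambda>x. dil p q a b (pt c x) * (2 * ext_deriv2 (scaled f A) c x p1 r q1))"
      unfolding ext_deriv2_def
      by (intro continuous_intros continuous_pd_scaled[OF c(1)] smooth_on_continuous_on[OF smooth_pt_atlas[OF c(1)]]
        continuous_on_compose2[OF continuous_dil[of UNIV]]) auto
    then have cc: "continuous_on (img c) (curl f A c)"
      by (rule continuous_on_eq) (rule curl_local[OF c1 c(1) e1, symmetric])
    obtain T where T: "open T" "cdom c = M \<inter> T" using chart_dom_open[OF smooth_manifold_torus c(1)] openin_open by blast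
    have "subtopology (top_of_set M) (cdom c) = top_of_set (cdom c)"
      using T(2) by (simp add: subtopology_subtopology Int_absorb1)
    then have k: "continuous_on (cdom c) (coord c)"
      using chart_homeomorphic[OF smooth_manifold_torus c(1)] homeomorphic_imp_continuous_map
      by (metis continuous_map_in_subtopology continuous_map_iff_continuous)
    have "continuous_on (cdom c) (\<lambda>y. curl f A c (coord c y))"
      by (rule continuous_on_compose2[OF cc k]) (auto simp: img_def)
    moreover have "?F y = curl f A c (coord c y)" if "y \<in> cdom c" for y
      using scalar_at_curl[OF c(1), of "coord c y"] inv_into_f_f[OF chart_inj[OF smooth_manifold_torus c(1)] that] that
      by (simp add: pt_def img_def)
    ultimately have "continuous_on (cdom c) ?F" by (rule continuous_on_eq[OF _ sym])
    then have "continuous (at y within cdom c) ?F" using c(2) by (simp add: continuous_on_eq_continuous_within)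
    moreover have "at y within cdom c = at y within M"
      by (rule at_within_nhd[of y T]) (use T c(2) in auto)
    ultimately show ?thesis by simp
  qed
  then show ?thesis by (simp add: continuous_on_eq_continuous_within)
qed

end

end

section \<open>Integration by parts\<close>

lemma lborel_integral_translate:
  fixes f :: "'a::euclidean_space \<Rightarrow> real"
  assumes f: "f \<in> borel_measurable borel"
  shows "(\<integral>x. f (x + c) \<partial>lborel) = (\<integral>x. f x \<partial>lborel)"
    and "integrable lborel (\<lambda>x. f (x + c)) \<longleftrightarrow> integrable lborel f"
proof -
  have d: "distr lborel borel (\<lambda>x. x + c) = lborel"
    using lborel_distr_plus[of c] by (simp add: add.commute[of _ c])
  have m: "(\<lambda>x. x + c) \<in> measurable lborel borel" by simp
  show "(\<integral>x. f (x + c) \<partial>lborel) = (\<integral>x. f x \<partial>lborel)"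
    using integral_distr[OF m f] by (simp add: d)
  show "integrable lborel (\<lambda>x. f (x + c)) \<longleftrightarrow> integrable lborel f"
    using integrable_distr_eq[OF m f] by (simp add: d)
qed

text \<open>Fubini's theorem for one distinguished coordinate, without splitting \<open>\<real>\<^sup>n\<close> as a product: \<open>h\<close> is integrated against the indicator of
  \<open>0 \<le> x\<^sub>k - t \<le> 1\<close> over \<open>(x, t)\<close>, once in each order. Integrating over \<open>t\<close> first returns the integral of \<open>h\<close>; shifting \<open>x\<close> by
  \<open>t\<close> in direction \<open>k\<close> and then integrating over \<open>t\<close> first gives line integrals.\<close>

lemma integral_zero_of_lines:
  fixes h :: "real^'n::finite \<Rightarrow> real"
  assumes h: "integrable lborel h" and lines: "\<And>x. (\<integral>t. h (x + t *\<^sub>R axis k 1) \<partial>lborel) = 0"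
  shows "(\<integral>x. h x \<partial>lborel) = 0"
proof -
  let ?v = "axis k (1::real) :: real^'n" and ?I = "indicator {0..1::real} :: real \<Rightarrow> real"
  have hm [measurable]: "h \<in> borel_measurable borel" using h by (simp add: borel_measurable_integrable[of lborel, simplified])
  have vk: "?v $ k = 1" by simp
  have km [measurable]: "(\<lambda>x::real^'n. x $ k) \<in> borel_measurable borel"
    by (intro borel_measurable_continuous_onI continuous_intros)
  have am [measurable]: "(\<lambda>z::real \<times> (real^'n). snd z + fst z *\<^sub>R ?v) \<in> borel_measurable borel"
    by (intro borel_measurable_continuous_onI continuous_intros)
  have amp: "(\<lambda>z::real \<times> (real^'n). snd z + fst z *\<^sub>R ?v) \<in> measurable (lborel \<Otimes>\<^sub>M lborel) borel"
    using am by (simp add: lborel_prod)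
  have I1: "(\<integral>t. ?I (c - t) \<partial>lborel) = 1" "integrable lborel (\<lambda>t. ?I (c - t))" for c :: real
  proof -
    have "?I (c - t) = indicator {c - 1..c} t" for t by (auto simp: indicator_def)
    then show "(\<integral>t. ?I (c - t) \<partial>lborel) = 1" "integrable lborel (\<lambda>t. ?I (c - t))" by simp_all
  qed
  define g1 where "g1 x t = h x * ?I (x $ k - t)" for x t
  define g2 where "g2 t x = h (x + t *\<^sub>R ?v) * ?I (x $ k)" for t and x :: "real^'n"
  have tr: "(\<integral>x. F (h x) * ?I (x $ k - t) \<partial>lborel) = (\<integral>x. F (h (x + t *\<^sub>R ?v)) * ?I (x $ k) \<partial>lborel)"
    if F: "F \<in> borel_measurable borel" for t and F :: "real \<Rightarrow> real"
  proof -
    have m: "(\<lambda>x. F (h x) * ?I (x $ k - t)) \<in> borel_measurable borel" using F by measurable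
    show ?thesis using lborel_integral_translate(1)[OF m, of "t *\<^sub>R ?v"] by simp
  qed
  have i1: "integrable (lborel \<Otimes>\<^sub>M lborel) (case_prod g1)"
  proof (rule lborel_pair.Fubini_integrable)
    show "case_prod g1 \<in> borel_measurable (lborel \<Otimes>\<^sub>M lborel)" unfolding g1_def by measurable
    have "(\<integral>t. norm (case_prod g1 (x, t)) \<partial>lborel) = \<bar>h x\<bar>" for x
      using I1(1)[of "x $ k"] by (simp add: g1_def abs_mult)
    then show "integrable lborel (\<lambda>x. \<integral>t. norm (case_prod g1 (x, t)) \<partial>lborel)" using h by simp
    show "AE x in lborel. integrable lborel (\<lambda>t. case_prod g1 (x, t))"
      using I1(2) by (simp add: g1_def)
  qed
  have i2: "integrable (lborel \<Otimes>\<^sub>M lborel) (case_prod g2)"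
  proof (rule lborel_pair.Fubini_integrable)
    show "case_prod g2 \<in> borel_measurable (lborel \<Otimes>\<^sub>M lborel)"
      unfolding g2_def case_prod_beta using measurable_compose[OF amp hm] by measurable
    have "integrable lborel (\<lambda>t. \<integral>x. \<bar>g1 x t\<bar> \<partial>lborel)"
    proof (rule lborel_pair.integrable_snd)
      have "(\<lambda>(x, t). \<bar>g1 x t\<bar>) = (\<lambda>z. \<bar>case_prod g1 z\<bar>)" by auto
      then show "integrable (lborel \<Otimes>\<^sub>M lborel) (\<lambda>(x, t). \<bar>g1 x t\<bar>)" using integrable_abs[OF i1] by simp
    qed
    then have "integrable lborel (\<lambda>t. \<integral>x. \<bar>h x\<bar> * ?I (x $ k - t) \<partial>lborel)" by (simp add: g1_def abs_mult)
    then have "integrable lborel (\<lambda>t. \<integral>x. \<bar>h (x + t *\<^sub>R ?v)\<bar> * ?I (x $ k) \<partial>lborel)" by (simp add: tr[of abs])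
    then show "integrable lborel (\<lambda>t. \<integral>x. norm (case_prod g2 (t, x)) \<partial>lborel)"
      by (simp add: g2_def abs_mult)
    have "integrable lborel (\<lambda>x. g2 t x)" for t
    proof -
      have "integrable lborel (\<lambda>x. h (x + t *\<^sub>R ?v))" using lborel_integral_translate(2)[OF hm] h by simp
      then show ?thesis unfolding g2_def
        by (rule Bochner_Integration.integrable_bound) (auto simp: indicator_def)
    qed
    then show "AE t in lborel. integrable lborel (\<lambda>x. case_prod g2 (t, x))" by simp
  qed
  have "(\<integral>x. h x \<partial>lborel) = (\<integral>x. (\<integral>t. g1 x t \<partial>lborel) \<partial>lborel)"
    using I1(1) by (simp add: g1_def)
  also have "\<dots> = (\<integral>t. (\<integral>x. g1 x t \<partial>lborel) \<partial>lborel)"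
    by (rule lborel_pair.Fubini_integral[OF i1, symmetric])
  also have "\<dots> = (\<integral>t. (\<integral>x. g2 t x \<partial>lborel) \<partial>lborel)"
    unfolding g1_def g2_def using tr[of "\<lambda>x. x"] by simp
  also have "\<dots> = (\<integral>x. (\<integral>t. g2 t x \<partial>lborel) \<partial>lborel)"
    by (rule lborel_pair.Fubini_integral[OF i2, symmetric])
  also have "\<dots> = 0" unfolding g2_def using lines by simp
  finally show ?thesis .
qed

text \<open>The fundamental theorem of calculus on each line parallel to the \<open>k\<close>-th axis.\<close>

lemma integral_partial_over_box:
  fixes F :: "real^'n::finite \<Rightarrow> real"
  assumes d: "\<And>x. F differentiable (at x)" and c: "continuous_on UNIV (pd k F)"
    and ends: "\<And>x y. x $ k = l $ k \<Longrightarrow> y $ k = u $ k \<Longrightarrow> (\<And>j. j \<noteq> k \<Longrightarrow> x $ j = y $ j) \<Longrightarrow> F x = F y"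
    and lu: "l $ k \<le> u $ k"
  shows "integrable lborel (\<lambda>x. indicator (cbox l u) x * pd k F x)"
    "(\<integral>x. indicator (cbox l u) x * pd k F x \<partial>lborel) = 0"
proof -
  show i: "integrable lborel (\<lambda>x. indicator (cbox l u) x * pd k F x)"
    using borel_integrable_compact[OF compact_cbox continuous_on_subset[OF c subset_UNIV], of l u]
    by (simp add: mult.commute if_distrib indicator_def cong: if_cong)
  show "(\<integral>x. indicator (cbox l u) x * pd k F x \<partial>lborel) = 0"
  proof (rule integral_zero_of_lines[OF i])
    fix x
    let ?v = "axis k (1::real) :: real^'n"
    let ?a = "l $ k - x $ k" and ?b = "u $ k - x $ k"
    show "(\<integral>t. indicator (cbox l u) (x + t *\<^sub>R ?v) * pd k F (x + t *\<^sub>R ?v) \<partial>lborel) = 0"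
    proof (cases "\<forall>j. j \<noteq> k \<longrightarrow> l $ j \<le> x $ j \<and> x $ j \<le> u $ j")
      case False
      then have "x + t *\<^sub>R ?v \<notin> cbox l u" for t by (auto simp: mem_box_cart axis_def)
      then show ?thesis by simp
    next
      case True
      have m: "x + t *\<^sub>R ?v \<in> cbox l u \<longleftrightarrow> t \<in> {?a..?b}" for t
      proof -
        have c: "(x + t *\<^sub>R ?v) $ j = (if j = k then x $ k + t else x $ j)" for j by (auto simp: axis_def)
        show ?thesis unfolding mem_box_cart c using True by (auto split: if_splits)
      qed
      have dF: "((\<lambda>t. F (x + t *\<^sub>R ?v)) has_real_derivative pd k F (x + t *\<^sub>R ?v)) (at t)" for t
        unfolding pd_def by (rule has_derivative_along_line) (use d frechet_derivative_works in blast)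
      have cF: "isCont (\<lambda>t. pd k F (x + t *\<^sub>R ?v)) t" for t
        by (rule continuous_on_interior[of UNIV]) (auto intro!: continuous_on_compose2[OF c] continuous_intros)
      have "(\<integral>t. indicator (cbox l u) (x + t *\<^sub>R ?v) * pd k F (x + t *\<^sub>R ?v) \<partial>lborel)
          = (\<integral>t. pd k F (x + t *\<^sub>R ?v) * indicator {?a..?b} t \<partial>lborel)"
        by (intro Bochner_Integration.integral_cong) (auto simp: indicator_def m)
      also have "\<dots> = F (x + ?b *\<^sub>R ?v) - F (x + ?a *\<^sub>R ?v)"
        by (rule integral_FTC_Icc_real[OF _ dF cF]) (use lu in auto)
      also have "F (x + ?a *\<^sub>R ?v) = F (x + ?b *\<^sub>R ?v)"
        by (rule ends) (auto simp: axis_def)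
      finally show ?thesis by simp
    qed
  qed
qed

context two_weights begin

lemma dsq_shift: "v $ p = 0 \<Longrightarrow> v $ r = 0 \<Longrightarrow> dsq p r (x + v) = dsq p r x"
  by (simp add: dsq_def)

lemma param_shift:
  assumes v: "v $ p = 0" "v $ r = 0" "\<And>k. \<exists>m::int. v $ k = 2 * pi * of_int m"
  shows "param p r q (x + v) = param p r q x"
proof -
  have "cos (x $ k + v $ k) = cos (x $ k)" "sin (x $ k + v $ k) = sin (x $ k)" for k
    using v(3)[of k] by (auto simp: cos_add sin_add)
  moreover have "modulus p r q (x + v) k = modulus p r q x k" for k by (simp add: modulus_def dsq_shift[OF v(1,2)])
  ultimately show ?thesis by (simp add: param_def vec_eq_iff v)
qed

text \<open>Charts with the same disc coordinate whose angles differ by multiples of \<open>2\<pi>\<close> are related by translations, under which the components of a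
  tensor do not change.\<close>

lemma lift_shift:
  assumes A: "two_form Atl A" and v: "v $ p = 0" "v $ r = 0" "\<And>k. \<exists>m::int. v $ k = 2 * pi * of_int m"
    and y: "y \<in> box_around p r \<theta>" "y + v \<in> box_around p r \<theta>'"
  shows "A (torus_chart p r q \<theta>) y i j = A (torus_chart p r q \<theta>') (y + v) i j"
proof -
  let ?c = "torus_chart p r q \<theta>" and ?d = "torus_chart p r q \<theta>'"
  note pv = param_shift[OF v]
  have ov: "z \<in> overlap ?c ?d" "transition ?c ?d z = z + v"
    if z: "z \<in> box_around p r \<theta>" "z + v \<in> box_around p r \<theta>'" for z
  proof -
    have "param p r q z \<in> patch p r q \<theta>" "param p r q z \<in> patch p r q \<theta>'" "coords p r \<theta> (param p r q z) = z"
      using param_patch[OF z(1)] param_patch[OF z(2)] by (simp_all add: pv)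
    then show "z \<in> overlap ?c ?d" unfolding overlap_def torus_chart_def fst_conv snd_conv by (metis IntI imageI)
    show "transition ?c ?d z = z + v"
      unfolding transition_def pt_torus_chart[OF z(1)] using param_patch(2)[OF z(2)] by (simp add: pv torus_chart_def)
  qed
  define N where "N = box_around p r \<theta> \<inter> (\<lambda>z. z + v) -` box_around p r \<theta>'"
  have N: "open N" "y \<in> N"
    unfolding N_def using y by (auto intro!: open_Int open_box open_vimage continuous_intros)
  have "((\<lambda>z. z + v) has_derivative (\<lambda>h. h)) (at y)" by (auto intro!: derivative_eq_intros)
  then have "frechet_derivative (transition ?c ?d) (at y) = (\<lambda>h. h)"
    using frechet_derivative_cong_open[OF N, of "transition ?c ?d" "\<lambda>z. z + v"] ov(2) frechet_derivative_at
    by (metis (no_types, lifting) IntD1 IntD2 N_def vimageD)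
  then have J: "jac ?c ?d y k i = (if k = i then 1 else 0)" for k i by (simp add: jac_def axis_def)
  have "A ?c y i j = (\<Sum>k\<in>UNIV. \<Sum>l\<in>UNIV. jac ?c ?d y k i * jac ?c ?d y l j * A ?d (transition ?c ?d y) k l)"
    using A ov(1)[OF y] atlas_in unfolding two_form_def smooth_tensor2_def by blast
  also have "\<dots> = A ?d (y + v) i j"
  proof -
    have "(\<Sum>l\<in>UNIV. (if k = i then 1 else 0) * (if l = j then 1 else 0) * A ?d (y + v) k l)
        = (if k = i then A ?d (y + v) i j else 0)" for k
    proof -
      have "(if k = i then 1 else 0) * (if l = j then 1 else 0) * A ?d (y + v) k l
          = (if l = j then (if k = i then A ?d (y + v) i j else 0) else 0)" for l by simp
      then show ?thesis by simp
    qed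
    then show ?thesis unfolding J ov(2)[OF y] by simp
  qed
  finally show ?thesis .
qed

context
  fixes f :: "'n ambient \<Rightarrow> real" and A :: "('n ambient, 'n) tensor2"
  assumes f: "C1_multiplier f" and A: "two_form Atl A"
    and cutoff: "\<And>y. y \<in> M \<Longrightarrow> dotc p y y \<ge> 3/4 \<Longrightarrow> f y = 0"
begin

text \<open>The components of \<open>f A\<close>, pulled back to \<open>\<real>\<^sup>n\<close> along \<open>param\<close>: at each \<open>x\<close> they are taken in the chart centred at \<open>x\<close> itself, so no
  angle is excluded. The cutoff makes the extension by \<open>0\<close> beyond \<open>|z\<^sub>p| = 1\<close> of class \<open>C\<^sup>1\<close>.\<close>

definition lifted :: "'n \<Rightarrow> 'n \<Rightarrow> real^'n \<Rightarrow> real" where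
  "lifted i j x = (if dsq p r x < 1 then scaled f A (torus_chart p r q x) x i j else 0)"

lemma own_box: "dsq p r x < 1 \<Longrightarrow> x \<in> box_around p r x"
  by (simp add: box_around_def)

lemma f_param:
  assumes "x \<in> box_around p r \<theta>" "dsq p r x \<ge> 3/4"
  shows "f (pt (torus_chart p r q \<theta>) x) = 0"
proof (rule cutoff)
  have xs: "x \<in> solid p r" using assms(1) box_solid by blast
  show "pt (torus_chart p r q \<theta>) x \<in> M" unfolding pt_torus_chart[OF assms(1)] by (rule param_in[OF xs])
  show "3/4 \<le> dotc p (pt (torus_chart p r q \<theta>) x) (pt (torus_chart p r q \<theta>) x)"
    unfolding pt_torus_chart[OF assms(1)] using assms(2) by (simp add: dotc_def param_nth dsq_def power2_eq_square)
qed

lemma lifted_box: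
  assumes y: "y \<in> box_around p r \<theta>"
  shows "lifted i j y = scaled f A (torus_chart p r q \<theta>) y i j"
proof -
  have s: "dsq p r y < 1" using y by (simp add: box_around_def)
  have "A (torus_chart p r q y) y i j = A (torus_chart p r q \<theta>) y i j"
    using lift_shift[OF A, of 0 y y \<theta>] y own_box[OF s] by (simp add: exI[of _ 0])
  then show ?thesis using s by (simp add: lifted_def scaled_def pt_torus_chart[OF y] pt_torus_chart[OF own_box[OF s]])
qed

lemma lifted_outer:
  assumes "dsq p r y \<ge> 3/4" shows "lifted i j y = 0"
  using f_param[OF own_box assms] assms by (simp add: lifted_def scaled_def)

lemma lifted_periodic:
  assumes v: "v $ p = 0" "v $ r = 0" "\<And>k. \<exists>m::int. v $ k = 2 * pi * of_int m"
  shows "lifted i j (x + v) = lifted i j x"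
proof (cases "dsq p r x < 1")
  case True
  then have t': "dsq p r (x + v) < 1" by (simp add: dsq_shift[OF v(1,2)])
  note pv = param_shift[OF v]
  show ?thesis
    using True t' lift_shift[OF A v own_box[OF True] own_box[OF t'], of i j]
    by (simp add: lifted_def scaled_def pt_torus_chart[OF own_box[OF True]] pt_torus_chart[OF own_box[OF t']] pv)
qed (simp add: lifted_def dsq_shift[OF v(1,2)])

lemma open_outer: "open {y::real^'n. dsq p r y > 3/4}"
  by (rule open_Collect_less[OF continuous_on_const continuous_dsq])

lemma lifted_C1:
  shows "lifted i j differentiable (at x)" and "isCont (pd k (lifted i j)) x"
proof -
  have "lifted i j differentiable (at x) \<and> isCont (pd k (lifted i j)) x"
  proof (cases "dsq p r x < 1")
    case True
    note o = own_box[OF True]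
    let ?c = "torus_chart p r q x"
    have c: "?c \<in> Atl" "img ?c = box_around p r x" by (simp_all add: atlas_in img_torus_chart)
    have "(lifted i j has_derivative D) (at x) \<longleftrightarrow> ((\<lambda>y. scaled f A ?c y i j) has_derivative D) (at x)" for D
      by (rule has_derivative_cong_open[OF open_box o lifted_box])
    then have d: "lifted i j differentiable (at x)"
      using scaled_differentiable[OF f A c(1), of x i j] o c(2) by (simp add: differentiable_def)
    have "continuous_on (box_around p r x) (pd k (\<lambda>y. scaled f A ?c y i j))"
      using continuous_pd_scaled[OF f A c(1)] c(2) by simp
    then have "continuous_on (box_around p r x) (pd k (lifted i j))"
      by (rule continuous_on_eq) (rule pd_cong_open[OF open_box _ lifted_box, symmetric])
    then show ?thesis using d o open_box continuous_on_eq_continuous_at by blast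
  next
    case False
    then have o: "x \<in> {y. dsq p r y > 3/4}" by simp
    have z: "lifted i j y = 0" if "y \<in> {y. dsq p r y > 3/4}" for y using that lifted_outer by simp
    have "(lifted i j has_derivative D) (at y) \<longleftrightarrow> ((\<lambda>y. 0) has_derivative D) (at y)" if "y \<in> {y. dsq p r y > 3/4}" for D y
      by (rule has_derivative_cong_open[OF open_outer that z])
    then have hd: "(lifted i j has_derivative (\<lambda>h. 0)) (at y)" if "y \<in> {y. dsq p r y > 3/4}" for y
      using that by simp
    then have "pd k (lifted i j) y = 0" if "y \<in> {y. dsq p r y > 3/4}" for y using pd_eqI[OF hd[OF that]] by simp
    then have "continuous_on {y. dsq p r y > 3/4} (pd k (lifted i j))"
      using continuous_on_cong[OF refl] continuous_on_const by metis
    then show ?thesis using hd[OF o] o open_outer continuous_on_eq_continuous_at differentiable_def by blast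
  qed
  then show "lifted i j differentiable (at x)" "isCont (pd k (lifted i j)) x" by auto
qed

lemma pd_lifted_outer: "dsq p r x \<ge> 1 \<Longrightarrow> pd k (lifted i j) x = 0"
proof -
  assume "dsq p r x \<ge> 1"
  then have o: "x \<in> {y. dsq p r y > 3/4}" by simp
  have "pd k (lifted i j) x = pd k (\<lambda>y. 0) x"
    by (rule pd_cong_open[OF open_outer o]) (simp add: lifted_outer)
  then show "pd k (lifted i j) x = 0" by (simp add: pd_eqI[OF has_derivative_const])
qed

text \<open>The box spanned by \<open>corner (- 1)\<close> and \<open>corner 1\<close> is the square \<open>[- 1, 1]\<^sup>2\<close> around the disc times one period of each angle.\<close>

definition corner :: "real \<Rightarrow> real^'n" where
  "corner t = (\<chi> k. if k = p \<or> k = r then t else t * pi)"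

text \<open>The domain of \<open>base\<close> may be replaced by a box: the two differ by a null set and by points where \<open>lifted\<close> vanishes. On opposite
  faces of the box \<open>lifted\<close> takes equal values, zero in the disc directions and by periodicity in the angular direction.\<close>

lemma integral_pd_lifted:
  assumes k: "k = p \<or> k = r \<or> k = q"
  shows "integrable lborel (\<lambda>x. indicator (img base) x * pd k (lifted i j) x)"
    "(\<integral>x. indicator (img base) x * pd k (lifted i j) x \<partial>lborel) = 0"
proof -
  let ?B = "cbox (corner (- 1)) (corner 1)"
  have cont: "continuous_on UNIV (pd k (lifted i j))"
    using lifted_C1(2) by (simp add: continuous_at_imp_continuous_on)
  have ends: "lifted i j x = lifted i j y"
    if xy: "x $ k = corner (- 1) $ k" "y $ k = corner 1 $ k" "\<And>l. l \<noteq> k \<Longrightarrow> x $ l = y $ l" for x y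
  proof (cases "k = q")
    case False
    then have "x $ k = - 1" "y $ k = 1" "k = p \<or> k = r" using xy k by (auto simp: corner_def)
    then have "dsq p r x \<ge> 3/4" "dsq p r y \<ge> 3/4" by (auto simp: dsq_def)
    then show ?thesis by (simp add: lifted_outer)
  next
    case True
    have "y = x + axis k (2 * pi)"
      using xy True by (simp add: vec_eq_iff corner_def axis_def)
    moreover have "\<exists>m::int. axis k (2 * pi) $ l = 2 * pi * of_int m" for l
      by (cases "l = k") (auto simp: axis_def intro: exI[of _ 1] exI[of _ 0])
    ultimately show ?thesis
      using lifted_periodic[of "axis k (2 * pi)" i j x] True by (simp add: axis_def)
  qed
  have lu: "corner (- 1) $ k \<le> corner 1 $ k" by (simp add: corner_def)
  note b = integral_partial_over_box[OF lifted_C1(1) cont ends lu]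
  have imgb: "x \<in> img base \<longleftrightarrow> dsq p r x < 1 \<and> (\<forall>k. k \<noteq> p \<longrightarrow> k \<noteq> r \<longrightarrow> \<bar>x $ k\<bar> < pi)" for x
    by (simp add: base_def img_torus_chart box_around_def)
  have e: "indicator (img base) x * pd k (lifted i j) x = indicator ?B x * pd k (lifted i j) x" if x: "x \<notin> cuts 0" for x
  proof (cases "dsq p r x < 1")
    case True
    have "(x $ p)^2 \<le> 1" "(x $ r)^2 \<le> 1"
      using True zero_le_power2[of "x $ p"] zero_le_power2[of "x $ r"] unfolding dsq_def by linarith+
    then have pr: "\<bar>x $ p\<bar> \<le> 1" "\<bar>x $ r\<bar> \<le> 1" by (simp_all add: abs_square_le_1)
    have ne: "\<bar>x $ l\<bar> \<noteq> pi" for l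
    proof
      assume "\<bar>x $ l\<bar> = pi"
      then have "x $ l = of_int 1 * pi \<or> x $ l = of_int (- 1) * pi" by auto
      then obtain m :: int where "x $ l = of_int m * pi" by blast
      then have "x \<in> cuts 0" unfolding cuts_def by auto
      then show False using x by simp
    qed
    have "x \<in> img base \<longleftrightarrow> x \<in> ?B"
      unfolding imgb mem_box_cart corner_def using True pr ne by (auto simp: abs_less_iff abs_le_iff) (smt (verit))+
    then show ?thesis by (simp add: indicator_def)
  next
    case False
    then show ?thesis by (simp add: pd_lifted_outer)
  qed
  have AE: "AE x in lborel. indicator (img base) x * pd k (lifted i j) x = indicator ?B x * pd k (lifted i j) x"
    using AE_not_in[OF null_cuts[of 0]] by eventually_elim (rule e)
  have m: "(\<lambda>x. indicator (img base) x * pd k (lifted i j) x) \<in> borel_measurable lborel"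
    "(\<lambda>x. indicator ?B x * pd k (lifted i j) x) \<in> borel_measurable lborel"
    using borel_measurable_continuous_onI[OF cont] borel_img[OF base_in] by (auto intro!: borel_measurable_times borel_measurable_indicator)
  show "integrable lborel (\<lambda>x. indicator (img base) x * pd k (lifted i j) x)"
    by (rule integrable_cong_AE[OF m AE, THEN iffD2]) (rule b(1))
  show "(\<integral>x. indicator (img base) x * pd k (lifted i j) x \<partial>lborel) = 0"
    by (rule trans[OF integral_cong_AE[OF m AE] b(2)])
qed

text \<open>In the chart \<open>base\<close> the density \<open>sqrt (a * b) / \<Delta>\<close> cancels the factor \<open>\<Delta>\<close> in \<open>curl\<close>, and a sum of partial derivatives with constant coefficients remains.\<close>

lemma integral_curl_zero:
  "integrable vol (scalar_at Atl (curl f A))" "(\<integral>y. scalar_at Atl (curl f A) y \<partial>vol) = 0"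
proof -
  let ?F = "scalar_at Atl (curl f A)"
  note F = integrable_vol_continuous[OF continuous_curl[OF f A]]
  show "integrable vol ?F" by (rule F(2))
  have i: "img base = box_around p r 0" by (simp add: base_def img_torus_chart)
  have e: "indicator (img base) x * (dens (pt base x) * ?F (pt base x)) = 2 * sqrt (a * b) *
      (indicator (img base) x * pd p (lifted r q) x - indicator (img base) x * pd r (lifted p q) x
       + indicator (img base) x * pd q (lifted p r) x)" for x
  proof (cases "x \<in> img base")
    case True
    have x: "x \<in> box_around p r 0" using True i by simp
    have pd: "pd k (\<lambda>y. scaled f A base y i j) x = pd k (lifted i j) x" for k i j
      unfolding base_def by (rule pd_cong_open[OF open_box x]) (rule lifted_box[symmetric])
    have F1: "?F (pt base x) = dil p q a b (pt base x) * (2 * ext_deriv2 (scaled f A) base x p r q)"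
      unfolding scalar_at_curl[OF f A base_in True]
      by (rule curl_local[OF f A two_weights_axioms base_def base_in refl refl True])
    have K: "dens (pt base x) * (dil p q a b (pt base x) * (2 * X)) = 2 * sqrt (a * b) * X" for X
      using dil_pos(1)[OF base_in True] by (simp add: dens_def)
    show ?thesis unfolding F1 ext_deriv2_def pd K using True by simp
  qed simp
  have "(\<integral>y. ?F y \<partial>vol) = (\<integral>x. 2 * sqrt (a * b) *
      (indicator (img base) x * pd p (lifted r q) x - indicator (img base) x * pd r (lifted p q) x
       + indicator (img base) x * pd q (lifted p r) x) \<partial>lborel)"
    unfolding integral_vol[OF base_in F(1)] e ..
  also have "\<dots> = 2 * sqrt (a * b) * (0 - 0 + 0)"
    using integral_pd_lifted[of p] integral_pd_lifted[of r] integral_pd_lifted[of q] by simp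
  finally show "(\<integral>y. ?F y \<partial>vol) = 0" by simp
qed

end

end

section \<open>The codifferential and the soliton\<close>

lemma DERIV_pos_part_squared: "((\<lambda>y::real. (max 0 y)^2) has_real_derivative 2 * max 0 y) (at y)"
proof -
  consider "y < 0" | "y > 0" | "y = 0" by linarith
  then show ?thesis
  proof cases
    case 1
    have "((\<lambda>y::real. 0) has_real_derivative 2 * max 0 y) (at y)" using 1 by simp
    then show ?thesis
      by (rule has_field_derivative_transform_within_open[where S = "{..<0}"]) (use 1 in auto)
  next
    case 2
    have "((\<lambda>y::real. y^2) has_real_derivative 2 * max 0 y) (at y)" using 2 by (auto intro!: derivative_eq_intros)
    then show ?thesis
      by (rule has_field_derivative_transform_within_open[where S = "{0<..}"]) (use 2 in auto)
  next
    case 3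
    have "((\<lambda>h::real. max 0 h) \<longlongrightarrow> max 0 0) (at 0)" by (intro tendsto_max tendsto_const tendsto_ident_at)
    then have "((\<lambda>h::real. max 0 h) \<longlongrightarrow> 0) (at 0)" by simp
    then have "((\<lambda>h::real. ((max 0 (0 + h))^2 - (max 0 0)^2) / h) \<longlongrightarrow> 0) (at 0)"
      by (rule tendsto_cong[THEN iffD1, rotated]) (auto simp: eventually_at_filter power2_eq_square max_def)
    then show ?thesis unfolding 3 DERIV_def by simp
  qed
qed

text \<open>A partition of unity on the line by a function and its reflection. The smooth step is
  \<open>m(1/2 + y) / (m(1/2 + y) + m(1/2 - y))\<close> with \<open>m(y) = max(0, y)\<^sup>2\<close>.\<close>

lemma ex_C1_step:
  obtains \<sigma> \<sigma>' :: "real \<Rightarrow> real"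
  where "\<And>y. (\<sigma> has_real_derivative \<sigma>' y) (at y)" "continuous_on UNIV \<sigma>'"
    "\<And>y. y \<le> - 1/2 \<Longrightarrow> \<sigma> y = 0" "\<And>y. \<sigma> y + \<sigma> (- y) = 1"
proof -
  define m where "m y = (max 0 y)^2" for y :: real
  define N where "N y = m (1/2 + y) + m (1/2 - y)" for y
  have N: "N y > 0" for y
  proof -
    have "m (1/2 + y) > 0 \<or> m (1/2 - y) > 0" by (auto simp: m_def max_def)
    moreover have "m z \<ge> 0" for z by (simp add: m_def)
    ultimately show ?thesis unfolding N_def by (smt (verit))
  qed
  have dm: "((\<lambda>y. m (1/2 + y)) has_real_derivative 2 * max 0 (1/2 + y)) (at y)"
    "((\<lambda>y. m (1/2 - y)) has_real_derivative - (2 * max 0 (1/2 - y))) (at y)" for y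
    unfolding m_def
    using DERIV_chain2[OF DERIV_pos_part_squared DERIV_add[OF DERIV_const DERIV_ident], of "1/2" y UNIV]
      DERIV_chain2[OF DERIV_pos_part_squared DERIV_diff[OF DERIV_const DERIV_ident], of "1/2" y UNIV]
    by simp_all
  have dN: "(N has_real_derivative 2 * max 0 (1/2 + y) + - (2 * max 0 (1/2 - y))) (at y)" for y
    unfolding N_def[abs_def] by (rule DERIV_add[OF dm])
  define \<sigma>' where "\<sigma>' y = (2 * max 0 (1/2 + y) * N y - m (1/2 + y) * (2 * max 0 (1/2 + y) + - (2 * max 0 (1/2 - y)))) / (N y * N y)" for y
  show ?thesis
  proof (rule that[of "\<lambda>y. m (1/2 + y) / N y" \<sigma>'])
    show "((\<lambda>y. m (1/2 + y) / N y) has_real_derivative \<sigma>' y) (at y)" for y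
      unfolding \<sigma>'_def using N[of y] by (intro DERIV_divide dm dN) simp
    show "continuous_on UNIV \<sigma>'"
      unfolding \<sigma>'_def[abs_def] N_def m_def
      by (intro continuous_intros) (use N in \<open>force simp: N_def m_def\<close>)
    show "m (1/2 + y) / N y = 0" if "y \<le> - 1/2" for y
      using that by (simp add: m_def max_def)
    show "m (1/2 + y) / N y + m (1/2 + - y) / N (- y) = 1" for y
    proof -
      have "N (- y) = N y" by (simp add: N_def add.commute)
      then have "m (1/2 + y) / N y + m (1/2 + - y) / N (- y) = (m (1/2 + y) + m (1/2 - y)) / N y"
        by (simp add: add_divide_distrib)
      also have "m (1/2 + y) + m (1/2 - y) = N y" by (simp add: N_def)
      finally show ?thesis using N[of y] by simp
    qed
  qed
qed

context two_weights begin

lemma smooth_dotc_pt: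
  assumes c: "c \<in> Atl"
  shows "smooth_on (img c) (\<lambda>x. dotc k (pt c x) (pt c x))"
proof -
  have o: "open (img c)" by (rule chart_img_open[OF smooth_manifold_torus c])
  have l: "bounded_linear (\<lambda>y::'n ambient. fst y $ k)" "bounded_linear (\<lambda>y::'n ambient. snd y $ k)"
    by (rule bounded_linear_compose[OF bounded_linear_vec_nth bounded_linear_fst],
        rule bounded_linear_compose[OF bounded_linear_vec_nth bounded_linear_snd])
  show ?thesis
    unfolding dotc_def
    by (intro smooth_on_add smooth_on_mult o smooth_on_linear_compose[OF l(1) o smooth_pt_atlas[OF c]]
      smooth_on_linear_compose[OF l(2) o smooth_pt_atlas[OF c]])
qed

lemma smooth_inverse_dil:
  assumes c: "c \<in> Atl"
  shows "smooth_on (img c) (\<lambda>x. 1 / dil p q a b (pt c x))"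
  using chart_img_open[OF smooth_manifold_torus c] dil_pos(1)[OF c]
  by (intro smooth_on_divide smooth_on_const) (auto simp: dil_def[abs_def] intro!: smooth_on_add smooth_on_mult smooth_on_const smooth_dotc_pt[OF c])

lemma C1_multiplier_step:
  assumes \<sigma>: "\<And>y. (\<sigma> has_real_derivative \<sigma>' y) (at y)" "continuous_on UNIV \<sigma>'"
  shows "C1_multiplier (\<lambda>y. \<sigma> (1 - 2 * dotc k y y) * (1 / dil p q a b y))"
  unfolding C1_multiplier_def
proof (intro ballI conjI allI)
  fix c assume c: "c \<in> Atl"
  have o: "open (img c)" by (rule chart_img_open[OF smooth_manifold_torus c])
  define u where "u x = 1 - 2 * dotc k (pt c x) (pt c x)" for x
  define E where "E x = 1 / dil p q a b (pt c x)" for x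
  have u: "smooth_on (img c) u" unfolding u_def[abs_def]
    by (intro smooth_on_diff smooth_on_mult smooth_on_const smooth_dotc_pt[OF c] o)
  have E: "smooth_on (img c) E" unfolding E_def[abs_def] by (rule smooth_inverse_dil[OF c])
  have d: "((\<lambda>x. \<sigma> (u x) * E x) has_derivative
      (\<lambda>h. \<sigma> (u x) * frechet_derivative E (at x) h + \<sigma>' (u x) * frechet_derivative u (at x) h * E x)) (at x)"
    if x: "x \<in> img c" for x
  proof (rule has_derivative_mult[OF _ smooth_on_has_derivative[OF E x]])
    show "((\<lambda>x. \<sigma> (u x)) has_derivative (\<lambda>h. \<sigma>' (u x) * frechet_derivative u (at x) h)) (at x)"
      by (rule has_derivative_compose[OF smooth_on_has_derivative[OF u x] \<sigma>(1)[unfolded has_field_derivative_def]])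
  qed
  show "(\<lambda>y. \<sigma> (1 - 2 * dotc k (pt c y) (pt c y)) * (1 / dil p q a b (pt c y))) differentiable (at x)" if "x \<in> img c" for x
    using d[OF that] unfolding u_def E_def differentiable_def by blast
  fix i
  have "continuous_on UNIV \<sigma>" using \<sigma>(1) by (meson DERIV_isCont continuous_at_imp_continuous_on)
  then have "continuous_on (img c) (\<lambda>x. \<sigma> (u x))" "continuous_on (img c) (\<lambda>x. \<sigma>' (u x))"
    using \<sigma>(2) smooth_on_continuous_on[OF u] by (auto intro: continuous_on_compose2)
  then have "continuous_on (img c) (\<lambda>x. \<sigma> (u x) * pd i E x + \<sigma>' (u x) * pd i u x * E x)"
    by (intro continuous_on_add continuous_on_mult smooth_on_continuous_on[OF E] smooth_on_continuous_on[OF smooth_on_pd[OF E]]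
      smooth_on_continuous_on[OF smooth_on_pd[OF u]])
  then have "continuous_on (img c) (pd i (\<lambda>x. \<sigma> (u x) * E x))"
    by (rule continuous_on_eq) (simp only: pd_eqI[OF d], simp add: pd_def)
  then show "continuous_on (img c) (pd i (\<lambda>y. \<sigma> (1 - 2 * dotc k (pt c y) (pt c y)) * (1 / dil p q a b (pt c y))))"
    unfolding u_def E_def .
qed

text \<open>The chart \<open>base\<close> in the definition of \<open>vol\<close> changes with the exchange of roles, but the Riemannian measure does not.\<close>

lemma swapped_objects:
  "two_weights.vol q r p b a = vol" "two_weights.curl q r p b a f A = curl f A"
  "two_weights.C1_multiplier q r p f \<longleftrightarrow> C1_multiplier f"
proof -
  interpret s: two_weights q r p b a by (rule swapped_weights)
  show "s.vol = vol"
    using s.riemannian_measure_eq_vol riemannian_measure_eq_vol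
    unfolding sphere_torus_swap[of q r p] torus_atlas_swap[of q r p] forms_swap(1)[of q r p b a] by simp
  have "s.scaled f A = scaled f A" by (intro ext) (simp add: s.scaled_def scaled_def)
  then show "s.curl f A = curl f A"
    unfolding s.curl_def[abs_def] curl_def[abs_def] dil_swap[of q p b a] forms_swap(1)[of q r p b a] forms_swap(2)[of q p b a] by simp
  show "s.C1_multiplier f \<longleftrightarrow> C1_multiplier f"
    unfolding s.C1_multiplier_def C1_multiplier_def torus_atlas_swap[of q r p] ..
qed

lemma inner_difference:
  assumes A: "two_form Atl A" and f: "C1_multiplier f1" "C1_multiplier f2"
    and sum: "\<And>y. y \<in> M \<Longrightarrow> f1 y + f2 y = 1 / dil p q a b y"
    and c: "c \<in> Atl" "x \<in> img c"
  shows "inner3 met (ext_deriv2 A) flux c x - inner2 met A coflux c x = curl f1 A c x + curl f2 A c x"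
proof -
  let ?B = "scaled (\<lambda>y. 1 / dil p q a b y) A"
  obtain p1 q1 a1 b1 \<theta>1 where c1: "two_weights p1 r q1 a1 b1" "c = torus_chart p1 r q1 \<theta>1" "img c = box_around p1 r \<theta>1"
    and e1: "metric_form p1 r q1 a1 b1 = metric_form p r q a b" "flux_form p1 q1 a1 b1 = flux_form p q a b"
    "coflux_form p1 q1 a1 b1 = coflux_form p q a b" "dil p1 q1 a1 b1 = dil p q a b"
    by (rule chart_locale[OF c(1)]) (rule that; assumption)
  interpret c: two_weights p1 r q1 a1 b1 by (rule c1(1))
  have o: "open (img c)" by (rule chart_img_open[OF smooth_manifold_torus c(1)])
  have S: "img c \<subseteq> solid p1 r" unfolding c1(3) by (rule c.box_solid)
  have comp: "met c y i j = c.G y i j" "flux c y i j k = c.cH (dsq p1 r y) * c.eps i j k"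
    "coflux c y i j = c.cC (dsq p1 r y) * (c.ang y i * c.Q j - c.ang y j * c.Q i)"
    "dil p q a b (pt c y) = c.cD (dsq p1 r y)" if "y \<in> img c" for y i j k
  proof -
    have y: "y \<in> box_around p1 r \<theta>1" using that unfolding c1(3) .
    note e = c.components(1-3)[OF y] c.frame_products(8)[OF y]
    show "met c y i j = c.G y i j" "flux c y i j k = c.cH (dsq p1 r y) * c.eps i j k"
      "coflux c y i j = c.cC (dsq p1 r y) * (c.ang y i * c.Q j - c.ang y j * c.Q i)"
      "dil p q a b (pt c y) = c.cD (dsq p1 r y)"
      by (rule e[unfolded e1, folded c1(2)])+
  qed
  have sB: "?B c y i j = scaled f1 A c y i j + scaled f2 A c y i j" if "y \<in> img c" for y i j
    using sum[of "pt c y"] pt_dom[OF c(1) that] dom_subset[OF c(1)] unfolding scaled_def by (metis (no_types, lifting) distrib_right subsetD)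
  have pdB: "pd k (\<lambda>y. ?B c y i j) x = pd k (\<lambda>y. scaled f1 A c y i j) x + pd k (\<lambda>y. scaled f2 A c y i j) x" for k i j
  proof -
    have "pd k (\<lambda>y. ?B c y i j) x = pd k (\<lambda>y. scaled f1 A c y i j + scaled f2 A c y i j) x"
      by (rule pd_cong_open[OF o c(2) sB])
    also have "\<dots> = pd k (\<lambda>y. scaled f1 A c y i j) x + pd k (\<lambda>y. scaled f2 A c y i j) x"
      using pd_eqI[OF has_derivative_add[OF scaled_derivative[OF f(1) A c] scaled_derivative[OF f(2) A c]]]
        pd_eqI[OF scaled_derivative[OF f(1) A c]] pd_eqI[OF scaled_derivative[OF f(2) A c]] by simp
    finally show ?thesis .
  qed
  have ext: "ext_deriv2 ?B c x i j k = ext_deriv2 (scaled f1 A) c x i j k + ext_deriv2 (scaled f2 A) c x i j k" for i j k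
    unfolding ext_deriv2_def pdB by simp
  note alt = alternatingD[OF alternating_scaled[OF f(1) A c]] alternatingD[OF alternating_scaled[OF f(2) A c]]
  have altB: "ext_deriv2 ?B c x j i k = - ext_deriv2 ?B c x i j k" "ext_deriv2 ?B c x i k j = - ext_deriv2 ?B c x i j k" for i j k
    unfolding ext using alt(1)[of j i k] alt(2)[of i k j] alt(3)[of j i k] alt(4)[of i k j] by simp_all
  have dA: "(\<lambda>y. A c y i j) differentiable (at x)" for i j
    by (rule smooth_on_differentiable[OF two_form_smooth[OF A c(1)] c(2)])
  have altA: "alternating (ext_deriv2 A c x)"
    by (rule alternating_ext_deriv2[where S = "img c"]) (rule o c(2) two_form_antisym[OF A c(1)] dA | assumption)+
  have "inner3 met (ext_deriv2 A) flux c x - inner2 met A coflux c x = c.cD (dsq p1 r x) * inner3 met (ext_deriv2 ?B) flux c x"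
  proof (rule c.inner_difference_local[where S = "img c"])
    show "?B c y i j = A c y i j / c.cD (dsq p1 r y)" if "y \<in> img c" for y i j
      unfolding scaled_def comp(4)[OF that] by simp
    show "A c y j i = - A c y i j" if "y \<in> img c" for y i j by (rule two_form_antisym[OF A c(1) that])
  qed (rule o c(2) S comp dA altB alternatingD[OF altA])+
  moreover have "inner3 met (ext_deriv2 ?B) flux c x = 2 * ext_deriv2 ?B c x p1 r q1"
    by (rule c.inner3_local) (rule comp altB subsetD[OF S c(2)] c(2))+
  ultimately show ?thesis
    using curl_local[OF f(1) A c1(1,2) c(1) e1(1,2) c(2)] curl_local[OF f(2) A c1(1,2) c(1) e1(1,2) c(2)] comp(4)[OF c(2)]
    by (simp add: ext algebra_simps)
qed

text \<open>With \<open>t = |z\<^sub>p|\<^sup>2\<close> and \<open>1 - t = |z\<^sub>q|\<^sup>2\<close> the arguments \<open>1 - 2|z\<^sub>p|\<^sup>2\<close> and \<open>1 - 2|z\<^sub>q|\<^sup>2\<close> of the step function are opposite, so the step function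
  splits \<open>1/\<Delta>\<close> into two parts. Integration by parts applies to the first in charts with disc coordinate \<open>z\<^sub>p\<close> and to the second
  in charts with disc coordinate \<open>z\<^sub>q\<close>.\<close>

lemma codifferential: "is_codifferential (top_of_set M) Atl met flux coflux"
  unfolding is_codifferential_def riemannian_measure_eq_vol
proof (intro conjI two_form_coflux allI impI)
  fix A assume A: "two_form Atl A"
  obtain \<sigma> \<sigma>' :: "real \<Rightarrow> real" where \<sigma>: "\<And>y. (\<sigma> has_real_derivative \<sigma>' y) (at y)" "continuous_on UNIV \<sigma>'"
    "\<And>y. y \<le> - 1/2 \<Longrightarrow> \<sigma> y = 0" "\<And>y. \<sigma> y + \<sigma> (- y) = 1" by (rule ex_C1_step) blast
  define f where "f k y = \<sigma> (1 - 2 * dotc k y y) * (1 / dil p q a b y)" for k y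
  have f: "C1_multiplier (f k)" for k unfolding f_def[abs_def] by (rule C1_multiplier_step[OF \<sigma>(1,2)])
  have sum: "f p y + f q y = 1 / dil p q a b y" if "y \<in> M" for y
  proof -
    have "dotc p y y + dotc q y y = 1" using that by (simp add: sphere_torus_def dotc_def power2_eq_square)
    then have "1 - 2 * dotc q y y = - (1 - 2 * dotc p y y)" by simp
    then have "\<sigma> (1 - 2 * dotc p y y) + \<sigma> (1 - 2 * dotc q y y) = 1" using \<sigma>(4) by metis
    then show ?thesis unfolding f_def by (metis distrib_right mult_1)
  qed
  have cut: "f k y = 0" if "dotc k y y \<ge> 3/4" for k y
    using \<sigma>(3)[of "1 - 2 * dotc k y y"] that by (simp add: f_def)
  let ?F = "\<lambda>k. scalar_at Atl (curl (f k) A)"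
  have Fp: "integrable vol (?F p)" "(\<integral>y. ?F p y \<partial>vol) = 0"
    using integral_curl_zero[OF f A cut] by auto
  interpret s: two_weights q r p b a by (rule swapped_weights)
  have Fq: "integrable vol (?F q)" "(\<integral>y. ?F q y \<partial>vol) = 0"
    using s.integral_curl_zero[of "f q" A] f[of q] A cut[of q]
    unfolding swapped_objects torus_atlas_swap[of q r p] by auto
  let ?I3 = "scalar_at Atl (inner3 met (ext_deriv2 A) flux)" and ?I2 = "scalar_at Atl (inner2 met A coflux)"
  have pw: "?I3 y = ?I2 y + (?F p y + ?F q y)" if y: "y \<in> M" for y
  proof -
    define c where "c = (SOME c. c \<in> Atl \<and> y \<in> cdom c)"
    have "\<exists>c. c \<in> Atl \<and> y \<in> cdom c" using finite_subatlas y by blast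
    then have c: "c \<in> Atl" "y \<in> cdom c" unfolding c_def using someI_ex[of "\<lambda>c. c \<in> Atl \<and> y \<in> cdom c"] by blast+
    then have "coord c y \<in> img c" by (simp add: img_def)
    then show ?thesis
      using inner_difference[OF A f f sum c(1), of "coord c y"] by (simp add: scalar_at_def c_def[symmetric])
  qed
  have sp: "space vol = M" by (simp add: vol_def chart_measure_def space_borel_M)
  have F: "integrable vol (\<lambda>y. ?F p y + ?F q y)" "(\<integral>y. ?F p y + ?F q y \<partial>vol) = 0"
    using Fp Fq by simp_all
  have eq: "(\<integral>y. ?I3 y \<partial>vol) = (\<integral>y. ?I2 y + (?F p y + ?F q y) \<partial>vol)"
    by (rule Bochner_Integration.integral_cong) (simp_all add: sp pw)
  \<comment> \<open>If the right-hand integrand were not integrable, neither would be the left-hand one, and both integrals would be 0 by convention.\<close>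
  show "(\<integral>y. ?I3 y \<partial>vol) = (\<integral>y. ?I2 y \<partial>vol)"
  proof (cases "integrable vol ?I2")
    case True
    show ?thesis unfolding eq Bochner_Integration.integral_add[OF True F(1)] F(2) by simp
  next
    case False
    have "\<not> integrable vol (\<lambda>y. ?I2 y + (?F p y + ?F q y))"
    proof
      assume "integrable vol (\<lambda>y. ?I2 y + (?F p y + ?F q y))"
      from Bochner_Integration.integrable_diff[OF this F(1)] show False using False by simp
    qed
    then show ?thesis unfolding eq using False by (simp add: not_integrable_integral_eq)
  qed
qed

lemma soliton: "generalized_steady_soliton (top_of_set M) Atl met flux pot"
  unfolding generalized_steady_soliton_def
proof (intro conjI)
  show "\<forall>c\<in>Atl. \<forall>x\<in>img c. \<forall>i j. ricci met c x i j - 1/4 * H_squared met flux c x i j + hessian met pot c x i j = 0"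
    using chart_fields(10) by blast
  show "\<exists>D. is_codifferential (top_of_set M) Atl met flux D \<and> (\<forall>c\<in>Atl. \<forall>x\<in>img c. \<forall>i j.
      1/2 * D c x i j + interior_product (\<lambda>c x k. 1/2 * gradient met pot c x k) flux c x i j = 0)"
    by (rule exI[of _ coflux], rule conjI, rule codifferential, intro ballI allI, rule chart_fields(11))
  show "riemannian_metric Atl met" by (rule riemannian_metric_met)
  show "closed_three_form Atl flux" by (rule closed_flux)
  show "smooth_function Atl pot" by (rule smooth_potential)
qed

text \<open>The value of the potential on the circle \<open>z\<^sub>p = 0\<close>. With the roles exchanged, its value on the circle \<open>z\<^sub>q = 0\<close> is \<open>- ln b\<close>.\<close>

lemma potential_values:
  "param p r q 0 \<in> M" "pot (param p r q 0) = - ln a"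
  by (auto intro!: param_in simp: solid_def dsq_def potential_def dil_def dotc_def param_nth modulus_def)

end

(* The points are taken from real^'n x real^'n, with an arbitrary topology X. This is no
   restriction: every closed n-manifold has the cardinality of the continuum. *)

theorem corollary1p3:
  fixes n :: nat
  assumes "n \<ge> 3" and "CARD('n::finite) = n"
  shows "\<exists>(X :: ((real^'n) \<times> (real^'n)) topology)
           (A :: ((real^'n) \<times> (real^'n), 'n) chart set) g H f.
           smooth_manifold X A \<and> compact_space X \<and> connected_space X \<and>
           generalized_steady_soliton X A g H f \<and> \<not> f constant_on topspace X"
proof -
  have "3 \<le> card (UNIV :: 'n set)" using assms by simp
  then obtain T :: "'n set" where "card T = 3" using obtain_subset_with_card_n by metis
  then obtain p r q :: 'n where pqr: "p \<noteq> r" "p \<noteq> q" "r \<noteq> q" unfolding card_3_iff by blast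
  interpret two_weights p r q 1 2 by unfold_locales (use pqr in auto)
  interpret s: two_weights q r p 2 1 by (rule swapped_weights)
  let ?X = "top_of_set (sphere_torus p r q)"
  have "compact_space ?X" using compact_torus by (simp add: compact_space_subtopology)
  moreover have "connected_space ?X" using connected_torus by (simp add: connected_space_subtopology)
  moreover have "\<not> pot constant_on topspace ?X"
  proof
    assume "pot constant_on topspace ?X"
    then obtain v where "\<And>y. y \<in> sphere_torus p r q \<Longrightarrow> pot y = v" unfolding constant_on_def by auto
    then have "pot (param p r q 0) = pot (param q r p 0)"
      using potential_values(1) s.potential_values(1) unfolding sphere_torus_swap[of q r p] by metis
    then show False
      using potential_values(2) s.potential_values(2) unfolding forms_swap(4)[of q p 2 1] by simp
  qed
  ultimately show ?thesis
    using smooth_manifold_torus soliton by blast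
qed

end
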